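(* Let $w_1,w_2,w_3$ be coprime positive integers, let $f(x_1,x_2,x_3)$ be a polynomial with real coefficients which is weighted homogeneous with respect to $w=(w_1,w_2,w_3)$, and let $X=\{(x_1,x_2,x_3)\in\mathbb{C}^3 : f(x_1,x_2,x_3)=0\}$ be the surface defined by $f$. Suppose that $X$ is irreducible and that the singularity of $X$ at $0\in\mathbb{C}^3$ is isolated. Put $X(\mathbb{R})=\{(x_1,x_2,x_3)\in\mathbb{R}^3 : f(x_1,x_2,x_3)=0\}$. If 1. $2w_3<\inf\{w_1,w_2\}$; 2. $X(\mathbb{R})\neq\{0\}$; 3. $X(\mathbb{R})\cap\{(x_1,x_2,x_3)\in\mathbb{R}^3 : x_1x_2x_3=0\}=\{0\}$, then the singularity of $X$ at $0\in\mathbb{C}^3$ is not strongly metrically conic.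
   Context: A nonzero polynomial $f$ is weighted homogeneous with respect to $w=(w_1,w_2,w_3)$ if there is a positive integer $d$ such that $f(t^{w_1}x_1,t^{w_2}x_2,t^{w_3}x_3)=t^d f(x_1,x_2,x_3)$ for all $t\in\mathbb{C}^*=\mathbb{C}\setminus\{0\}$ and all $(x_1,x_2,x_3)\in\mathbb{C}^3$. "Coprime" means that the three integers have no common factor greater than $1$. Inner metric: for a connected set $Z$ (an algebraic set, its intersection with a ball, or a cone) in a Euclidean space, the inner distance $d(x,y)$ between $x,y\in Z$ is the infimum of the lengths of rectifiable arcs $\gamma:[0,1]\to Z$ with $\gamma(0)=x$, $\gamma(1)=y$. Strongly metrically conic: let $X\subset\mathbb{C}^n$ be an algebraic set and $x_0\in X$ a singular point. Let $B_\epsilon[x_0]$ and $S_\epsilon(x_0)$ be the closed ball and the sphere of radius $\epsilon$ centered at $x_0$ in $\mathbb{C}^n\cong\mathbb{R}^{2n}$, and let $c[X\cap S_\epsilon(x_0)]$ be the cone over $X\cap S_\epsilon(x_0)$ (the union of the straight segments joining $x_0$ to the points of $X\cap S_\epsilon(x_0)$). The point $x_0$ is a strongly metrically conic singular point of $X$ if for all sufficiently small $\epsilon>0$ there exists a semialgebraic homeomorphism $h:c[X\cap S_\epsilon(x_0)]\to X\cap B_\epsilon[x_0]$ which is bi-Lipschitz with respect to the inner metrics. (Semialgebraicity is understood after identifying $\mathbb{C}^n$ with $\mathbb{R}^{2n}$.) *)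

theory Defs
  imports "HOL-Analysis.Analysis" "HOL-Library.Poly_Mapping"
begin

section \<open>Polynomials and algebraic sets\<close>

text \<open>A polynomial in variables indexed by \<open>'n\<close> is a finitely supported map from exponent
  vectors to coefficients.\<close>

type_synonym ('n, 'a) mpoly = "('n \<Rightarrow>\<^sub>0 nat) \<Rightarrow>\<^sub>0 'a"

definition mpoly_eval :: "('n::finite, 'a::comm_semiring_1) mpoly \<Rightarrow> 'a ^ 'n \<Rightarrow> 'a" where
  "mpoly_eval p x = (\<Sum>m\<in>Poly_Mapping.keys p.
     Poly_Mapping.lookup p m * (\<Prod>i\<in>UNIV. (x $ i) ^ Poly_Mapping.lookup m i))"

definition complexify :: "('n, real) mpoly \<Rightarrow> ('n, complex) mpoly" where
  "complexify p = Poly_Mapping.map complex_of_real p"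

definition zero_set :: "('n::finite, 'a::comm_semiring_1) mpoly \<Rightarrow> ('a ^ 'n) set" where
  "zero_set p = {x. mpoly_eval p x = 0}"

definition weighted_homogeneous :: "nat ^ 'n \<Rightarrow> ('n::finite, complex) mpoly \<Rightarrow> bool" where
  "weighted_homogeneous w p \<longleftrightarrow> p \<noteq> 0 \<and>
     (\<exists>d::nat. d > 0 \<and> (\<forall>t::complex. t \<noteq> 0 \<longrightarrow> (\<forall>x.
        mpoly_eval p (\<chi> i. t ^ (w $ i) * x $ i) = t ^ d * mpoly_eval p x)))"

definition algebraic_set :: "(complex ^ 'n::finite) set \<Rightarrow> bool" where
  "algebraic_set Z \<longleftrightarrow> (\<exists>P. Z = (\<Inter>p\<in>P. zero_set p))"

definition irreducible_algebraic_set :: "(complex ^ 'n::finite) set \<Rightarrow> bool" where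
  "irreducible_algebraic_set Z \<longleftrightarrow> algebraic_set Z \<and> Z \<noteq> {} \<and>
     (\<forall>A B. algebraic_set A \<and> algebraic_set B \<and> Z = A \<union> B \<longrightarrow> Z = A \<or> Z = B)"

definition vanishing_ideal :: "(complex ^ 'n::finite) set \<Rightarrow> ('n, complex) mpoly set" where
  "vanishing_ideal Z = {p. Z \<subseteq> zero_set p}"

definition mpoly_gradient :: "('n::finite, complex) mpoly \<Rightarrow> complex ^ 'n \<Rightarrow> complex ^ 'n" where
  "mpoly_gradient p x =
     (\<chi> i. deriv (\<lambda>z. mpoly_eval p (\<chi> j. if j = i then z else x $ j)) (x $ i))"

text \<open>A point of an algebraic set \<open>Z\<close> is regular if near it \<open>Z\<close> is cut out by finitely many
  polynomials vanishing on \<open>Z\<close> whose complex gradients at the point are linearly independent;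
  all other points of \<open>Z\<close> are singular.  Only the set \<open>Z\<close> enters, so a non-reduced defining
  equation does not create singular points.\<close>

definition regular_points :: "(complex ^ 'n::finite) set \<Rightarrow> (complex ^ 'n) set" where
  "regular_points Z = {x \<in> Z. \<exists>P U. finite P \<and> P \<subseteq> vanishing_ideal Z \<and>
     inj_on (\<lambda>p. mpoly_gradient p x) P \<and> vec.independent ((\<lambda>p. mpoly_gradient p x) ` P) \<and>
     open U \<and> x \<in> U \<and> Z \<inter> U = (\<Inter>p\<in>P. zero_set p) \<inter> U}"

definition singular_points :: "(complex ^ 'n::finite) set \<Rightarrow> (complex ^ 'n) set" where
  "singular_points Z = Z - regular_points Z"

section \<open>Semialgebraic sets\<close>

text \<open>\<^const>\<open>real_polynomial_function\<close> on a finite-dimensional real vector space consists of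
  the polynomials in real linear coordinates, so on \<open>\<complex>\<^sup>n\<close> these are the real polynomials
  in the real and imaginary parts of the coordinates.\<close>

definition basic_semialgebraic :: "'a::euclidean_space set \<Rightarrow> bool" where
  "basic_semialgebraic S \<longleftrightarrow> (\<exists>P Q. finite P \<and> finite Q \<and>
     (\<forall>p\<in>P \<union> Q. real_polynomial_function p) \<and>
     S = {x. (\<forall>p\<in>P. p x = 0) \<and> (\<forall>q\<in>Q. q x > 0)})"

definition semialgebraic :: "'a::euclidean_space set \<Rightarrow> bool" where
  "semialgebraic S \<longleftrightarrow> (\<exists>F. finite F \<and> (\<forall>B\<in>F. basic_semialgebraic B) \<and> S = \<Union>F)"

definition semialgebraic_map_on ::
  "'a::euclidean_space set \<Rightarrow> ('a \<Rightarrow> 'b::euclidean_space) \<Rightarrow> bool" where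
  "semialgebraic_map_on S h \<longleftrightarrow> semialgebraic ((\<lambda>x. (x, h x)) ` S)"

section \<open>Inner metric\<close>

definition arc_length :: "(real \<Rightarrow> 'a::metric_space) \<Rightarrow> ennreal" where
  "arc_length g = (SUP (n, t) \<in> {(n::nat, t::nat \<Rightarrow> real). mono_on {..n} t \<and> t ` {..n} \<subseteq> {0..1}}.
     ennreal (\<Sum>i<n. dist (g (t i)) (g (t (Suc i)))))"

text \<open>The value is \<open>\<infinity>\<close> if no rectifiable path in \<open>Z\<close> joins the two points.  Paths need
  not be injective, so that the distance from a point to itself is \<open>0\<close>.\<close>

definition inner_dist :: "'a::metric_space set \<Rightarrow> 'a \<Rightarrow> 'a \<Rightarrow> ennreal" where
  "inner_dist Z x y = (INF g \<in> {g. path g \<and> path_image g \<subseteq> Z \<and> pathstart g = x \<and>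
     pathfinish g = y \<and> arc_length g < \<infinity>}. arc_length g)"

definition inner_bi_lipschitz ::
  "'a::metric_space set \<Rightarrow> 'b::metric_space set \<Rightarrow> ('a \<Rightarrow> 'b) \<Rightarrow> bool" where
  "inner_bi_lipschitz S T h \<longleftrightarrow> (\<exists>K::real. K > 0 \<and> (\<forall>x\<in>S. \<forall>y\<in>S.
     inner_dist T (h x) (h y) \<le> ennreal K * inner_dist S x y \<and>
     inner_dist S x y \<le> ennreal K * inner_dist T (h x) (h y)))"

section \<open>Strongly metrically conic points\<close>

definition cone_over :: "'a::real_vector \<Rightarrow> 'a set \<Rightarrow> 'a set" where
  "cone_over x0 L = (\<Union>y\<in>L. closed_segment x0 y)"

definition strongly_metrically_conic ::
  "(complex ^ 'n::finite) set \<Rightarrow> complex ^ 'n \<Rightarrow> bool" where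
  "strongly_metrically_conic X x0 \<longleftrightarrow> (\<forall>\<^sub>F \<epsilon> in at_right (0::real).
     \<exists>h k. homeomorphism (cone_over x0 (X \<inter> sphere x0 \<epsilon>)) (X \<inter> cball x0 \<epsilon>) h k \<and>
       semialgebraic_map_on (cone_over x0 (X \<inter> sphere x0 \<epsilon>)) h \<and>
       inner_bi_lipschitz (cone_over x0 (X \<inter> sphere x0 \<epsilon>)) (X \<inter> cball x0 \<epsilon>) h)"

end

theory Submission
  imports Defs "HOL-Complex_Analysis.Conformal_Mappings"
begin

text \<open>Let \<open>r0 \<noteq> 0\<close> be the third coordinate of a nonzero real point of \<open>X\<close>.  The real points of
  \<open>X\<close> in the slice \<open>x\<^sub>3 = r0\<close> form a compact set; let \<open>A\<close> be a component of it.  Acting by a small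
  real \<open>s\<close> moves \<open>A\<close> to distance about \<open>s ^ w\<^sub>3\<close> from \<open>0\<close> and shrinks its diameter to about
  \<open>s ^ min w\<^sub>1 w\<^sub>2\<close>, which is much less.  In a cone over a smooth link such a thin set contracts
  close to itself, so a metrically conic \<open>X\<close> would make \<open>A\<close> null-homotopic in the complex curve
  \<open>C = X \<inter> {x\<^sub>3 = r0}\<close>.  Then every polynomial 1-form, being closed on \<open>C\<close>, has a primitive on \<open>A\<close>.

  This is impossible because \<open>A\<close> is a compact curve without endpoints.  By Weierstrass
  approximation, exactness of the polynomial forms gives every continuous \<open>u : A \<rightarrow> S\<^sup>1\<close> a
  logarithm; for \<open>u\<close> the square of the unit tangent this yields a continuous unit tangent field.
  A polynomial form approximating that field is positive along \<open>A\<close>, yet its primitive has a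
  maximum on \<open>A\<close>.\<close>

section \<open>Zero sets of submersions\<close>

text \<open>Three obstacles shape the proof. A homotopy in \<open>C\<close> leaves the real plane,
  so forms on \<open>A\<close> can be followed only after complexification: a real polynomial form
  extends holomorphically to two complex variables, and a holomorphic 1-form on a one-dimensional
  complex manifold always has local primitives. This is the closedness on \<open>C\<close>. Next,
  the cone map is controlled only in the inner metrics and need not fix the apex. Thinness therefore
  has to be measured along paths inside \<open>A\<close>, which chains of a bounded number of short
  arcs make possible. Finally, no orientation of \<open>A\<close> is given. The square of the unit
  tangent does not see the sign, hence is continuous from the start, and half of its logarithm
  exponentiates to a tangent field. The smallness of s^m against s^w3, where m = min w1 w2, is used
  twice: for thinness as seen from the apex, and to keep the contraction away from x3 = 0, where the
  action could not bring it back to the slice.\<close>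

lemma perturbed_identity_expanding:
  fixes \<Psi> :: "'a::real_normed_vector \<Rightarrow> 'a"
  assumes lip: "\<And>x x'. x \<in> cball y R \<Longrightarrow> x' \<in> cball y R \<Longrightarrow>
      norm ((\<Psi> x - x) - (\<Psi> x' - x')) \<le> norm (x - x') / 2"
    and x: "x \<in> cball y R" and x': "x' \<in> cball y R"
  shows "norm (x - x') \<le> 2 * norm (\<Psi> x - \<Psi> x')"
    and "norm (\<Psi> x - \<Psi> x') \<le> 3 / 2 * norm (x - x')"
proof -
  have eq: "x - x' = (\<Psi> x - \<Psi> x') - ((\<Psi> x - x) - (\<Psi> x' - x'))"
    by simp
  have "norm (x - x') \<le> norm (\<Psi> x - \<Psi> x') + norm ((\<Psi> x - x) - (\<Psi> x' - x'))"
    by (subst eq) (rule norm_triangle_ineq4)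
  with lip[OF x x'] show "norm (x - x') \<le> 2 * norm (\<Psi> x - \<Psi> x')" by simp
  have eq: "\<Psi> x - \<Psi> x' = (x - x') + ((\<Psi> x - x) - (\<Psi> x' - x'))"
    by simp
  have "norm (\<Psi> x - \<Psi> x') \<le> norm (x - x') + norm ((\<Psi> x - x) - (\<Psi> x' - x'))"
    by (subst eq) (rule norm_triangle_ineq)
  with lip[OF x x'] show "norm (\<Psi> x - \<Psi> x') \<le> 3 / 2 * norm (x - x')" by simp
qed

lemma perturbed_identity_surj:
  fixes \<Psi> :: "'a::banach \<Rightarrow> 'a"
  assumes lip: "\<And>x x'. x \<in> cball y R \<Longrightarrow> x' \<in> cball y R \<Longrightarrow>
      norm ((\<Psi> x - x) - (\<Psi> x' - x')) \<le> norm (x - x') / 2"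
    and R: "R \<ge> 0" and q: "norm (q - \<Psi> y) \<le> R / 2"
  obtains x where "x \<in> cball y R" "\<Psi> x = q"
proof -
  \<comment> \<open>Fixed points of \<open>g\<close> are the solutions of
    \<open>\<Psi> x = q\<close>, and \<open>lip\<close> makes \<open>g\<close> a
    contraction.\<close>
  define g where "g x = q - (\<Psi> x - x)" for x
  have "\<exists>!x\<in>cball y R. g x = x"
  proof (rule Banach_fix[where c = "1/2"])
    show "complete (cball y R)" by (simp add: complete_eq_closed)
    show "cball y R \<noteq> {}" using R by auto
    show "g ` cball y R \<subseteq> cball y R"
    proof safe
      fix x assume x: "x \<in> cball y R"
      have eq: "g x - y = (q - \<Psi> y) - ((\<Psi> x - x) - (\<Psi> y - y))"
        by (simp add: g_def)
      have "norm (g x - y) \<le> norm (q - \<Psi> y) + norm ((\<Psi> x - x) - (\<Psi> y - y))"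
        by (subst eq) (rule norm_triangle_ineq4)
      also have "\<dots> \<le> R / 2 + norm (x - y) / 2"
        using q lip[OF x, of y] R by (intro add_mono) auto
      also have "\<dots> \<le> R" using x by (simp add: dist_norm norm_minus_commute)
      finally show "g x \<in> cball y R" by (simp add: dist_norm norm_minus_commute)
    qed
    show "dist (g x) (g x') \<le> 1/2 * dist x x'" if "x \<in> cball y R" "x' \<in> cball y R" for x x'
    proof -
      have "g x - g x' = - ((\<Psi> x - x) - (\<Psi> x' - x'))" by (simp add: g_def)
      then have "dist (g x) (g x') = norm ((\<Psi> x - x) - (\<Psi> x' - x'))"
        by (metis dist_norm norm_minus_cancel)
      with lip[OF that] show ?thesis by (simp add: dist_norm)
    qed
  qed auto
  then obtain x where "x \<in> cball y R" "g x = x" by blast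
  moreover from this have "\<Psi> x = q" by (simp add: g_def)
  ultimately show ?thesis using that by blast
qed

text \<open>With \<open>\<Psi> x = x + J (G x - G' y (x - y))\<close> one has \<open>G' y (\<Psi> x - y) = G x\<close>, so \<open>\<Psi>\<close>
  straightens \<open>{x. G x = 0}\<close> to an affine subspace while its derivative at \<open>y\<close> is the identity.\<close>

lemma submersion_straightening:
  fixes G :: "'a::real_normed_vector \<Rightarrow> 'b::real_normed_vector"
  assumes S: "open S" "y \<in> S"
    and der: "\<And>x. x \<in> S \<Longrightarrow> (G has_derivative G' x) (at x)"
    and cont: "\<And>e. e > 0 \<Longrightarrow> \<exists>d>0. \<forall>x\<in>ball y d. \<forall>h. norm (G' x h - G' y h) \<le> e * norm h"
    and J: "bounded_linear J" "\<And>k. G' y (J k) = k"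
  defines "\<Psi> \<equiv> \<lambda>x. x + J (G x - G' y (x - y))"
  obtains R where "R > 0" "cball y R \<subseteq> S"
    "\<And>x x'. x \<in> cball y R \<Longrightarrow> x' \<in> cball y R \<Longrightarrow>
      norm ((\<Psi> x - x) - (\<Psi> x' - x')) \<le> norm (x - x') / 2"
    "\<And>x. G' y (\<Psi> x - y) = G x"
proof -
  interpret J: bounded_linear J by fact
  interpret Gy: bounded_linear "G' y" using der[OF S(2)] by (rule has_derivative_bounded_linear)
  obtain B where B: "B > 0" "\<And>k. norm (J k) \<le> norm k * B"
    using J.pos_bounded by blast
  \<comment> \<open>As \<open>B\<close> bounds \<open>J\<close>, the tolerance 1 / (2 B) gives the
    composition of \<open>J\<close> with G' z - G' y norm at most 1/2.\<close>
  obtain d where d: "d > 0" "\<And>x h. x \<in> ball y d \<Longrightarrow> norm (G' x h - G' y h) \<le> 1 / (2 * B) * norm h"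
    using cont[of "1 / (2 * B)"] B by auto
  obtain r where r: "r > 0" "ball y r \<subseteq> S" using S open_contains_ball by blast
  define R where "R = min d r / 2"
  have R: "R > 0" "R < d" "R < r" using d r by (auto simp: R_def)
  have RS: "cball y R \<subseteq> S" using R r by force
  have "norm ((\<Psi> x - x) - (\<Psi> x' - x')) \<le> norm (x - x') / 2"
    if "x \<in> cball y R" "x' \<in> cball y R" for x x'
  proof -
    define \<Phi> where "\<Phi> x = J (G x - G' y (x - y))" for x
    have "norm (\<Phi> x - \<Phi> x') \<le> 1 / 2 * norm (x - x')"
    proof (rule differentiable_bound[OF convex_cball[of y R]])
      fix z assume z: "z \<in> cball y R"
      have "(\<Phi> has_derivative (\<lambda>h. J (G' z h - G' y h))) (at z within cball y R)"
        unfolding \<Phi>_def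
        by (intro J.has_derivative has_derivative_at_withinI[OF has_derivative_diff])
           (use z RS in \<open>auto intro!: der derivative_eq_intros Gy.has_derivative\<close>)
      then show "(\<Phi> has_derivative (\<lambda>h. J (G' z h - G' y h))) (at z within cball y R)" .
      show "onorm (\<lambda>h. J (G' z h - G' y h)) \<le> 1 / 2"
      proof (rule onorm_bound)
        fix h
        have "norm (J (G' z h - G' y h)) \<le> norm (G' z h - G' y h) * B" by (rule B)
        also have "\<dots> \<le> 1 / (2 * B) * norm h * B"
          using d(2)[of z h] z R B(1) by (intro mult_right_mono) auto
        also have "\<dots> = 1 / 2 * norm h" using B(1) by simp
        finally show "norm (J (G' z h - G' y h)) \<le> 1 / 2 * norm h" .
      qed simp
    qed (use that in auto)
    then show ?thesis by (simp add: \<Psi>_def \<Phi>_def)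
  qed
  moreover have "G' y (\<Psi> x - y) = G x" for x
  proof -
    have "\<Psi> x - y = (x - y) + J (G x - G' y (x - y))" by (simp add: \<Psi>_def)
    then show ?thesis using J(2) by (simp only: Gy.add) simp
  qed
  ultimately show ?thesis using that R(1) RS by blast
qed

text \<open>In the coordinates \<open>\<Psi>\<close> the zero set is affine, because
  \<open>G' y (\<Psi> x - y) = G x\<close>. The segment from \<open>\<Psi> x\<close> to
  \<open>\<Psi> y1\<close>, pulled back, therefore contracts the zero set inside itself. The
  constant 3 is the product of the Lipschitz constants 2 of the inverse and 3/2 of
  \<open>\<Psi>\<close>.\<close>

lemma submersion_locally_contractible:
  fixes G :: "'a::banach \<Rightarrow> 'b::real_normed_vector"
  assumes S: "open S" "y \<in> S" and y: "G y = 0"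
    and der: "\<And>x. x \<in> S \<Longrightarrow> (G has_derivative G' x) (at x)"
    and cont: "\<And>e. e > 0 \<Longrightarrow> \<exists>d>0. \<forall>x\<in>ball y d. \<forall>h. norm (G' x h - G' y h) \<le> e * norm h"
    and J: "bounded_linear J" "\<And>k. G' y (J k) = k"
  obtains r where "r > 0"
    "\<And>y1. y1 \<in> ball y r \<Longrightarrow> G y1 = 0 \<Longrightarrow> \<exists>g.
       continuous_on ({x\<in>ball y r. G x = 0} \<times> {0..1::real}) (\<lambda>(x, v). g x v) \<and>
       (\<forall>x\<in>ball y r. G x = 0 \<longrightarrow> g x 0 = x \<and> g x 1 = y1 \<and>
         (\<forall>v\<in>{0..1}. g x v \<in> S \<and> G (g x v) = 0) \<and>
         (\<forall>v\<in>{0..1}. \<forall>v'\<in>{0..1}. dist (g x v) (g x v') \<le> 3 * \<bar>v - v'\<bar> * dist x y1))"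
proof -
  interpret Gy: bounded_linear "G' y" using der[OF S(2)] by (rule has_derivative_bounded_linear)
  define \<Psi> where "\<Psi> x = x + J (G x - G' y (x - y))" for x
  obtain R where R: "R > 0" "cball y R \<subseteq> S"
    and lip: "\<And>x x'. x \<in> cball y R \<Longrightarrow> x' \<in> cball y R \<Longrightarrow>
      norm ((\<Psi> x - x) - (\<Psi> x' - x')) \<le> norm (x - x') / 2"
    and str: "\<And>x. G' y (\<Psi> x - y) = G x"
    using submersion_straightening[OF S der cont J] unfolding \<Psi>_def by blast
  note ex = perturbed_identity_expanding[of y R \<Psi>, OF lip]
  have \<Psi>y: "\<Psi> y = y"
    using linear_0[OF bounded_linear.linear[OF J(1)]] y by (simp add: \<Psi>_def Gy.zero)
  \<comment> \<open>A right inverse of \<open>\<Psi>\<close> on the ball of radius R / 2, by choice;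
    injectivity of \<open>\<Psi>\<close> makes it two-sided in \<open>\<Theta>_inv\<close>.\<close>
  define \<Theta> where "\<Theta> q = (SOME x. x \<in> cball y R \<and> \<Psi> x = q)" for q
  have \<Theta>: "\<Theta> q \<in> cball y R" "\<Psi> (\<Theta> q) = q" if "q \<in> cball y (R / 2)" for q
  proof -
    have "norm (q - \<Psi> y) \<le> R / 2" using that \<Psi>y by (simp add: dist_norm norm_minus_commute)
    then have "\<exists>x. x \<in> cball y R \<and> \<Psi> x = q"
      using perturbed_identity_surj[of y R \<Psi> q, OF lip] R(1) by (metis less_imp_le)
    from someI_ex[OF this] show "\<Theta> q \<in> cball y R" "\<Psi> (\<Theta> q) = q"
      unfolding \<Theta>_def by blast+
  qed
  have \<Theta>_lip: "norm (\<Theta> q - \<Theta> q') \<le> 2 * norm (q - q')"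
    if "q \<in> cball y (R / 2)" "q' \<in> cball y (R / 2)" for q q'
    using ex(1)[of "\<Theta> q" "\<Theta> q'"] \<Theta>[OF that(1)] \<Theta>[OF that(2)] by simp
  have \<Theta>_inv: "\<Theta> (\<Psi> x) = x" if "x \<in> cball y R" "\<Psi> x \<in> cball y (R / 2)" for x
    using ex(1)[of "\<Theta> (\<Psi> x)" x] \<Theta>[OF that(2)] that(1) by simp
  \<comment> \<open>Since 3/2 * R/3 = R/2, \<open>\<Psi>\<close> maps the ball of radius
    \<open>r\<close> into the region where \<open>\<Theta>\<close> inverts it.\<close>
  define r where "r = R / 3"
  have r: "r > 0" "r < R" using R by (auto simp: r_def)
  have \<Psi>in: "\<Psi> x \<in> cball y (R / 2)" if "x \<in> ball y r" for x
  proof -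
    have "norm (\<Psi> x - y) \<le> 3 / 2 * norm (x - y)"
      using ex(2)[of x y] that r R \<Psi>y by simp
    then show ?thesis using that by (simp add: dist_norm norm_minus_commute r_def)
  qed
  show ?thesis
  proof (rule that[OF r(1)])
    fix y1 assume y1: "y1 \<in> ball y r" "G y1 = 0"
    define c where "c x v = (1 - v) *\<^sub>R \<Psi> x + v *\<^sub>R \<Psi> y1" for x v
    define g where "g x v = \<Theta> (c x v)" for x v
    have c_in: "c x v \<in> cball y (R / 2)" if "x \<in> ball y r" "v \<in> {0..1}" for x v
      unfolding c_def using convexD_alt[OF convex_cball \<Psi>in[OF that(1)] \<Psi>in[OF y1(1)], of v] that
      by auto
    have "continuous_on ({x\<in>ball y r. G x = 0} \<times> {0..1}) (\<lambda>(x, v). g x v)"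
    proof -
      have "continuous_on (cball y R) \<Psi>"
      proof (rule lipschitz_on_continuous_on)
        show "(3/2)-lipschitz_on (cball y R) \<Psi>"
          using ex(2) by (intro lipschitz_onI) (auto simp: dist_norm)
      qed
      then have "continuous_on ({x\<in>ball y r. G x = 0} \<times> {0..1}) (\<lambda>z. \<Psi> (fst z))"
        by (rule continuous_on_compose2) (use r in \<open>auto intro!: continuous_intros\<close>)
      then have 1: "continuous_on ({x\<in>ball y r. G x = 0} \<times> {0..1}) (\<lambda>z. c (fst z) (snd z))"
        unfolding c_def by (intro continuous_intros)
      have "continuous_on (cball y (R / 2)) \<Theta>"
      proof (rule lipschitz_on_continuous_on)
        show "2-lipschitz_on (cball y (R / 2)) \<Theta>"
          using \<Theta>_lip by (intro lipschitz_onI) (auto simp: dist_norm)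
      qed
      from continuous_on_compose2[OF this 1] c_in show ?thesis
        by (force simp: g_def case_prod_unfold)
    qed
    moreover have "g x 0 = x" if "x \<in> ball y r" for x
      using \<Theta>_inv[of x] \<Psi>in[OF that] that r by (simp add: g_def c_def)
    moreover have "g x 1 = y1" for x
      using \<Theta>_inv[of y1] \<Psi>in[OF y1(1)] y1 r by (simp add: g_def c_def)
    moreover have "g x v \<in> S \<and> G (g x v) = 0"
      if x: "x \<in> ball y r" "G x = 0" and v: "v \<in> {0..1}" for x v
    proof
      show "g x v \<in> S" using \<Theta>(1)[OF c_in[OF x(1) v]] R(2) by (auto simp: g_def)
      have "G (g x v) = G' y (c x v - y)"
        using str[of "g x v"] \<Theta>(2)[OF c_in[OF x(1) v]] by (simp add: g_def)
      also have "c x v - y = (1 - v) *\<^sub>R (\<Psi> x - y) + v *\<^sub>R (\<Psi> y1 - y)"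
        by (simp add: c_def algebra_simps)
      also have "G' y \<dots> = (1 - v) *\<^sub>R G x + v *\<^sub>R G y1"
        by (simp only: Gy.add Gy.scaleR str)
      finally show "G (g x v) = 0" using x y1 by simp
    qed
    moreover have "dist (g x v) (g x v') \<le> 3 * \<bar>v - v'\<bar> * dist x y1"
      if x: "x \<in> ball y r" and v: "v \<in> {0..1}" "v' \<in> {0..1}" for x v v'
    proof -
      have "norm (g x v - g x v') \<le> 2 * norm (c x v - c x v')"
        unfolding g_def using c_in x v by (intro \<Theta>_lip) auto
      also have "c x v - c x v' = (v' - v) *\<^sub>R (\<Psi> x - \<Psi> y1)"
        by (simp add: c_def algebra_simps)
      also have "2 * norm \<dots> \<le> 2 * (\<bar>v - v'\<bar> * (3 / 2 * norm (x - y1)))"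
        unfolding norm_scaleR abs_minus_commute[of v' v] using ex(2)[of x y1] x y1 r
        by (intro mult_left_mono) auto
      finally show ?thesis by (simp add: dist_norm mult.assoc)
    qed
    ultimately show "\<exists>g.
       continuous_on ({x\<in>ball y r. G x = 0} \<times> {0..1::real}) (\<lambda>(x, v). g x v) \<and>
       (\<forall>x\<in>ball y r. G x = 0 \<longrightarrow> g x 0 = x \<and> g x 1 = y1 \<and>
         (\<forall>v\<in>{0..1}. g x v \<in> S \<and> G (g x v) = 0) \<and>
         (\<forall>v\<in>{0..1}. \<forall>v'\<in>{0..1}. dist (g x v) (g x v') \<le> 3 * \<bar>v - v'\<bar> * dist x y1))"
      by (intro exI[of _ g]) auto
  qed
qed

section \<open>Regular points of complex hypersurfaces\<close>

lemma has_derivative_vec_lambda: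
  fixes f :: "'n::finite \<Rightarrow> 'a::real_normed_vector \<Rightarrow> 'b::euclidean_space"
  assumes "\<And>i. (f i has_derivative f' i) (at x within S)"
  shows "((\<lambda>x. \<chi> i. f i x) has_derivative (\<lambda>h. \<chi> i. f' i h)) (at x within S)"
proof (subst has_derivative_componentwise_within, rule ballI)
  fix b :: "'b ^ 'n" assume "b \<in> Basis"
  then obtain i u where b: "b = axis i u" "u \<in> Basis" by (auto simp: Basis_vec_def)
  have "((\<lambda>x. f i x \<bullet> u) has_derivative (\<lambda>h. f' i h \<bullet> u)) (at x within S)"
    by (intro has_derivative_inner_left assms)
  then show "((\<lambda>x. (\<chi> i. f i x) \<bullet> b) has_derivative (\<lambda>h. (\<chi> i. f' i h) \<bullet> b)) (at x within S)"
    by (simp add: b inner_axis)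
qed

text \<open>\<open>mpoly_gradient\<close> is built from \<open>deriv\<close>, which says nothing
  before differentiability is known. So some continuous complex gradient is first produced by
  closure under the polynomial operations, and is identified with \<open>mpoly_gradient\<close>
  afterwards.\<close>

lemma mpoly_eval_C1:
  fixes p :: "('n::finite, complex) mpoly"
  shows "\<exists>g. continuous_on UNIV g \<and>
    (\<forall>x. (mpoly_eval p has_derivative (\<lambda>h. \<Sum>i\<in>UNIV. g x $ i * h $ i)) (at x))"
proof -
  define C1 where "C1 F \<longleftrightarrow> (\<exists>g :: complex ^ 'n \<Rightarrow> complex ^ 'n. continuous_on UNIV g \<and>
    (\<forall>x. (F has_derivative (\<lambda>h. \<Sum>i\<in>UNIV. g x $ i * h $ i)) (at x)))" for F :: "complex ^ 'n \<Rightarrow> complex"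
  have C1_const: "C1 (\<lambda>x. c)" for c
    unfolding C1_def by (intro exI[of _ "\<lambda>x. 0"]) (auto intro!: derivative_eq_intros)
  have C1_nth: "C1 (\<lambda>x. x $ k)" for k
    unfolding C1_def
  proof (intro exI[of _ "\<lambda>x. axis k 1"] conjI allI)
    have "(\<lambda>h::complex ^ 'n. \<Sum>i\<in>UNIV. axis k 1 $ i * h $ i) = (\<lambda>h. h $ k)"
      by (simp add: axis_def if_distrib[of "\<lambda>x. x * _"] cong: if_cong)
    then show "((\<lambda>x. x $ k) has_derivative (\<lambda>h. \<Sum>i\<in>UNIV. axis k 1 $ i * h $ i)) (at x)" for x :: "complex ^ 'n"
      using bounded_linear_imp_has_derivative[OF bounded_linear_vec_nth[of k]] by simp
  qed auto
  have C1_add: "C1 (\<lambda>x. F x + F' x)" if F: "C1 F" "C1 F'" for F F'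
  proof -
    from F obtain g g' where g: "continuous_on UNIV g" "continuous_on UNIV g'"
      "\<And>x. (F has_derivative (\<lambda>h. \<Sum>i\<in>UNIV. g x $ i * h $ i)) (at x)"
      "\<And>x. (F' has_derivative (\<lambda>h. \<Sum>i\<in>UNIV. g' x $ i * h $ i)) (at x)"
      unfolding C1_def by (elim exE conjE) simp
    show ?thesis unfolding C1_def
    proof (intro exI[of _ "\<lambda>x. g x + g' x"] conjI allI)
      show "((\<lambda>x. F x + F' x) has_derivative (\<lambda>h. \<Sum>i\<in>UNIV. (g x + g' x) $ i * h $ i)) (at x)" for x
        using has_derivative_add[OF g(3,4)[of x]] by (simp add: algebra_simps sum.distrib)
    qed (intro continuous_intros g)
  qed
  have C1_mult: "C1 (\<lambda>x. F x * F' x)" if F: "C1 F" "C1 F'" for F F'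
  proof -
    from F obtain g g' where g: "continuous_on UNIV g" "continuous_on UNIV g'"
      "\<And>x. (F has_derivative (\<lambda>h. \<Sum>i\<in>UNIV. g x $ i * h $ i)) (at x)"
      "\<And>x. (F' has_derivative (\<lambda>h. \<Sum>i\<in>UNIV. g' x $ i * h $ i)) (at x)"
      unfolding C1_def by (elim exE conjE) simp
    have c: "continuous_on UNIV F" "continuous_on UNIV F'"
      by (auto intro!: continuous_at_imp_continuous_on has_derivative_continuous[OF g(3)]
          has_derivative_continuous[OF g(4)])
    show ?thesis unfolding C1_def
    proof (intro exI[of _ "\<lambda>x. \<chi> i. F x * g' x $ i + F' x * g x $ i"] conjI allI)
      show "((\<lambda>x. F x * F' x) has_derivative
        (\<lambda>h. \<Sum>i\<in>UNIV. (\<chi> i. F x * g' x $ i + F' x * g x $ i) $ i * h $ i)) (at x)" for x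
        using has_derivative_mult[OF g(3,4)[of x]]
        by (simp add: algebra_simps sum.distrib sum_distrib_left)
    qed (intro continuous_intros g c)
  qed
  have C1_power: "C1 (\<lambda>x. F x ^ k)" if "C1 F" for F k
  proof (induction k)
    case 0 show ?case using C1_const[of 1] by simp
  next
    case (Suc k) show ?case using C1_mult[OF that Suc] by simp
  qed
  have C1_prod: "C1 (\<lambda>x. \<Prod>i\<in>I. F i x)" if "finite I" "\<And>i. i \<in> I \<Longrightarrow> C1 (F i)" for I :: "'n set" and F
    using that
  proof (induction I rule: finite_induct)
    case empty show ?case using C1_const[of 1] by simp
  next
    case (insert i I)
    then show ?case using C1_mult[of "F i"] by simp
  qed
  have C1_sum: "C1 (\<lambda>x. \<Sum>i\<in>I. F i x)" if "finite I" "\<And>i. i \<in> I \<Longrightarrow> C1 (F i)" for I :: "('n \<Rightarrow>\<^sub>0 nat) set" and F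
    using that
  proof (induction I rule: finite_induct)
    case empty show ?case using C1_const[of 0] by simp
  next
    case (insert i I)
    then show ?case using C1_add[of "F i"] by simp
  qed
  have "C1 (mpoly_eval p)"
    unfolding mpoly_eval_def[abs_def]
    by (rule C1_sum[OF finite_keys C1_mult[OF C1_const C1_prod[OF finite C1_power[OF C1_nth]]]])
  then show ?thesis unfolding C1_def .
qed

lemma
  fixes p :: "('n::finite, complex) mpoly"
  shows mpoly_eval_has_derivative:
      "(mpoly_eval p has_derivative (\<lambda>h. \<Sum>i\<in>UNIV. mpoly_gradient p x $ i * h $ i)) (at x)"
    and continuous_on_mpoly_gradient: "continuous_on UNIV (mpoly_gradient p)"
proof -
  obtain g where g: "continuous_on UNIV g"
    "\<And>x. (mpoly_eval p has_derivative (\<lambda>h. \<Sum>i\<in>UNIV. g x $ i * h $ i)) (at x)"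
    using mpoly_eval_C1[of p] by (elim exE conjE) simp
  have "mpoly_gradient p x = g x" for x
  proof (rule vec_eq_iff[THEN iffD2], rule allI)
    fix i
    define l where "l z = (\<chi> j. if j = i then z else x $ j)" for z
    have lx: "l (x $ i) = x" by (simp add: l_def vec_eq_iff)
    have "(l has_derivative (\<lambda>h. \<chi> j. if j = i then h else 0)) (at (x $ i))"
      unfolding l_def
    proof (rule has_derivative_vec_lambda)
      show "((\<lambda>z. if j = i then z else x $ j) has_derivative (\<lambda>h. if j = i then h else 0)) (at (x $ i))" for j
        by (cases "j = i") auto
    qed
    from has_derivative_compose[OF this, of "mpoly_eval p", unfolded lx, OF g(2)]
    have "((\<lambda>z. mpoly_eval p (l z)) has_derivative (\<lambda>h. g x $ i * h)) (at (x $ i))"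
      by (simp add: if_distrib[of "\<lambda>x. _ * x"] cong: if_cong)
    then have "((\<lambda>z. mpoly_eval p (l z)) has_field_derivative g x $ i) (at (x $ i))"
      by (simp add: has_field_derivative_def)
    then show "mpoly_gradient p x $ i = g x $ i"
      by (simp add: mpoly_gradient_def l_def DERIV_imp_deriv)
  qed
  then have "mpoly_gradient p = g" by auto
  with g show "(mpoly_eval p has_derivative (\<lambda>h. \<Sum>i\<in>UNIV. mpoly_gradient p x $ i * h $ i)) (at x)"
    and "continuous_on UNIV (mpoly_gradient p)" by auto
qed

lemma continuous_on_mpoly_eval:
  "continuous_on UNIV (mpoly_eval (p :: ('n::finite, complex) mpoly))"
  by (auto intro!: continuous_at_imp_continuous_on has_derivative_continuous[OF mpoly_eval_has_derivative])

section \<open>Polynomials on complex lines, and zeros of functions of two complex variables\<close>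

lemma has_derivative_scale_line:
  "((\<lambda>a. x + a *s v) has_derivative (\<lambda>h. h *s v)) (at (a :: complex))"
  for x v :: "complex ^ 'n::finite"
proof -
  have "((\<lambda>a. \<chi> i. x $ i + a * v $ i) has_derivative (\<lambda>h. \<chi> i. h * v $ i)) (at a)"
    by (rule has_derivative_vec_lambda) (auto intro!: derivative_eq_intros)
  moreover have "(\<lambda>a. \<chi> i. x $ i + a * v $ i) = (\<lambda>a. x + a *s v)"
    by (auto simp: vec_eq_iff)
  moreover have "(\<lambda>h. \<chi> i. h * v $ i) = (\<lambda>h. h *s v)"
    by (auto simp: vec_eq_iff)
  ultimately show ?thesis by simp
qed

lemma mpoly_eval_line:
  fixes p :: "('n::finite, complex) mpoly"
  shows "((\<lambda>a. mpoly_eval p (x + a *s v)) has_field_derivative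
    (\<Sum>i\<in>UNIV. mpoly_gradient p (x + a *s v) $ i * v $ i)) (at a)"
proof -
  from has_derivative_compose[OF has_derivative_scale_line mpoly_eval_has_derivative[of p]]
  have "((\<lambda>a. mpoly_eval p (x + a *s v)) has_derivative
    (\<lambda>h. (\<Sum>i\<in>UNIV. mpoly_gradient p (x + a *s v) $ i * v $ i) * h)) (at a)"
    by (simp add: sum_distrib_left sum_distrib_right mult_ac)
  then show ?thesis by (simp add: has_field_derivative_def)
qed

lemma holomorphic_on_mpoly_eval_line:
  fixes p :: "('n::finite, complex) mpoly"
  shows "(\<lambda>a. mpoly_eval p (x + a *s v)) holomorphic_on S"
  unfolding holomorphic_on_def field_differentiable_def
  by (rule ballI, rule exI, rule has_field_derivative_at_within, rule mpoly_eval_line)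

text \<open>If 0 were the only zero in the bidisc, |F| would be at least some m > 0 on the circle
  |a| = r, b = 0, and hence above m/2 on the circle |a| = r for every small b. The maximum modulus
  principle for 1/F(-, b) would then give |F(0, b)| \<ge> m/2, although F(0, b) tends to 0.\<close>

lemma holomorphic_no_isolated_zero:
  fixes F :: "complex \<times> complex \<Rightarrow> complex"
  assumes cont: "continuous_on UNIV F"
    and hol: "\<And>b. (\<lambda>a. F (a, b)) holomorphic_on UNIV"
    and z: "F (0, 0) = 0" and r: "r > 0"
  shows "\<exists>a b. norm a \<le> r \<and> norm b \<le> r \<and> (a, b) \<noteq> (0, 0) \<and> F (a, b) = 0"
proof (rule ccontr)
  assume "\<not> ?thesis"
  then have nz: "F (a, b) \<noteq> 0" if "norm a \<le> r" "norm b \<le> r" "(a, b) \<noteq> (0, 0)" for a b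
    using that by blast
  define Sp where "Sp = sphere (0::complex) r \<times> {0::complex}"
  have Sp: "compact Sp" "Sp \<noteq> {}" using r by (auto simp: Sp_def compact_Times)
  have "continuous_on Sp (\<lambda>x. norm (F x))"
    by (rule continuous_on_norm[OF continuous_on_subset[OF cont subset_UNIV]])
  then obtain x0 where x0: "x0 \<in> Sp" "\<And>x. x \<in> Sp \<Longrightarrow> norm (F x0) \<le> norm (F x)"
    using continuous_attains_inf[OF Sp] by blast
  define m where "m = norm (F x0)"
  have m: "m > 0" using x0(1) nz r by (auto simp: m_def Sp_def)
  have "open {x. norm (F x) > m / 2}"
    by (rule open_Collect_less[OF continuous_on_const continuous_on_norm[OF cont]])
  moreover have "Sp \<subseteq> {x. norm (F x) > m / 2}"
  proof
    fix x assume "x \<in> Sp"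
    from x0(2)[OF this] m show "x \<in> {x. norm (F x) > m / 2}"
      unfolding m_def mem_Collect_eq by linarith
  qed
  ultimately obtain e where e: "e > 0" "{x. infdist x Sp \<le> e} \<subseteq> {x. norm (F x) > m / 2}"
    using compact_in_open_separated[OF Sp(2,1)] by blast
  have "continuous_on UNIV (\<lambda>b. F (0, b))"
    by (rule continuous_on_compose2[OF cont continuous_on_Pair[OF continuous_on_const continuous_on_id]])
       (rule subset_UNIV)
  then have "isCont (\<lambda>b. F (0, b)) 0" by (simp add: continuous_on_eq_continuous_at)
  then obtain d where d: "d > 0" "\<And>b. norm b < d \<Longrightarrow> norm (F (0, b)) < m / 2"
    unfolding continuous_at_eps_delta using z m
    by (elim allE[of _ "m / 2"]) (auto simp: dist_norm)
  define b where "b = complex_of_real (min (min e d) r / 2)"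
  have nb: "norm b = min (min e d) r / 2" unfolding b_def norm_of_real using e d r by simp
  have b: "norm b \<le> e" "norm b < d" "norm b \<le> r" "b \<noteq> 0"
    using e d r nb by auto
  have low: "norm (F (a, b)) > m / 2" if "norm a = r" for a
  proof -
    have "infdist (a, b) Sp \<le> dist (a, b) (a, 0)"
      using that by (intro infdist_le) (auto simp: Sp_def)
    also have "\<dots> \<le> e" using b by (simp add: dist_prod_def dist_norm)
    finally show ?thesis using e(2) by auto
  qed
  have "norm (inverse (F (0, b))) \<le> 2 / m"
  proof (rule maximum_modulus_frontier[where f = "\<lambda>a. inverse (F (a, b))" and S = "cball 0 r"])
    have h: "(\<lambda>a. inverse (F (a, b))) holomorphic_on cball 0 r"
    proof (rule holomorphic_on_inverse)
      show "(\<lambda>a. F (a, b)) holomorphic_on cball 0 r"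
        using hol by (rule holomorphic_on_subset) simp
      show "F (a, b) \<noteq> 0" if "a \<in> cball 0 r" for a
        using nz[of a b] that b by simp
    qed
    show "(\<lambda>a. inverse (F (a, b))) holomorphic_on interior (cball 0 r)"
      using h by (rule holomorphic_on_subset) auto
    show "continuous_on (closure (cball 0 r)) (\<lambda>a. inverse (F (a, b)))"
      using holomorphic_on_imp_continuous_on[OF h] by simp
    show "norm (inverse (F (a, b))) \<le> 2 / m" if "a \<in> frontier (cball 0 r)" for a
    proof -
      have "inverse (norm (F (a, b))) \<le> inverse (m / 2)"
        using low[of a] that m r by (intro le_imp_inverse_le) (auto simp: frontier_cball)
      then show ?thesis by (simp only: norm_inverse inverse_divide)
    qed
    show "bounded (cball (0::complex) r)" "(0::complex) \<in> cball 0 r" using r by auto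
  qed
  moreover have "F (0, b) \<noteq> 0" using nz[of 0 b] b r by simp
  ultimately have "norm (F (0, b)) \<ge> m / 2"
    using m by (simp add: norm_inverse inverse_eq_divide[of "norm _"] divide_le_eq mult.commute le_divide_eq)
  with d(2)[OF b(2)] show False by simp
qed

section \<open>Regular points of a hypersurface have codimension one\<close>

lemma independent_pair_minor:
  fixes g1 g2 :: "complex ^ 'n::finite"
  assumes "vec.independent {g1, g2}" "g1 \<noteq> g2"
  obtains i j where "g1 $ i * g2 $ j - g1 $ j * g2 $ i \<noteq> 0"
proof -
  have "g1 \<noteq> 0" using assms(1) vec.dependent_zero by blast
  then obtain i where i: "g1 $ i \<noteq> 0" by (auto simp: vec_eq_iff)
  have "g2 \<notin> vec.span {g1}"
    using assms vec.independent_insert[of g2 "{g1}"] by (auto simp: insert_commute split: if_splits)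
  moreover have "(g2 $ i / g1 $ i) *s g1 \<in> vec.span {g1}"
    by (intro vec.span_scale vec.span_base) auto
  ultimately have "g2 \<noteq> (g2 $ i / g1 $ i) *s g1" by metis
  then obtain j where "g2 $ j \<noteq> (g2 $ i / g1 $ i) * g1 $ j" by (auto simp: vec_eq_iff)
  with i show ?thesis by (intro that[of i j]) (auto simp: field_simps)
qed

text \<open>The identity theorem on the complex line through \<open>x\<close> and \<open>z\<close>.
  It excludes the empty family of equations at a regular point of a proper hypersurface.\<close>

lemma zero_set_empty_interior:
  fixes q :: "('n::finite, complex) mpoly"
  assumes "open U" "x \<in> U" "U \<subseteq> zero_set q"
  shows "mpoly_eval q z = 0"
proof -
  define l where "l a = x + a *s (z - x)" for a :: complex
  define G where "G a = mpoly_eval q (l a)" for a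
  have hol: "G holomorphic_on UNIV"
    unfolding G_def l_def by (rule holomorphic_on_mpoly_eval_line)
  have c: "continuous_on UNIV l"
    unfolding l_def
    by (intro continuous_at_imp_continuous_on ballI has_derivative_continuous[OF has_derivative_scale_line])
  have "open (l -` U)" using assms(1) c by (rule open_vimage)
  moreover have "0 \<in> l -` U" using assms(2) by (simp add: l_def)
  ultimately obtain e where e: "e > 0" "ball 0 e \<subseteq> l -` U"
    by (rule openE)
  have lim: "(0::complex) islimpt ball 0 e" using e(1) by (simp add: islimpt_ball)
  have zero: "G a = 0" if "a \<in> ball 0 e" for a
  proof -
    have "l a \<in> zero_set q" using that e(2) assms(3) by blast
    then show ?thesis by (simp add: G_def zero_set_def)
  qed
  have "G 1 = 0"
    by (rule analytic_continuation[OF hol open_UNIV connected_UNIV subset_UNIV UNIV_I lim zero UNIV_I])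
  then show ?thesis by (simp add: G_def l_def)
qed

text \<open>The definition of a regular point allows any number of equations with independent
  gradients. With none, the zero set would have an interior point. With two, it would meet a
  suitable complex 2-plane near \<open>x\<close> only in \<open>x\<close>, and \<open>q\<close>
  restricted to that plane would have an isolated zero.\<close>

lemma regular_point_hypersurface:
  fixes q :: "('n::finite, complex) mpoly"
  assumes x: "x \<in> regular_points (zero_set q)" and q: "mpoly_eval q z \<noteq> 0"
  obtains p U where "p \<in> vanishing_ideal (zero_set q)" "mpoly_gradient p x \<noteq> 0"
    "open U" "x \<in> U" "zero_set q \<inter> U = zero_set p \<inter> U"
proof -
  let ?g = "\<lambda>p. mpoly_gradient p x"
  obtain P U where P: "P \<subseteq> vanishing_ideal (zero_set q)" "inj_on ?g P"
      "vec.independent (?g ` P)" and U: "open U" "x \<in> U"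
      "zero_set q \<inter> U = (\<Inter>p\<in>P. zero_set p) \<inter> U" and xq: "x \<in> zero_set q"
    using x unfolding regular_points_def by blast
  have "P \<noteq> {}"
  proof
    assume "P = {}"
    then have "U \<subseteq> zero_set q" using U(3) by auto
    with zero_set_empty_interior[OF U(1,2)] q show False by blast
  qed
  then obtain p where p: "p \<in> P" by blast
  have "P = {p}"
  proof (rule ccontr)
    assume "P \<noteq> {p}"
    then obtain p' where p': "p' \<in> P" "p' \<noteq> p" using p by blast
    have ne: "?g p \<noteq> ?g p'" using inj_onD[OF P(2) _ p p'(1)] p'(2) by auto
    have "vec.independent {?g p, ?g p'}"
      using P(3) p p' by (elim vec.independent_mono) auto
    from independent_pair_minor[OF this ne] obtain i j where
      ij: "?g p $ i * ?g p' $ j - ?g p $ j * ?g p' $ i \<noteq> 0" by blast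
    define \<Delta> where "\<Delta> = ?g p $ i * ?g p' $ j - ?g p $ j * ?g p' $ i"
    have \<Delta>: "\<Delta> \<noteq> 0" using ij by (simp add: \<Delta>_def)
    \<comment> \<open>Cramer's rule: \<open>e1\<close> and \<open>e2\<close> are dual to the two
      gradients, so in the plane through \<open>x\<close> that they span, the pair (p, p') has the
      identity as its derivative at \<open>x\<close>.\<close>
    define e1 where "e1 = axis i (?g p' $ j / \<Delta>) - axis j (?g p' $ i / \<Delta>)"
    define e2 where "e2 = axis j (?g p $ i / \<Delta>) - axis i (?g p $ j / \<Delta>)"
    have ax: "(\<Sum>k\<in>UNIV. g $ k * (axis i a - axis j b) $ k) = g $ i * a - g $ j * b"
      for g :: "complex ^ 'n" and i j a b
      by (simp add: axis_def right_diff_distrib sum_subtractf if_distrib[of "\<lambda>x. _ * x"] cong: if_cong)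
    have dual: "(\<Sum>k\<in>UNIV. ?g p $ k * e1 $ k) = 1" "(\<Sum>k\<in>UNIV. ?g p' $ k * e1 $ k) = 0"
      "(\<Sum>k\<in>UNIV. ?g p $ k * e2 $ k) = 0" "(\<Sum>k\<in>UNIV. ?g p' $ k * e2 $ k) = 1"
      using \<Delta> unfolding e1_def e2_def ax times_divide_eq_right diff_divide_distrib[symmetric]
      by (simp_all add: \<Delta>_def mult.commute)
    define L where "L w = x + fst w *s e1 + snd w *s e2" for w :: "complex \<times> complex"
    have L': "(L has_derivative (\<lambda>h. \<chi> k. fst h * e1 $ k + snd h * e2 $ k)) (at w)" for w
    proof -
      have "L = (\<lambda>w. \<chi> k. x $ k + fst w * e1 $ k + snd w * e2 $ k)"
        by (auto simp: L_def vec_eq_iff)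
      then show ?thesis
        by (simp only:) (rule has_derivative_vec_lambda, auto intro!: derivative_eq_intros)
    qed
    have L0: "L (0, 0) = x" by (simp add: L_def)
    have contL: "continuous_on UNIV L"
      by (auto intro!: continuous_at_imp_continuous_on has_derivative_continuous[OF L'])
    define G where "G w = (mpoly_eval p (L w), mpoly_eval p' (L w))" for w
    have "(G has_derivative (\<lambda>h. ((\<Sum>k\<in>UNIV. ?g p $ k * (\<chi> k. fst h * e1 $ k + snd h * e2 $ k) $ k),
        (\<Sum>k\<in>UNIV. ?g p' $ k * (\<chi> k. fst h * e1 $ k + snd h * e2 $ k) $ k)))) (at (0, 0))"
      using has_derivative_Pair[OF
          has_derivative_compose[OF L'[of "(0, 0)"] mpoly_eval_has_derivative[of p "L (0, 0)"]]
          has_derivative_compose[OF L'[of "(0, 0)"] mpoly_eval_has_derivative[of p' "L (0, 0)"]]]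
      unfolding G_def L0 .
    also have "(\<lambda>h. ((\<Sum>k\<in>UNIV. ?g p $ k * (\<chi> k. fst h * e1 $ k + snd h * e2 $ k) $ k),
        (\<Sum>k\<in>UNIV. ?g p' $ k * (\<chi> k. fst h * e1 $ k + snd h * e2 $ k) $ k))) = (\<lambda>h. h)"
    proof
      fix h :: "complex \<times> complex"
      have *: "(\<Sum>k\<in>UNIV. g $ k * (\<chi> k. fst h * e1 $ k + snd h * e2 $ k) $ k) =
         fst h * (\<Sum>k\<in>UNIV. g $ k * e1 $ k) + snd h * (\<Sum>k\<in>UNIV. g $ k * e2 $ k)"
        for g :: "complex ^ 'n"
        by (simp add: sum_distrib_left sum.distrib[symmetric] algebra_simps)
      show "((\<Sum>k\<in>UNIV. ?g p $ k * (\<chi> k. fst h * e1 $ k + snd h * e2 $ k) $ k),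
        (\<Sum>k\<in>UNIV. ?g p' $ k * (\<chi> k. fst h * e1 $ k + snd h * e2 $ k) $ k)) = h"
        unfolding * dual by simp
    qed
    finally have G': "(G has_derivative (\<lambda>h. h)) (at (0, 0))" .
    have z0: "(0, 0) = (0 :: complex \<times> complex)" by (simp add: zero_prod_def)
    have G0: "G 0 = 0"
    proof -
      have "x \<in> zero_set p" "x \<in> zero_set p'" using xq P(1) p p'(1) unfolding vanishing_ideal_def by blast+
      then have "G (0, 0) = (0, 0)" by (simp add: G_def zero_set_def L0)
      then show ?thesis unfolding z0 .
    qed
    \<comment> \<open>The error of the linearization w is at most half of |w|, so \<open>G\<close>
      has no zero other than 0 in the ball of radius \<open>d\<close>.\<close>
    have "\<exists>d>0. \<forall>w. norm (w - 0) < d \<longrightarrow> norm (G w - G 0 - (w - 0)) \<le> 1 / 2 * norm (w - 0)"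
      using G'[unfolded has_derivative_at_alt z0, THEN conjunct2, rule_format, of "1/2"] by simp
    then obtain d where d: "d > 0" "\<And>w. norm w < d \<Longrightarrow> norm (G w - w) \<le> 1 / 2 * norm w"
      by (auto simp: G0)
    have "open (L -` U)" using contL U(1) continuous_on_open_vimage[OF open_UNIV] by auto
    moreover have "(0, 0) \<in> L -` U" using U(2) L0 by simp
    ultimately obtain e where e: "e > 0" "ball (0, 0) e \<subseteq> L -` U" using open_contains_ball by blast
    \<comment> \<open>A pair with both entries at most \<open>r\<close> has norm at most 2 r, below
      both \<open>d\<close> and \<open>e\<close>.\<close>
    define r where "r = min d e / 4"
    have r: "r > 0" "2 * r < d" "2 * r < e" using d e by (auto simp: r_def)
    have "\<exists>a b. norm a \<le> r \<and> norm b \<le> r \<and> (a, b) \<noteq> (0, 0) \<and> mpoly_eval q (L (a, b)) = 0"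
    proof (rule holomorphic_no_isolated_zero)
      show "continuous_on UNIV (\<lambda>w. mpoly_eval q (L w))"
        by (rule continuous_on_compose2[OF continuous_on_mpoly_eval contL]) auto
      show "(\<lambda>a. mpoly_eval q (L (a, b))) holomorphic_on UNIV" for b
      proof -
        have "L (a, b) = (x + b *s e2) + a *s e1" for a by (simp add: L_def)
        then show ?thesis
          by (simp only: holomorphic_on_mpoly_eval_line)
      qed
      show "mpoly_eval q (L (0, 0)) = 0" using xq by (simp add: L0 zero_set_def)
    qed (rule r)
    then obtain a b where ab: "norm a \<le> r" "norm b \<le> r" "(a, b) \<noteq> (0, 0)" "mpoly_eval q (L (a, b)) = 0"
      by blast
    have nab: "norm (a, b) \<le> 2 * r"
      using norm_Pair_le[of a b] ab by simp
    have "L (a, b) \<in> U"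
    proof -
      have "(a, b) \<in> ball (0, 0) e" using nab r by (simp add: zero_prod_def[symmetric])
      then show ?thesis using e(2) by auto
    qed
    moreover have "L (a, b) \<in> zero_set q" using ab by (simp add: zero_set_def)
    ultimately have "L (a, b) \<in> zero_set p \<inter> zero_set p'" using U(3) p p' by blast
    then have G_ab: "G (a, b) = 0" by (simp add: G_def zero_set_def zero_prod_def)
    have "norm (a, b) < d" using nab r(2) by linarith
    from d(2)[OF this] have "norm (a, b) \<le> 1 / 2 * norm (a, b)"
      unfolding G_ab diff_0 norm_minus_cancel .
    then have "norm (a, b) \<le> 0" by simp
    with ab(3) show False by (simp add: z0)
  qed
  moreover have "?g p \<noteq> 0"
  proof
    assume "?g p = 0"
    then have "0 \<in> ?g ` P" using p by (metis imageI)
    from vec.dependent_zero[OF this] P(3) show False by contradiction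
  qed
  ultimately show ?thesis using that[of p U] P(1) U by auto
qed

text \<open>Differentiate \<open>p\<close> = 0 along the orbit of \<open>x\<close> at t = 1: the
  Euler vector field of the action is tangent to \<open>X\<close>.\<close>

lemma gradient_euler:
  fixes w :: "nat ^ 'n::finite" and p :: "('n, complex) mpoly"
  assumes p: "p \<in> vanishing_ideal X"
    and X: "\<And>t. t \<noteq> 0 \<Longrightarrow> (\<chi> i. t ^ (w $ i) * x $ i) \<in> X"
  shows "(\<Sum>i\<in>UNIV. mpoly_gradient p x $ i * (of_nat (w $ i) * x $ i)) = 0"
proof -
  define l where "l t = (\<chi> i. t ^ (w $ i) * x $ i)" for t :: complex
  have l1: "l 1 = x" by (simp add: l_def vec_eq_iff)
  have "(l has_derivative (\<lambda>h. \<chi> i. h * (of_nat (w $ i) * x $ i))) (at 1)"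
    unfolding l_def by (rule has_derivative_vec_lambda) (auto intro!: derivative_eq_intros)
  from has_derivative_compose[OF this, of "mpoly_eval p", unfolded l1, OF mpoly_eval_has_derivative]
  have "((\<lambda>t. mpoly_eval p (l t)) has_derivative
     (\<lambda>h. (\<Sum>i\<in>UNIV. mpoly_gradient p x $ i * (of_nat (w $ i) * x $ i)) * h)) (at 1)"
    by (simp add: sum_distrib_left sum_distrib_right mult_ac)
  then have "((\<lambda>t. mpoly_eval p (l t)) has_field_derivative
     (\<Sum>i\<in>UNIV. mpoly_gradient p x $ i * (of_nat (w $ i) * x $ i))) (at 1)"
    by (simp add: has_field_derivative_def)
  moreover have "((\<lambda>t. mpoly_eval p (l t)) has_field_derivative 0) (at 1)"
  proof (rule has_field_derivative_transform_within_open[where S = "- {0}"])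
    show "0 = mpoly_eval p (l t)" if "t \<in> - {0}" for t
      using X[of t] p that by (auto simp: l_def vanishing_ideal_def zero_set_def)
  qed (auto intro!: derivative_eq_intros)
  ultimately show ?thesis by (rule DERIV_unique)
qed

section \<open>Primitives of forms along a null-homotopy\<close>

text \<open>The linear map \<open>\<pi>\<close> recovers the parameter. Followed by the
  parametrization it gives a map of the ambient space that fixes the curve near \<open>c\<close>,
  and so functions of the parameter become functions differentiable within \<open>C\<close>.\<close>

definition curve_chart :: "(complex \<times> complex) set \<Rightarrow> complex \<times> complex \<Rightarrow> bool" where
  "curve_chart C c \<longleftrightarrow> (\<exists>N r \<zeta>1 \<zeta>2 \<pi>. open N \<and> c \<in> N \<and> r > 0 \<and>
     \<zeta>1 holomorphic_on ball 0 r \<and> \<zeta>2 holomorphic_on ball 0 r \<and>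
     bounded_linear \<pi> \<and> C \<inter> N = (\<lambda>z. (\<zeta>1 z, \<zeta>2 z)) ` ball 0 r \<and>
     (\<zeta>1 0, \<zeta>2 0) = c \<and> (\<forall>z\<in>ball 0 r. \<pi> (\<zeta>1 z, \<zeta>2 z) = \<pi> c + z))"

text \<open>The derivative within \<open>C\<close> only sees tangent directions, so this says that
  \<open>\<Phi>\<close> is a primitive of the restriction of \<open>Q1 dz1 + Q2 dz2\<close> to \<open>C\<close>.\<close>

definition form_primitive where
  "form_primitive C Q1 Q2 N \<Phi> \<longleftrightarrow> open N \<and>
     (\<forall>c\<in>C \<inter> N. (\<Phi> has_derivative (\<lambda>h. Q1 c * fst h + Q2 c * snd h :: complex))
        (at (c :: complex \<times> complex) within C))"

text \<open>Holomorphy in two variables, encoded by the way it is applied: composition with a pair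
  of holomorphic functions of one variable.\<close>

definition entire2 :: "(complex \<times> complex \<Rightarrow> complex) \<Rightarrow> bool" where
  "entire2 Q \<longleftrightarrow> (\<forall>S \<zeta>1 \<zeta>2. \<zeta>1 holomorphic_on S \<longrightarrow> \<zeta>2 holomorphic_on S \<longrightarrow>
     (\<lambda>z. Q (\<zeta>1 z, \<zeta>2 z)) holomorphic_on S)"

text \<open>Pulled back to the parameter disc of a chart, the form is f dz with f holomorphic, and
  the disc is convex.\<close>

lemma form_primitive_exists:
  assumes "curve_chart C c" and Q: "entire2 Q1" "entire2 Q2"
  obtains N \<Phi> where "c \<in> N" "form_primitive C Q1 Q2 N \<Phi>"
proof -
  obtain N r \<zeta>1 \<zeta>2 \<pi> where ch: "open N" "c \<in> N" "r > 0"
     "\<zeta>1 holomorphic_on ball 0 r" "\<zeta>2 holomorphic_on ball 0 r"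
     "bounded_linear \<pi>" "C \<inter> N = (\<lambda>z. (\<zeta>1 z, \<zeta>2 z)) ` ball 0 r"
     "(\<zeta>1 0, \<zeta>2 0) = c" "\<And>z. z \<in> ball 0 r \<Longrightarrow> \<pi> (\<zeta>1 z, \<zeta>2 z) = \<pi> c + z"
    using assms(1) unfolding curve_chart_def by (elim exE conjE) simp
  interpret \<pi>: bounded_linear \<pi> by (rule ch(6))
  define f where "f z = Q1 (\<zeta>1 z, \<zeta>2 z) * deriv \<zeta>1 z + Q2 (\<zeta>1 z, \<zeta>2 z) * deriv \<zeta>2 z" for z
  have holf: "f holomorphic_on ball 0 r"
    unfolding f_def
    by (intro holomorphic_on_add holomorphic_on_mult holomorphic_deriv ch(4,5) open_ball
        Q[unfolded entire2_def, rule_format])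
  obtain P where P0: "\<And>z. z \<in> ball 0 r \<Longrightarrow> (P has_field_derivative f z) (at z within ball 0 r)"
    using holomorphic_convex_primitive'[OF convex_ball open_ball holf] by blast
  have P: "(P has_field_derivative f z) (at z)" if "z \<in> ball 0 r" for z
    using P0[OF that] at_within_open[OF that open_ball] by simp
  define \<Phi> where "\<Phi> x = P (\<pi> x - \<pi> c)" for x
  have "form_primitive C Q1 Q2 N \<Phi>"
    unfolding form_primitive_def
  proof (intro conjI ballI ch(1))
    fix c' assume c': "c' \<in> C \<inter> N"
    then obtain z where z: "z \<in> ball 0 r" "c' = (\<zeta>1 z, \<zeta>2 z)" using ch(7) by blast
    have \<pi>z: "\<pi> c' - \<pi> c = z" using ch(9)[OF z(1)] z(2) by simp
    define \<theta> where "\<theta> h = Q1 c' * fst h + Q2 c' * snd h" for h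
    interpret \<theta>: bounded_linear \<theta>
      unfolding \<theta>_def by (intro bounded_linear_add bounded_linear_const_mult
          bounded_linear_fst bounded_linear_snd)
    define Z where "Z x = (\<zeta>1 (\<pi> x - \<pi> c), \<zeta>2 (\<pi> x - \<pi> c))" for x
    have d\<pi>: "((\<lambda>x. \<pi> x - \<pi> c) has_derivative \<pi>) (at c' within C)"
      by (auto intro!: derivative_eq_intros \<pi>.has_derivative[OF has_derivative_ident])
    have d\<zeta>: "(\<zeta>1 has_derivative (\<lambda>h. deriv \<zeta>1 z * h)) (at z)" "(\<zeta>2 has_derivative (\<lambda>h. deriv \<zeta>2 z * h)) (at z)"
      using holomorphic_derivI[OF ch(4) open_ball z(1)] holomorphic_derivI[OF ch(5) open_ball z(1)]
      by (simp_all add: has_field_derivative_def)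
    have dZ: "(Z has_derivative (\<lambda>h. (deriv \<zeta>1 z * \<pi> h, deriv \<zeta>2 z * \<pi> h))) (at c' within C)"
      unfolding Z_def
      by (intro has_derivative_Pair has_derivative_compose[OF d\<pi>, of \<zeta>1, unfolded \<pi>z]
          has_derivative_compose[OF d\<pi>, of \<zeta>2, unfolded \<pi>z] d\<zeta>)
    have "(P has_derivative (\<lambda>h. f z * h)) (at z)"
      using P[OF z(1)] by (simp add: has_field_derivative_def)
    from has_derivative_compose[OF d\<pi>, of P, unfolded \<pi>z, OF this]
    have d\<Phi>: "(\<Phi> has_derivative (\<lambda>h. f z * \<pi> h)) (at c' within C)"
      unfolding \<Phi>_def .
    \<comment> \<open>\<open>Z\<close> fixes the curve, so the added term vanishes on
      \<open>C\<close>. It turns the derivative taken through \<open>\<pi>\<close> into the full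
      form \<open>\<theta>\<close>, transverse directions included.\<close>
    have "((\<lambda>x. \<Phi> x + (\<theta> x - \<theta> (Z x))) has_derivative
        (\<lambda>h. f z * \<pi> h + (\<theta> h - \<theta> (deriv \<zeta>1 z * \<pi> h, deriv \<zeta>2 z * \<pi> h)))) (at c' within C)"
      by (intro has_derivative_add has_derivative_diff d\<Phi> \<theta>.has_derivative[OF dZ]
          \<theta>.has_derivative[OF has_derivative_ident])
    also have "(\<lambda>h. f z * \<pi> h + (\<theta> h - \<theta> (deriv \<zeta>1 z * \<pi> h, deriv \<zeta>2 z * \<pi> h))) = \<theta>"
      by (auto simp: fun_eq_iff \<theta>_def f_def z(2) algebra_simps)
    finally have d: "((\<lambda>x. \<Phi> x + (\<theta> x - \<theta> (Z x))) has_derivative \<theta>) (at c' within C)" .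
    obtain d where d0: "d > 0" "ball c' d \<subseteq> N" using ch(1) c' open_contains_ball by blast
    have "(\<Phi> has_derivative \<theta>) (at c' within C)"
    proof (rule has_derivative_transform_within[OF d d0(1)])
      fix x assume x: "x \<in> C" "dist x c' < d"
      then have "x \<in> C \<inter> N" using d0(2) by (auto simp: dist_commute)
      then obtain z' where z': "z' \<in> ball 0 r" "x = (\<zeta>1 z', \<zeta>2 z')" using ch(7) by blast
      then have "Z x = x" using ch(9)[OF z'(1)] by (simp add: Z_def)
      then show "\<Phi> x + (\<theta> x - \<theta> (Z x)) = \<Phi> x" by simp
    qed (use c' in simp)
    then show "(\<Phi> has_derivative (\<lambda>h. Q1 c' * fst h + Q2 c' * snd h)) (at c' within C)"
      by (simp add: \<theta>_def[abs_def])
  qed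
  with ch(2) show ?thesis by (rule that)
qed

text \<open>The difference has derivative zero over a convex parameter disc, hence is constant
  there; \<open>\<pi>\<close> cuts out the corresponding neighbourhood of \<open>c\<close>.\<close>

lemma form_primitive_diff_locally_constant:
  assumes "curve_chart C c" and p: "form_primitive C Q1 Q2 N \<Phi>" "form_primitive C Q1 Q2 N' \<Phi>'"
    and c: "c \<in> N" "c \<in> N'"
  obtains M k where "open M" "c \<in> M" "\<And>x. x \<in> C \<inter> M \<Longrightarrow> \<Phi> x = \<Phi>' x + k"
proof -
  obtain N0 r \<zeta>1 \<zeta>2 \<pi> where ch: "open N0" "c \<in> N0" "r > 0"
     "\<zeta>1 holomorphic_on ball 0 r" "\<zeta>2 holomorphic_on ball 0 r"
     "bounded_linear \<pi>" "C \<inter> N0 = (\<lambda>z. (\<zeta>1 z, \<zeta>2 z)) ` ball 0 r"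
     "(\<zeta>1 0, \<zeta>2 0) = c" "\<And>z. z \<in> ball 0 r \<Longrightarrow> \<pi> (\<zeta>1 z, \<zeta>2 z) = \<pi> c + z"
    using assms(1) unfolding curve_chart_def by (elim exE conjE) simp
  define Z where "Z z = (\<zeta>1 z, \<zeta>2 z)" for z
  have cZ: "continuous_on (ball 0 r) Z"
    unfolding Z_def by (intro continuous_on_Pair holomorphic_on_imp_continuous_on ch)
  have oN: "open (N \<inter> N')" using p by (auto simp: form_primitive_def)
  have "open (ball 0 r \<inter> Z -` (N \<inter> N'))"
    by (rule continuous_open_preimage[OF cZ open_ball oN])
  moreover have "0 \<in> ball 0 r \<inter> Z -` (N \<inter> N')" using ch(3,8) c by (simp add: Z_def)
  ultimately obtain r' where r': "r' > 0" "ball 0 r' \<subseteq> ball 0 r \<inter> Z -` (N \<inter> N')"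
    using open_contains_ball by blast
  have ZC: "Z z \<in> C" if "z \<in> ball 0 r" for z
    using ch(7) that unfolding Z_def by blast
  have "\<exists>k. \<forall>z\<in>ball 0 r'. \<Phi> (Z z) - \<Phi>' (Z z) = k"
  proof (rule has_derivative_zero_constant[OF convex_ball])
    fix z :: complex assume z: "z \<in> ball 0 r'"
    then have zr: "z \<in> ball 0 r" "Z z \<in> N" "Z z \<in> N'" using r' by auto
    have d: "((\<lambda>x. \<Phi> x - \<Phi>' x) has_derivative (\<lambda>h. 0)) (at (Z z) within C)"
    proof -
      have "((\<lambda>x. \<Phi> x - \<Phi>' x) has_derivative
        (\<lambda>h. (Q1 (Z z) * fst h + Q2 (Z z) * snd h) - (Q1 (Z z) * fst h + Q2 (Z z) * snd h)))
        (at (Z z) within C)"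
        using p zr ZC[OF zr(1)] unfolding form_primitive_def by (intro has_derivative_diff) auto
      then show ?thesis by simp
    qed
    have dz: "(\<zeta>1 has_derivative (\<lambda>h. deriv \<zeta>1 z * h)) (at z)" "(\<zeta>2 has_derivative (\<lambda>h. deriv \<zeta>2 z * h)) (at z)"
      using holomorphic_derivI[OF ch(4) open_ball zr(1)] holomorphic_derivI[OF ch(5) open_ball zr(1)]
      by (simp_all add: has_field_derivative_def)
    have dZ: "(Z has_derivative (\<lambda>h. (deriv \<zeta>1 z * h, deriv \<zeta>2 z * h))) (at z within ball 0 r')"
      unfolding Z_def
      by (rule has_derivative_Pair[OF dz[THEN has_derivative_at_withinI]])
    have sub: "Z ` ball 0 r' \<subseteq> C" using ZC r' by auto
    show "((\<lambda>z. \<Phi> (Z z) - \<Phi>' (Z z)) has_derivative (\<lambda>h. 0)) (at z within ball 0 r')"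
      using has_derivative_in_compose[OF dZ has_derivative_subset[OF d sub]] .
  qed
  then obtain k where k: "\<And>z. z \<in> ball 0 r' \<Longrightarrow> \<Phi> (Z z) - \<Phi>' (Z z) = k" by blast
  define M where "M = N0 \<inter> (\<lambda>x. \<pi> x - \<pi> c) -` ball 0 r'"
  have c\<pi>: "continuous_on UNIV (\<lambda>x. \<pi> x - \<pi> c)"
    by (intro continuous_on_diff continuous_on_const linear_continuous_on ch(6))
  show ?thesis
  proof (rule that[of M k])
    show "open M" unfolding M_def
      using continuous_on_open_vimage[OF open_UNIV, THEN iffD1, OF c\<pi>] ch(1) by (intro open_Int) auto
    show "c \<in> M" using ch(2) r' by (simp add: M_def)
    fix x assume x: "x \<in> C \<inter> M"
    then obtain z where z: "z \<in> ball 0 r" "x = Z z" using ch(7) unfolding M_def Z_def by blast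
    then have "z \<in> ball 0 r'" using x ch(9)[OF z(1)] by (simp add: M_def Z_def)
    with k[OF this] z(2) show "\<Phi> x = \<Phi>' x + k" by (simp add: algebra_simps)
  qed
qed

lemma form_primitive_path_diff:
  assumes ch: "\<And>c. c \<in> C \<Longrightarrow> curve_chart C c"
    and p: "form_primitive C Q1 Q2 N \<Phi>" "form_primitive C Q1 Q2 N' \<Phi>'"
    and \<gamma>: "continuous_on {v..v'} \<gamma>" "\<And>x. x \<in> {v..v'} \<Longrightarrow> \<gamma> x \<in> C \<inter> N \<inter> N'" and v: "v \<le> (v'::real)"
  shows "\<Phi> (\<gamma> v) - \<Phi>' (\<gamma> v) = \<Phi> (\<gamma> v') - \<Phi>' (\<gamma> v')"
proof -
  have "(\<lambda>x. \<Phi> (\<gamma> x) - \<Phi>' (\<gamma> x)) constant_on {v..v'}"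
  proof (rule locally_constant_imp_constant)
    fix x assume x: "x \<in> {v..v'}"
    have "\<gamma> x \<in> C" "\<gamma> x \<in> N" "\<gamma> x \<in> N'" using \<gamma>(2)[OF x] by auto
    from form_primitive_diff_locally_constant[OF ch[OF this(1)] p this(2,3)]
    obtain M k where M: "open M" "\<gamma> x \<in> M" "\<And>y. y \<in> C \<inter> M \<Longrightarrow> \<Phi> y = \<Phi>' y + k" by blast
    show "\<exists>T. openin (top_of_set {v..v'}) T \<and> x \<in> T \<and>
      (\<forall>y\<in>T. \<Phi> (\<gamma> y) - \<Phi>' (\<gamma> y) = \<Phi> (\<gamma> x) - \<Phi>' (\<gamma> x))"
    proof (intro exI conjI ballI)
      show "openin (top_of_set {v..v'}) ({v..v'} \<inter> \<gamma> -` M)"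
        using \<gamma>(1) M(1) continuous_openin_preimage_gen by blast
      fix y assume "y \<in> {v..v'} \<inter> \<gamma> -` M"
      then show "\<Phi> (\<gamma> y) - \<Phi>' (\<gamma> y) = \<Phi> (\<gamma> x) - \<Phi>' (\<gamma> x)"
        using M(3)[of "\<gamma> y"] M(3)[of "\<gamma> x"] M(2) \<gamma>(2)[of y] \<gamma>(2)[OF x] by auto
    qed (use x M in auto)
  qed simp
  then show ?thesis unfolding constant_on_def using v by (metis atLeastAtMost_iff order_refl)
qed

section \<open>Complexified polynomial forms and their transport along a homotopy\<close>

lemma bounded_linear_complex_to_real:
  assumes "bounded_linear (f :: complex \<Rightarrow> real)"
  shows "f x = f 1 * Re x + f \<i> * Im x"
proof -
  interpret f: bounded_linear f by fact
  have "x = Re x *\<^sub>R 1 + Im x *\<^sub>R \<i>" by (simp add: complex_eq_iff)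
  then have "f x = f (Re x *\<^sub>R 1 + Im x *\<^sub>R \<i>)" by simp
  then show ?thesis by (simp only: f.add f.scaleR) simp
qed

text \<open>Two independent complex variables are substituted for Re and Im, along the inductive
  construction of the polynomial.\<close>

lemma real_polynomial_entire_extension:
  assumes "real_polynomial_function (p :: complex \<Rightarrow> real)"
  obtains Q where "entire2 Q" "\<And>x. Q (of_real (Re x), of_real (Im x)) = of_real (p x)"
proof -
  have "\<exists>Q. entire2 Q \<and> (\<forall>x. Q (of_real (Re x), of_real (Im x)) = of_real (p x))"
    using assms
  proof induction
    case (linear f)
    show ?case
    proof (intro exI[of _ "\<lambda>z. of_real (f 1) * fst z + of_real (f \<i>) * snd z"] conjI allI)
      show "entire2 (\<lambda>z. of_real (f 1) * fst z + of_real (f \<i>) * snd z)"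
        unfolding entire2_def fst_conv snd_conv
        by (intro allI impI holomorphic_on_add holomorphic_on_mult holomorphic_on_const)
      show "of_real (f 1) * fst (complex_of_real (Re x), complex_of_real (Im x)) +
          of_real (f \<i>) * snd (complex_of_real (Re x), complex_of_real (Im x)) = of_real (f x)" for x
        by (subst bounded_linear_complex_to_real[OF linear, of x]) simp
    qed
  next
    case (const c)
    show ?case by (intro exI[of _ "\<lambda>z. of_real c"]) (auto simp: entire2_def)
  next
    case (add f g)
    then obtain Q Q' where "entire2 Q" "\<And>x. Q (of_real (Re x), of_real (Im x)) = of_real (f x)"
      "entire2 Q'" "\<And>x. Q' (of_real (Re x), of_real (Im x)) = of_real (g x)" by blast
    then show ?case
      by (intro exI[of _ "\<lambda>z. Q z + Q' z"]) (auto simp: entire2_def intro!: holomorphic_on_add)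
  next
    case (mult f g)
    then obtain Q Q' where "entire2 Q" "\<And>x. Q (of_real (Re x), of_real (Im x)) = of_real (f x)"
      "entire2 Q'" "\<And>x. Q' (of_real (Re x), of_real (Im x)) = of_real (g x)" by blast
    then show ?case
      by (intro exI[of _ "\<lambda>z. Q z * Q' z"]) (auto simp: entire2_def intro!: holomorphic_on_mult)
  qed
  then show ?thesis using that by blast
qed

text \<open>Moving backwards along the homotopy in small steps, a function that is locally a primitive
  composed with \<open>H(-, v)\<close> is transported from \<open>v = 1\<close>, where it is \<open>0\<close>, to \<open>v = 0\<close>.\<close>

lemma nullhomotopic_forms_exact:
  fixes A :: "complex set" and H :: "complex \<times> real \<Rightarrow> complex \<times> complex"
  assumes A: "compact A" and ch: "\<And>c. c \<in> C \<Longrightarrow> curve_chart C c"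
    and H: "continuous_on (A \<times> {0..1}) H" "H ` (A \<times> {0..1}) \<subseteq> C"
    and H0: "\<And>a. a \<in> A \<Longrightarrow> H (a, 0) = (of_real (Re a), of_real (Im a))"
    and H1: "\<And>a. a \<in> A \<Longrightarrow> H (a, 1) = c1"
    and P: "real_polynomial_function P1" "real_polynomial_function P2"
  obtains F :: "complex \<Rightarrow> real"
    where "\<And>a. a \<in> A \<Longrightarrow> (F has_derivative (\<lambda>h. P1 a * Re h + P2 a * Im h)) (at a within A)"
proof (cases "A = {}")
  case True
  then show ?thesis using that by blast
next
  case False
  obtain a0 where a0: "a0 \<in> A" using False by blast
  obtain Q1 where Q1: "entire2 Q1" "\<And>x. Q1 (of_real (Re x), of_real (Im x)) = of_real (P1 x)"
    using real_polynomial_entire_extension[OF P(1)] by blast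
  obtain Q2 where Q2: "entire2 Q2" "\<And>x. Q2 (of_real (Re x), of_real (Im x)) = of_real (P2 x)"
    using real_polynomial_entire_extension[OF P(2)] by blast
  let ?prim = "form_primitive C Q1 Q2"
  have HC: "H (a, v) \<in> C" if "a \<in> A" "0 \<le> v" "v \<le> 1" for a v using H(2) that by force
  define L where "L v F \<longleftrightarrow> (\<forall>a\<in>A. \<exists>T N \<Phi>. open T \<and> a \<in> T \<and> ?prim N \<Phi> \<and>
      (\<forall>b\<in>A \<inter> T. H (b, v) \<in> N \<and> F b = \<Phi> (H (b, v))))" for v F
  \<comment> \<open>Over each member of \<open>\<G>\<close> a single primitive suffices; a Lebesgue
    number of this cover bounds the time step.\<close>
  define \<G> where "\<G> = {W. open W \<and> (\<exists>N \<Phi>. ?prim N \<Phi> \<and> H ` (W \<inter> (A \<times> {0..1})) \<subseteq> N)}"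
  obtain \<epsilon> where \<epsilon>: "\<epsilon> > 0" "\<And>x. x \<in> A \<times> {0..1} \<Longrightarrow> \<exists>G\<in>\<G>. ball x \<epsilon> \<subseteq> G"
  proof (rule Heine_Borel_lemma)
    show "compact (A \<times> {0..1::real})" using A by (intro compact_Times) auto
    show "A \<times> {0..1} \<subseteq> \<Union>\<G>"
    proof
      fix x assume x: "x \<in> A \<times> {0..1::real}"
      then have "H x \<in> C" using H(2) by blast
      then obtain N \<Phi> where N: "H x \<in> N" "?prim N \<Phi>"
        using form_primitive_exists[OF ch Q1(1) Q2(1)] by blast
      then have "open N" by (simp add: form_primitive_def)
      then obtain W where "open W" "W \<inter> (A \<times> {0..1}) = H -` N \<inter> (A \<times> {0..1})"
        using H(1)[unfolded continuous_on_open_invariant] by blast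
      then show "x \<in> \<Union>\<G>" using x N unfolding \<G>_def by blast
    qed
  qed (auto simp: \<G>_def)
  have small: "\<exists>T N \<Phi>. open T \<and> a \<in> T \<and> ?prim N \<Phi> \<and> (\<forall>b\<in>A \<inter> T. \<forall>x\<in>{v..v'}. H (b, x) \<in> N)"
    if a: "a \<in> A" and v: "0 \<le> v" "v' \<le> 1" "v' - v < \<epsilon> / 2" for a v v'
  proof (cases "v \<le> v'")
    case True
    then obtain G where G: "G \<in> \<G>" "ball (a, v) \<epsilon> \<subseteq> G" using \<epsilon>(2)[of "(a, v)"] a v by auto
    then obtain N \<Phi> where N: "?prim N \<Phi>" "H ` (G \<inter> (A \<times> {0..1})) \<subseteq> N" unfolding \<G>_def by blast
    show ?thesis
    proof (intro exI conjI ballI)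
      fix b x assume b: "b \<in> A \<inter> ball a (\<epsilon> / 2)" and x: "x \<in> {v..v'}"
      have "dist (a, v) (b, x) \<le> dist a b + dist v x"
        unfolding dist_prod_def fst_conv snd_conv
        by (rule order_trans[OF sqrt_add_le_add_sqrt]) auto
      also have "\<dots> < \<epsilon>" using b x v by (simp add: dist_real_def)
      finally have "(b, x) \<in> G" using G(2) by auto
      then show "H (b, x) \<in> N" using N(2) b x v by force
    qed (use \<epsilon>(1) N in auto)
  next
    case False
    \<comment> \<open>The interval of times is empty here, so any primitive will do.\<close>
    obtain N \<Phi> where "?prim N \<Phi>"
      using form_primitive_exists[OF ch[OF HC[of a 0]] Q1(1) Q2(1)] a by (metis zero_le_one order_refl)
    with False show ?thesis by (intro exI[of _ UNIV] exI[of _ N] exI[of _ \<Phi>]) auto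
  qed
  have slice: "continuous_on A (\<lambda>b. H (b, v))" "continuous_on {0..1} (\<lambda>x. H (b, x))"
    if "b \<in> A" "0 \<le> v" "v \<le> 1" for b v
    by (rule continuous_on_compose2[OF H(1) continuous_on_Pair[OF continuous_on_id continuous_on_const]],
        use that in auto)
       (rule continuous_on_compose2[OF H(1) continuous_on_Pair[OF continuous_on_const continuous_on_id]],
        use that in auto)
  have step: "\<exists>F. L v F" if LF: "L v' F" and v: "0 \<le> v" "v \<le> v'" "v' \<le> 1" "v' - v < \<epsilon> / 2" for v v' F
  proof -
    have "\<forall>a\<in>A. \<exists>T N \<Phi>. open T \<and> a \<in> T \<and> ?prim N \<Phi> \<and> (\<forall>b\<in>A \<inter> T. \<forall>x\<in>{v..v'}. H (b, x) \<in> N)"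
      using small[OF _ v(1,3,4)] by blast
    then obtain T N \<Phi> where TN: "\<forall>a\<in>A. open (T a) \<and> a \<in> T a \<and> ?prim (N a) (\<Phi> a) \<and>
        (\<forall>b\<in>A \<inter> T a. \<forall>x\<in>{v..v'}. H (b, x) \<in> N a)"
      unfolding bchoice_iff by (elim exE) (rule that)
    have X: "open (T a)" "a \<in> T a" "?prim (N a) (\<Phi> a)"
      "b \<in> A \<Longrightarrow> b \<in> T a \<Longrightarrow> x \<in> {v..v'} \<Longrightarrow> H (b, x) \<in> N a" if "a \<in> A" for a b x
      using TN that by blast+
    \<comment> \<open>At each \<open>b\<close> the change from \<open>v'\<close> to \<open>v\<close>
      is computed with the primitive chosen at \<open>b\<close> itself. By
      \<open>form_primitive_path_diff\<close> the primitive chosen at a nearby \<open>a\<close>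
      gives the same change, so near \<open>a\<close> the function \<open>F'\<close> is one
      primitive composed with the slice \<open>v\<close> of the homotopy.\<close>
    define F' where "F' b = F b + (\<Phi> b (H (b, v)) - \<Phi> b (H (b, v')))" for b
    have "L v F'"
      unfolding L_def
    proof
      fix a assume a: "a \<in> A"
      obtain T0 N0 \<Phi>0 where 0: "open T0" "a \<in> T0" "?prim N0 \<Phi>0"
        and F0': "\<forall>b\<in>A \<inter> T0. H (b, v') \<in> N0 \<and> F b = \<Phi>0 (H (b, v'))"
        using bspec[OF LF[unfolded L_def] a] by (elim exE conjE) (rule that)
      have F0: "H (b, v') \<in> N0 \<and> F b = \<Phi>0 (H (b, v'))" if "b \<in> A" "b \<in> T0" for b
        using F0' that by blast
      have v'01: "v' \<in> {v..v'}" "0 \<le> v'" using v by auto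
      from form_primitive_diff_locally_constant[OF ch[OF HC[OF a v'01(2) v(3)]] 0(3) X(3)[OF a]
          conjunct1[OF F0[OF a 0(2)]] X(4)[OF a a X(2)[OF a] v'01(1)]]
      obtain M k where M: "open M" "H (a, v') \<in> M" "\<And>x. x \<in> C \<inter> M \<Longrightarrow> \<Phi>0 x = \<Phi> a x + k"
        by blast
      obtain T1 where T1: "open T1" "T1 \<inter> A = (\<lambda>b. H (b, v')) -` M \<inter> A"
        using slice(1)[OF a v'01(2) v(3)] M(1) unfolding continuous_on_open_invariant by blast
      have aT1: "a \<in> T1" using T1(2) M(2) a by blast
      show "\<exists>T N \<Phi>. open T \<and> a \<in> T \<and> ?prim N \<Phi> \<and>
        (\<forall>b\<in>A \<inter> T. H (b, v) \<in> N \<and> F' b = \<Phi> (H (b, v)))"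
      proof (intro exI conjI ballI)
        show "open (T0 \<inter> T1 \<inter> T a)" using 0 T1 X a by blast
        show "a \<in> T0 \<inter> T1 \<inter> T a" using 0 aT1 X a by blast
        show "?prim (N a) (\<lambda>x. \<Phi> a x + k)"
          using X(3)[OF a] unfolding form_primitive_def
          by (auto intro!: derivative_eq_intros)
        fix b assume b: "b \<in> A \<inter> (T0 \<inter> T1 \<inter> T a)"
        then have bA: "b \<in> A" by blast
        show "H (b, v) \<in> N a" using X(4)[OF a, of b v] b v by auto
        have "\<Phi> b (H (b, v)) - \<Phi> a (H (b, v)) = \<Phi> b (H (b, v')) - \<Phi> a (H (b, v'))"
        proof (rule form_primitive_path_diff[OF ch X(3)[OF bA] X(3)[OF a], where \<gamma> = "\<lambda>x. H (b, x)"])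
          show "continuous_on {v..v'} (\<lambda>x. H (b, x))"
            by (rule continuous_on_subset[OF slice(2)[OF bA, of 0]]) (use v in auto)
          show "H (b, x) \<in> C \<inter> N b \<inter> N a" if "x \<in> {v..v'}" for x
            using X(4)[OF a bA _ that] X(4)[OF bA bA X(2)[OF bA] that] HC[OF bA, of x] b v that by auto
        qed (use v in auto)
        moreover have "F b = \<Phi> a (H (b, v')) + k"
          using F0[OF bA] M(3)[of "H (b, v')"] T1(2) b HC[OF bA v'01(2) v(3)] by auto
        ultimately show "F' b = \<Phi> a (H (b, v)) + k" by (simp add: F'_def algebra_simps)
      qed
    qed
    then show ?thesis by blast
  qed
  have "L 1 (\<lambda>b. 0)"
  proof -
    have "c1 \<in> C" using HC[OF a0, of 1] H1[OF a0] by simp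
    then obtain N \<Phi> where N: "c1 \<in> N" "?prim N \<Phi>"
      using form_primitive_exists[OF ch Q1(1) Q2(1)] by blast
    \<comment> \<open>Shifted to vanish at \<open>c1\<close>, the value of the homotopy at time
      1.\<close>
    then have "?prim N (\<lambda>x. \<Phi> x - \<Phi> c1)"
      unfolding form_primitive_def by (auto intro!: derivative_eq_intros)
    then show ?thesis unfolding L_def using H1 N(1)
      by (intro ballI exI[of _ UNIV] exI[of _ N] exI[of _ "\<lambda>x. \<Phi> x - \<Phi> c1"]) auto
  qed
  obtain n :: nat where n: "n > 0" "1 / real n < \<epsilon> / 2"
    using \<epsilon>(1) by (metis half_gt_zero nat_approx_posE zero_less_Suc)
  have "\<exists>F. L (1 - real j / real n) F" if "j \<le> n" for j
    using that
  proof (induction j)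
    case 0
    with \<open>L 1 (\<lambda>b. 0)\<close> show ?case by (auto intro!: exI[of _ "\<lambda>b. 0"])
  next
    case (Suc j)
    then obtain F where "L (1 - real j / real n) F" by auto
    then show ?case
      by (rule step) (use Suc n in \<open>auto simp: field_simps\<close>)
  qed
  from this[of n] n obtain F where F: "L 0 F" by auto
  show ?thesis
  proof (rule that)
    fix a assume a: "a \<in> A"
    obtain T N \<Phi> where T: "open T" "a \<in> T" "?prim N \<Phi>"
      and T': "\<forall>b\<in>A \<inter> T. H (b, 0) \<in> N \<and> F b = \<Phi> (H (b, 0))"
      using bspec[OF F[unfolded L_def] a] by (elim exE conjE) (rule that)
    have TF: "H (b, 0) \<in> N \<and> F b = \<Phi> (H (b, 0))" if "b \<in> A" "b \<in> T" for b
      using T' that by blast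
    define \<iota> where "\<iota> b = (complex_of_real (Re b), complex_of_real (Im b))" for b
    have \<iota>: "bounded_linear \<iota>"
      unfolding \<iota>_def
      by (intro bounded_linear_Pair bounded_linear_compose[OF bounded_linear_of_real] bounded_linear_Re bounded_linear_Im)
    have "\<iota> ` A \<subseteq> C" using H0 HC by (auto simp: \<iota>_def) (metis zero_le_one order_refl)
    moreover have "(\<Phi> has_derivative (\<lambda>h. Q1 (\<iota> a) * fst h + Q2 (\<iota> a) * snd h)) (at (\<iota> a) within C)"
      using T(3) TF[OF a T(2)] HC[OF a, of 0] H0[OF a] unfolding form_primitive_def \<iota>_def by auto
    ultimately have "((\<lambda>b. \<Phi> (\<iota> b)) has_derivative (\<lambda>h. Q1 (\<iota> a) * fst (\<iota> h) + Q2 (\<iota> a) * snd (\<iota> h))) (at a within A)"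
      by (intro has_derivative_in_compose[OF bounded_linear_imp_has_derivative[OF \<iota>]])
         (auto intro: has_derivative_subset)
    \<comment> \<open>The extended form is real on real tangent vectors at real points, so the real
      part of the primitive keeps the derivative.\<close>
    then have "((\<lambda>b. Re (\<Phi> (\<iota> b))) has_derivative
        (\<lambda>h. Re (Q1 (\<iota> a) * fst (\<iota> h) + Q2 (\<iota> a) * snd (\<iota> h)))) (at a within A)"
      by (rule bounded_linear.has_derivative[OF bounded_linear_Re])
    then have d: "((\<lambda>b. Re (\<Phi> (\<iota> b))) has_derivative (\<lambda>h. P1 a * Re h + P2 a * Im h)) (at a within A)"
      unfolding \<iota>_def Q1(2) Q2(2) by simp
    obtain d0 where d0: "d0 > 0" "ball a d0 \<subseteq> T" using T open_contains_ball by blast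
    show "((\<lambda>b. Re (F b)) has_derivative (\<lambda>h. P1 a * Re h + P2 a * Im h)) (at a within A)"
    proof (rule has_derivative_transform_within[OF d d0(1) a])
      fix b assume b: "b \<in> A" "dist b a < d0"
      then have "b \<in> T" using d0(2) by (auto simp: dist_commute)
      with TF[OF b(1)] H0[OF b(1)] show "Re (\<Phi> (\<iota> b)) = Re (F b)" by (simp add: \<iota>_def)
    qed
  qed
qed

section \<open>Compact curves carry non-exact forms\<close>

text \<open>The parameter interval is open around 0 and \<open>e 0 = a\<close>, which is how the
  absence of endpoints is expressed. The continuous left inverse \<open>\<pi>\<close> makes
  \<open>e\<close> an embedding.\<close>

definition arc_chart :: "complex set \<Rightarrow> complex \<Rightarrow> complex set \<Rightarrow> real \<Rightarrow> (real \<Rightarrow> complex) \<Rightarrow>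
    (real \<Rightarrow> complex) \<Rightarrow> (complex \<Rightarrow> real) \<Rightarrow> bool" where
  "arc_chart A a N r e e' \<pi> \<longleftrightarrow> open N \<and> a \<in> N \<and> r > 0 \<and> continuous_on UNIV \<pi> \<and>
     A \<inter> N = e ` {-r<..<r} \<and> e 0 = a \<and> continuous_on {-r<..<r} e' \<and>
     (\<forall>t\<in>{-r<..<r}. (e has_vector_derivative e' t) (at t) \<and> e' t \<noteq> 0 \<and> \<pi> (e t) = t)"

definition forms_exact_on :: "complex set \<Rightarrow> bool" where
  "forms_exact_on A \<longleftrightarrow> (\<forall>P1 P2. real_polynomial_function P1 \<longrightarrow> real_polynomial_function P2 \<longrightarrow>
     (\<exists>F::complex \<Rightarrow> real. \<forall>a\<in>A. (F has_derivative (\<lambda>h. P1 a * Re h + P2 a * Im h)) (at a within A)))"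

text \<open>The points reachable by chains from a fixed point form a clopen set, hence all of
  \<open>A\<close>, and a finite subcover bounds the lengths. The common \<open>n\<close> turns an
  estimate on one arc into an estimate on all of \<open>A\<close>: once for the variation of a
  logarithm, once for a diameter in the inner metric.\<close>

lemma uniform_chains:
  assumes A: "compact A" "connected A" and N: "\<And>a. a \<in> A \<Longrightarrow> open (N a) \<and> a \<in> N a"
  obtains n where "\<And>b c. b \<in> A \<Longrightarrow> c \<in> A \<Longrightarrow>
    (b, c) \<in> {(x, y). x \<in> A \<and> y \<in> A \<and> (\<exists>a\<in>A. x \<in> N a \<and> y \<in> N a)} ^^ n"
proof (cases "A = {}")
  case True
  then show ?thesis using that by blast
next
  case False
  define R where "R = {(x, y). x \<in> A \<and> y \<in> A \<and> (\<exists>a\<in>A. x \<in> N a \<and> y \<in> N a)}"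
  obtain a0 where a0: "a0 \<in> A" using False by blast
  have refl: "(b, b) \<in> R" if "b \<in> A" for b using that N by (auto simp: R_def)
  have symR: "(c, b) \<in> R" if "(b, c) \<in> R" for b c using that by (auto simp: R_def)
  have sym: "(c, b) \<in> R ^^ n" if "(b, c) \<in> R ^^ n" for b c n
    using that
  proof (induction n arbitrary: c)
    case (Suc n)
    then obtain y where "(b, y) \<in> R ^^ n" "(y, c) \<in> R" by auto
    with Suc.IH symR show ?case by (meson relpow_Suc_I2)
  qed auto
  have mono: "(b, c) \<in> R ^^ (n + k)" if "(b, c) \<in> R ^^ n" "c \<in> A" for b c n k
  proof (induction k)
    case (Suc k)
    then show ?case using refl[OF that(2)] by (simp only: add_Suc_right) (rule relpow_Suc_I)
  qed (use that in simp)
  define S where "S = {b \<in> A. \<exists>n. (a0, b) \<in> R ^^ n}"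
  have near: "c \<in> S" if nb: "b \<in> S" "a \<in> A" "b \<in> N a" "c \<in> N a" "c \<in> A" for a b c
  proof -
    obtain n where "(a0, b) \<in> R ^^ n" using nb(1) unfolding S_def by blast
    moreover have "(b, c) \<in> R" using nb by (auto simp: R_def S_def)
    ultimately have "(a0, c) \<in> R ^^ Suc n" by (rule relpow_Suc_I)
    with nb show ?thesis unfolding S_def by blast
  qed
  have o1: "openin (top_of_set A) S"
  proof (subst openin_subopen, rule ballI)
    fix b assume b: "b \<in> S"
    then have bA: "b \<in> A" by (simp add: S_def)
    show "\<exists>T. openin (top_of_set A) T \<and> b \<in> T \<and> T \<subseteq> S"
      by (rule exI[of _ "A \<inter> N b"]) (use bA N[OF bA] near[OF b bA] in \<open>auto simp: openin_open\<close>)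
  qed
  have o2: "openin (top_of_set A) (A - S)"
  proof (subst openin_subopen, rule ballI)
    fix b assume b: "b \<in> A - S"
    then have bA: "b \<in> A" by simp
    show "\<exists>T. openin (top_of_set A) T \<and> b \<in> T \<and> T \<subseteq> A - S"
      by (rule exI[of _ "A \<inter> N b"]) (use b bA N[OF bA] near[OF _ bA] in \<open>auto simp: openin_open\<close>)
  qed
  have "a0 \<in> S" using a0 by (auto simp: S_def intro!: exI[of _ 0])
  moreover have "closedin (top_of_set A) S"
    using o2 by (auto simp: closedin_def S_def)
  ultimately have "S = A" using A(2) o1 unfolding connected_clopen by blast
  then have "\<forall>b\<in>A. \<exists>n. (a0, b) \<in> R ^^ n" by (auto simp: S_def)
  from bchoice[OF this] obtain n where n: "\<And>b. b \<in> A \<Longrightarrow> (a0, b) \<in> R ^^ n b" by blast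
  obtain B where B: "B \<subseteq> A" "finite B" "A \<subseteq> (\<Union>b\<in>B. N b)"
  proof (rule compactE_image[OF A(1), of A N])
    show "A \<subseteq> (\<Union>c\<in>A. N c)" using N by auto
  qed (use N in auto)
  \<comment> \<open>\<open>Suc\<close> pays for the last step, from the centre \<open>b\<close> to
    the point; shorter chains are padded with reflexive steps.\<close>
  define m where "m = Suc (\<Sum>b\<in>B. n b)"
  have m: "(a0, c) \<in> R ^^ m" if cA: "c \<in> A" for c
  proof -
    obtain b where b: "b \<in> B" "c \<in> N b" using B cA by blast
    then have bA: "b \<in> A" using B by blast
    have "(b, c) \<in> R" using bA b cA N[OF bA] by (auto simp: R_def)
    with n[OF bA] have "(a0, c) \<in> R ^^ Suc (n b)" by (rule relpow_Suc_I)
    moreover have "n b \<le> (\<Sum>b\<in>B. n b)" using B b by (intro member_le_sum) auto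
    then have "m = Suc (n b) + (m - Suc (n b))" by (simp add: m_def)
    ultimately show ?thesis using mono cA by metis
  qed
  have "(b, c) \<in> R ^^ (m + m)" if "b \<in> A" "c \<in> A" for b c
    using sym[OF m[OF that(1)]] m[OF that(2)] unfolding relpow_add by blast
  then show ?thesis using that unfolding R_def by blast
qed

text \<open>The normalization bounds the length of the whole arc by 1: the speed is at most
  \<open>B\<close> over a parameter interval of length 2 r'.\<close>

lemma arc_chart_shrink:
  assumes "arc_chart A a N r e e' \<pi>"
  obtains N' r' B where "arc_chart A a N' r' e e' \<pi>" "B > 0" "2 * r' * B \<le> 1"
    "\<And>t. t \<in> {-r'<..<r'} \<Longrightarrow> norm (e' t) \<le> B"
proof -
  have ch: "open N" "a \<in> N" "r > 0" "continuous_on UNIV \<pi>"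
     "A \<inter> N = e ` {-r<..<r}" "e 0 = a" "continuous_on {-r<..<r} e'"
     "\<And>t. t\<in>{-r<..<r} \<Longrightarrow> (e has_vector_derivative e' t) (at t) \<and> e' t \<noteq> 0 \<and> \<pi> (e t) = t"
    using assms unfolding arc_chart_def by auto
  have "isCont e' 0"
    using ch(3,7) by (simp add: continuous_on_eq_continuous_at)
  then obtain d where d: "d > 0" "\<And>t. \<bar>t\<bar> < d \<Longrightarrow> dist (e' t) (e' 0) < 1"
    unfolding continuous_at_eps_delta by (elim allE[of _ 1]) (auto simp: dist_real_def)
  define B where "B = norm (e' 0) + 1"
  have B: "B > 0" by (simp add: B_def add_nonneg_pos)
  define r' where "r' = min (min r d) (1 / (2 * B))"
  have r': "r' > 0" "r' \<le> r" "r' \<le> d" "r' \<le> 1 / (2 * B)" using ch(3) d B by (auto simp: r'_def)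
  define N' where "N' = N \<inter> \<pi> -` {-r'<..<r'}"
  have "arc_chart A a N' r' e e' \<pi>"
    unfolding arc_chart_def
  proof (intro conjI ballI)
    show "open N'" unfolding N'_def
      using ch(1,4) by (intro open_Int open_vimage) auto
    show "a \<in> N'" using ch(2) ch(8)[of 0] ch(3,6) r' by (auto simp: N'_def)
    show "A \<inter> N' = e ` {-r'<..<r'}"
    proof (intro equalityI subsetI)
      fix x assume x: "x \<in> A \<inter> N'"
      then have "x \<in> e ` {-r<..<r}" using ch(5) unfolding N'_def by blast
      then obtain t where t: "t \<in> {-r<..<r}" "x = e t" by blast
      then show "x \<in> e ` {-r'<..<r'}" using x ch(8)[OF t(1)] by (auto simp: N'_def)
    next
      fix x assume "x \<in> e ` {-r'<..<r'}"
      then obtain t where t: "t \<in> {-r'<..<r'}" "x = e t" by blast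
      then have tr: "t \<in> {-r<..<r}" using r' by auto
      then have "x \<in> A \<inter> N" using ch(5) t by blast
      then show "x \<in> A \<inter> N'" using ch(8)[OF tr] t by (auto simp: N'_def)
    qed
    show "continuous_on {-r'<..<r'} e'" using r' by (intro continuous_on_subset[OF ch(7)]) auto
  qed (use ch r' in auto)
  moreover have "2 * r' * B \<le> 1" using r'(4) B by (simp add: field_simps)
  moreover have "norm (e' t) \<le> B" if "t \<in> {-r'<..<r'}" for t
  proof -
    have "dist (e' t) (e' 0) < 1" using d(2)[of t] that r' by auto
    moreover have "norm (e' t) \<le> norm (e' 0) + dist (e' t) (e' 0)"
      unfolding dist_norm by (metis norm_triangle_sub add.commute)
    ultimately show ?thesis by (simp add: B_def)
  qed
  ultimately show ?thesis using that B by blast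
qed

section \<open>Polynomial approximation and continuous logarithms\<close>

lemma real_polynomial_function_derivative:
  assumes "real_polynomial_function (p :: complex \<Rightarrow> real)"
  obtains p1 p2 where "real_polynomial_function p1" "real_polynomial_function p2"
    "\<And>x. (p has_derivative (\<lambda>h. p1 x * Re h + p2 x * Im h)) (at x)"
proof -
  have "\<exists>p1 p2. real_polynomial_function p1 \<and> real_polynomial_function p2 \<and>
    (\<forall>x. (p has_derivative (\<lambda>h. p1 x * Re h + p2 x * Im h)) (at x))"
    using assms
  proof induction
    case (linear f)
    have "f = (\<lambda>h. f 1 * Re h + f \<i> * Im h)"
      by (rule ext) (rule bounded_linear_complex_to_real[OF linear])
    then have "(f has_derivative (\<lambda>h. f 1 * Re h + f \<i> * Im h)) (at x)" for x
      using bounded_linear_imp_has_derivative[OF linear] by simp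
    then show ?case
      by (intro exI[of _ "\<lambda>x. f 1"] exI[of _ "\<lambda>x. f \<i>"]) (simp add: real_polynomial_function.intros(2))
  next
    case (const c)
    show ?case
      by (intro exI[of _ "\<lambda>x. 0"]) (auto simp: real_polynomial_function.intros(2))
  next
    case (add f g)
    then obtain f1 f2 g1 g2 where *: "real_polynomial_function f1" "real_polynomial_function f2"
      "real_polynomial_function g1" "real_polynomial_function g2"
      "\<And>x. (f has_derivative (\<lambda>h. f1 x * Re h + f2 x * Im h)) (at x)"
      "\<And>x. (g has_derivative (\<lambda>h. g1 x * Re h + g2 x * Im h)) (at x)" by (elim exE conjE) simp
    have "((\<lambda>x. f x + g x) has_derivative (\<lambda>h. (f1 x + g1 x) * Re h + (f2 x + g2 x) * Im h)) (at x)" for x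
      using has_derivative_add[OF *(5,6)[of x]] by (simp add: algebra_simps)
    then show ?case using * by (intro exI[of _ "\<lambda>x. f1 x + g1 x"] exI[of _ "\<lambda>x. f2 x + g2 x"]) auto
  next
    case (mult f g)
    then obtain f1 f2 g1 g2 where *: "real_polynomial_function f1" "real_polynomial_function f2"
      "real_polynomial_function g1" "real_polynomial_function g2"
      "\<And>x. (f has_derivative (\<lambda>h. f1 x * Re h + f2 x * Im h)) (at x)"
      "\<And>x. (g has_derivative (\<lambda>h. g1 x * Re h + g2 x * Im h)) (at x)" by (elim exE conjE) simp
    have "((\<lambda>x. f x * g x) has_derivative
      (\<lambda>h. (f x * g1 x + f1 x * g x) * Re h + (f x * g2 x + f2 x * g x) * Im h)) (at x)" for x
      using has_derivative_mult[OF *(5,6)[of x]] by (simp add: algebra_simps)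
    then show ?case using * mult.hyps
      by (intro exI[of _ "\<lambda>x. f x * g1 x + f1 x * g x"] exI[of _ "\<lambda>x. f x * g2 x + f2 x * g x"])
         (auto intro!: real_polynomial_function.intros(3) real_polynomial_function.intros(4))
  qed
  then show ?thesis using that by blast
qed

lemma complex_stone_weierstrass:
  assumes "compact A" "continuous_on A (u :: complex \<Rightarrow> complex)" "d > 0"
  obtains p1 p2 where "real_polynomial_function p1" "real_polynomial_function p2"
    "\<And>a. a \<in> A \<Longrightarrow> \<bar>Re (u a) - p1 a\<bar> < d" "\<And>a. a \<in> A \<Longrightarrow> \<bar>Im (u a) - p2 a\<bar> < d"
    "\<And>a. a \<in> A \<Longrightarrow> norm (u a - Complex (p1 a) (p2 a)) < 2 * d"
proof -
  obtain p1 where p1: "real_polynomial_function p1" "\<And>a. a \<in> A \<Longrightarrow> \<bar>Re (u a) - p1 a\<bar> < d"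
    using Stone_Weierstrass_real_polynomial_function[OF assms(1) continuous_on_Re[OF assms(2)] assms(3)]
    by blast
  obtain p2 where p2: "real_polynomial_function p2" "\<And>a. a \<in> A \<Longrightarrow> \<bar>Im (u a) - p2 a\<bar> < d"
    using Stone_Weierstrass_real_polynomial_function[OF assms(1) continuous_on_Im[OF assms(2)] assms(3)]
    by blast
  have "norm (u a - Complex (p1 a) (p2 a)) < 2 * d" if "a \<in> A" for a
    using cmod_le[of "u a - Complex (p1 a) (p2 a)"] p1(2)[OF that] p2(2)[OF that] by simp
  with p1 p2 show ?thesis using that by blast
qed

text \<open>For a polynomial map U close to \<open>u\<close>, the form dU / U has continuous
  coefficients on \<open>A\<close>. Polynomial forms approximating it are exact, with a complex
  primitive F. Then g = U exp (-F) has a small logarithmic derivative, so across a bounded number of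
  arcs the quotients of its values stay in the right half-plane, where the principal logarithm is
  continuous.\<close>

lemma exact_forms_logarithm:
  fixes u :: "complex \<Rightarrow> complex"
  assumes A: "compact A" "connected A" and ch: "\<And>a. a \<in> A \<Longrightarrow> \<exists>N r e e' \<pi>. arc_chart A a N r e e' \<pi>"
    and ex: "forms_exact_on A" and u: "continuous_on A u" "\<And>a. a \<in> A \<Longrightarrow> norm (u a) = 1"
  obtains \<Lambda> where "continuous_on A \<Lambda>" "\<And>a. a \<in> A \<Longrightarrow> u a = exp (\<Lambda> a)"
proof (cases "A = {}")
  case True
  then show ?thesis using that by auto
next
  case False
  then obtain a0 where a0: "a0 \<in> A" by blast
  \<comment> \<open>Since |u| = 1, an error below 1/2 makes U free of zeros and gives U / u positive
    real part.\<close>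
  obtain U1 U2 where U12: "real_polynomial_function U1" "real_polynomial_function U2"
    "\<And>a. a \<in> A \<Longrightarrow> norm (u a - Complex (U1 a) (U2 a)) < 2 * (1 / 4)"
    using complex_stone_weierstrass[OF A(1) u(1), of "1/4"] by (metis zero_less_divide_1_iff zero_less_numeral)
  define U where "U a = Complex (U1 a) (U2 a)" for a
  have Uu: "norm (u a - U a) < 1 / 2" if "a \<in> A" for a using U12(3)[OF that] by (simp add: U_def)
  have U0: "U a \<noteq> 0" if "a \<in> A" for a using Uu[OF that] u(2)[OF that] by auto
  obtain p11 p12 where p1: "real_polynomial_function p11" "real_polynomial_function p12"
    "\<And>x. (U1 has_derivative (\<lambda>h. p11 x * Re h + p12 x * Im h)) (at x)"
    using real_polynomial_function_derivative[OF U12(1)] by blast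
  obtain p21 p22 where p2: "real_polynomial_function p21" "real_polynomial_function p22"
    "\<And>x. (U2 has_derivative (\<lambda>h. p21 x * Re h + p22 x * Im h)) (at x)"
    using real_polynomial_function_derivative[OF U12(2)] by blast
  define D1 where "D1 x = Complex (p11 x) (p21 x)" for x
  define D2 where "D2 x = Complex (p12 x) (p22 x)" for x
  have U': "(U has_derivative (\<lambda>h. D1 x * of_real (Re h) + D2 x * of_real (Im h))) (at x)" for x
  proof -
    have "((\<lambda>x. of_real (U1 x) + \<i> * of_real (U2 x)) has_derivative
      (\<lambda>h. of_real (p11 x * Re h + p12 x * Im h) + \<i> * of_real (p21 x * Re h + p22 x * Im h))) (at x)"
      by (intro has_derivative_add has_derivative_mult_right has_derivative_of_real p1 p2)
    moreover have "(\<lambda>x. of_real (U1 x) + \<i> * of_real (U2 x)) = U"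
      by (auto simp: U_def complex_eq_iff)
    moreover have "(\<lambda>h. of_real (p11 x * Re h + p12 x * Im h) + \<i> * of_real (p21 x * Re h + p22 x * Im h))
      = (\<lambda>h. D1 x * of_real (Re h) + D2 x * of_real (Im h))"
      by (auto simp: D1_def D2_def complex_eq_iff)
    ultimately show ?thesis by simp
  qed
  have cp: "continuous_on S p" if "real_polynomial_function p" for p :: "complex \<Rightarrow> real" and S
    using that by (simp add: continuous_on_polymonial_function real_polynomial_function_eq)
  have cC: "continuous_on S (\<lambda>x. Complex (p x) (q x))"
    if "real_polynomial_function p" "real_polynomial_function q" for p q :: "complex \<Rightarrow> real" and S
    using that by (intro continuous_on_Complex cp)
  have cU: "continuous_on S U" for S unfolding U_def by (intro cC U12)
  define q1 where "q1 a = D1 a / U a" for a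
  define q2 where "q2 a = D2 a / U a" for a
  have cq: "continuous_on A q1" "continuous_on A q2"
    unfolding q1_def q2_def D1_def D2_def
    by (intro continuous_on_divide cC cU p1 p2; use U0 in auto)+
  have "\<exists>N. \<exists>r e e' \<pi> B. arc_chart A a N r e e' \<pi> \<and> B > 0 \<and> 2 * r * B \<le> 1 \<and>
      (\<forall>t\<in>{-r<..<r}. norm (e' t) \<le> B)" if aA: "a \<in> A" for a
  proof -
    obtain N r e e' \<pi> where "arc_chart A a N r e e' \<pi>" using ch[OF aA] by blast
    from arc_chart_shrink[OF this] show ?thesis by metis
  qed
  then obtain N where arcN: "\<And>a. a \<in> A \<Longrightarrow> \<exists>r e e' \<pi> B. arc_chart A a (N a) r e e' \<pi> \<and>
      B > 0 \<and> 2 * r * B \<le> 1 \<and> (\<forall>t\<in>{-r<..<r}. norm (e' t) \<le> B)" by metis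
  define R where "R = {(x, y). x \<in> A \<and> y \<in> A \<and> (\<exists>a\<in>A. x \<in> N a \<and> y \<in> N a)}"
  have N: "open (N a) \<and> a \<in> N a" if "a \<in> A" for a
    using arcN[OF that] unfolding arc_chart_def by blast
  obtain n where n: "\<And>b c. b \<in> A \<Longrightarrow> c \<in> A \<Longrightarrow> (b, c) \<in> R ^^ n"
    using uniform_chains[OF A N, folded R_def] by blast
  \<comment> \<open>One arc will contribute at most 4 \<delta> to the logarithm of g, and
    \<open>n\<close> arcs together less than 1.\<close>
  define \<delta> where "\<delta> = 1 / (4 * (real n + 1))"
  have \<delta>: "\<delta> > 0" "4 * \<delta> * real n < 1" by (simp_all add: \<delta>_def field_simps)
  obtain r1 s1 where rs1: "real_polynomial_function r1" "real_polynomial_function s1"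
    "\<And>a. a \<in> A \<Longrightarrow> norm (q1 a - Complex (r1 a) (s1 a)) < 2 * \<delta>"
    using complex_stone_weierstrass[OF A(1) cq(1) \<delta>(1)] by metis
  obtain r2 s2 where rs2: "real_polynomial_function r2" "real_polynomial_function s2"
    "\<And>a. a \<in> A \<Longrightarrow> norm (q2 a - Complex (r2 a) (s2 a)) < 2 * \<delta>"
    using complex_stone_weierstrass[OF A(1) cq(2) \<delta>(1)] by metis
  obtain F1 where F1: "\<And>a. a \<in> A \<Longrightarrow> (F1 has_derivative (\<lambda>h. r1 a * Re h + r2 a * Im h)) (at a within A)"
    using ex rs1 rs2 unfolding forms_exact_on_def by metis
  obtain F2 where F2: "\<And>a. a \<in> A \<Longrightarrow> (F2 has_derivative (\<lambda>h. s1 a * Re h + s2 a * Im h)) (at a within A)"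
    using ex rs1 rs2 unfolding forms_exact_on_def by metis
  define F where "F a = complex_of_real (F1 a) + \<i> * complex_of_real (F2 a)" for a
  define T1 where "T1 a = Complex (r1 a) (s1 a)" for a
  define T2 where "T2 a = Complex (r2 a) (s2 a)" for a
  have F: "(F has_derivative (\<lambda>h. T1 a * of_real (Re h) + T2 a * of_real (Im h))) (at a within A)"
    if "a \<in> A" for a
  proof -
    have "(F has_derivative (\<lambda>h. of_real (r1 a * Re h + r2 a * Im h) + \<i> * of_real (s1 a * Re h + s2 a * Im h))) (at a within A)"
      unfolding F_def
      by (intro has_derivative_add has_derivative_mult_right has_derivative_of_real F1 F2 that)
    moreover have "(\<lambda>h. of_real (r1 a * Re h + r2 a * Im h) + \<i> * of_real (s1 a * Re h + s2 a * Im h))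
      = (\<lambda>h. T1 a * of_real (Re h) + T2 a * of_real (Im h))"
      by (auto simp: T1_def T2_def complex_eq_iff)
    ultimately show ?thesis by simp
  qed
  \<comment> \<open>\<open>g\<close> would be constant along \<open>A\<close> if the polynomial
    coefficients \<open>T1\<close>, \<open>T2\<close> were equal to \<open>q1\<close>,
    \<open>q2\<close>.\<close>
  define g where "g a = U a * exp (- F a)" for a
  have g': "(g has_derivative (\<lambda>h. g a * ((q1 a - T1 a) * of_real (Re h) + (q2 a - T2 a) * of_real (Im h)))) (at a within A)"
    if "a \<in> A" for a
  proof -
    have "((\<lambda>a. exp (- F a)) has_derivative
        (\<lambda>h. exp (- F a) * (- (T1 a * of_real (Re h) + T2 a * of_real (Im h))))) (at a within A)"
      using has_derivative_compose[OF has_derivative_minus[OF F[OF that]], of exp "\<lambda>h. exp (- F a) * h"]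
      by (simp add: has_field_derivative_imp_has_derivative[OF DERIV_exp])
    from has_derivative_mult[OF has_derivative_at_withinI[OF U'] this]
    have "(g has_derivative (\<lambda>h. U a * (exp (- F a) * (- (T1 a * of_real (Re h) + T2 a * of_real (Im h)))) +
       (D1 a * of_real (Re h) + D2 a * of_real (Im h)) * exp (- F a))) (at a within A)"
      unfolding g_def .
    moreover have "D1 a = q1 a * U a" "D2 a = q2 a * U a" using U0[OF that] by (auto simp: q1_def q2_def)
    ultimately show ?thesis by (simp add: g_def algebra_simps)
  qed
  have near: "\<exists>z. g b = g c * exp z \<and> norm z \<le> 4 * \<delta>" if bc: "(b, c) \<in> R" for b c
  proof -
    obtain a where a: "a \<in> A" "b \<in> N a" "c \<in> N a" "b \<in> A" "c \<in> A" using bc by (auto simp: R_def)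
    obtain r e e' \<pi> B where arc: "arc_chart A a (N a) r e e' \<pi>" and B: "B > 0" "2 * r * B \<le> 1"
      "\<And>t. t \<in> {-r<..<r} \<Longrightarrow> norm (e' t) \<le> B"
      using arcN[OF a(1)] by (elim exE conjE) metis
    have ch: "A \<inter> N a = e ` {-r<..<r}" "continuous_on {-r<..<r} e'"
      "\<And>t. t\<in>{-r<..<r} \<Longrightarrow> (e has_vector_derivative e' t) (at t)"
      using arc unfolding arc_chart_def by auto
    obtain t0 t1 where t: "t0 \<in> {-r<..<r}" "b = e t0" "t1 \<in> {-r<..<r}" "c = e t1"
      using a ch(1) by blast
    have eA: "e t \<in> A" if "t \<in> {-r<..<r}" for t using ch(1) that by blast
    define \<epsilon> where "\<epsilon> t = (q1 (e t) - T1 (e t)) * of_real (Re (e' t)) + (q2 (e t) - T2 (e t)) * of_real (Im (e' t))" for t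
    have ge: "((\<lambda>t. g (e t)) has_vector_derivative g (e t) * \<epsilon> t) (at t)" if "t \<in> {-r<..<r}" for t
    proof -
      have "(e has_derivative (\<lambda>h. h *\<^sub>R e' t)) (at t within {-r<..<r})"
        using ch(3)[OF that] unfolding has_vector_derivative_def by (rule has_derivative_at_withinI)
      moreover have "(g has_derivative (\<lambda>h. g (e t) * ((q1 (e t) - T1 (e t)) * of_real (Re h) +
          (q2 (e t) - T2 (e t)) * of_real (Im h)))) (at (e t) within e ` {-r<..<r})"
        using g'[OF eA[OF that]] by (rule has_derivative_subset) (use eA in auto)
      ultimately have "((\<lambda>t. g (e t)) has_derivative (\<lambda>h. g (e t) * ((q1 (e t) - T1 (e t)) * of_real (Re (h *\<^sub>R e' t)) +
          (q2 (e t) - T2 (e t)) * of_real (Im (h *\<^sub>R e' t))))) (at t within {-r<..<r})"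
        by (rule has_derivative_in_compose)
      then have "((\<lambda>t. g (e t)) has_derivative (\<lambda>h. h *\<^sub>R (g (e t) * \<epsilon> t))) (at t within {-r<..<r})"
        by (simp add: \<epsilon>_def scaleR_conv_of_real algebra_simps)
      then show ?thesis using that by (simp add: has_vector_derivative_def at_within_open[OF that])
    qed
    have n\<epsilon>: "norm (\<epsilon> t) \<le> 4 * \<delta> * B" if "t \<in> {-r<..<r}" for t
    proof -
      have "norm (\<epsilon> t) \<le> norm (q1 (e t) - T1 (e t)) * \<bar>Re (e' t)\<bar> + norm (q2 (e t) - T2 (e t)) * \<bar>Im (e' t)\<bar>"
        unfolding \<epsilon>_def by (rule order_trans[OF norm_triangle_ineq]) (simp add: norm_mult)
      also have "\<dots> \<le> (2 * \<delta>) * B + (2 * \<delta>) * B"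
        using rs1(3)[OF eA[OF that]] rs2(3)[OF eA[OF that]] B(3)[OF that] abs_Re_le_cmod[of "e' t"]
          abs_Im_le_cmod[of "e' t"] \<delta>(1)
        unfolding T1_def T2_def by (intro add_mono mult_mono) auto
      finally show ?thesis by (simp add: mult_ac)
    qed
    define I where "I = {min t0 t1..max t0 t1}"
    have I: "I \<subseteq> {-r<..<r}" "t0 \<in> I" "t1 \<in> I" using t by (auto simp: I_def)
    have ce: "continuous_on I e"
      using has_vector_derivative_continuous[OF ch(3)] I(1) by (intro continuous_at_imp_continuous_on) blast
    have c2: "continuous_on I (\<lambda>t. q (e t))" if "continuous_on A q" for q :: "complex \<Rightarrow> complex"
      by (rule continuous_on_compose2[OF that ce]) (use eA I in auto)
    have "continuous_on I \<epsilon>"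
      unfolding \<epsilon>_def T1_def T2_def
      by (intro continuous_on_add continuous_on_mult continuous_on_diff continuous_on_of_real
          continuous_on_Re continuous_on_Im c2 cq cC rs1 rs2 continuous_on_subset[OF ch(2) I(1)])
    \<comment> \<open>An antiderivative of the logarithmic derivative of \<open>g\<close> along the
      arc, so that \<open>g (e t) * exp (- E t)\<close> is constant.\<close>
    then obtain E where E: "\<And>t. t \<in> I \<Longrightarrow> (E has_vector_derivative \<epsilon> t) (at t within I)"
      unfolding I_def using antiderivative_continuous by blast
    have d0: "((\<lambda>t. g (e t) * exp (- E t)) has_vector_derivative 0) (at t within I)" if tI: "t \<in> I" for t
    proof -
      have "((\<lambda>t. exp (- E t)) has_vector_derivative (- \<epsilon> t) * exp (- E t)) (at t within I)"
        using field_vector_diff_chain_within[OF has_vector_derivative_minus[OF E[OF tI]], of exp "exp (- E t)"]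
        by (simp add: o_def has_field_derivative_at_within[OF DERIV_exp])
      moreover have "((\<lambda>t. g (e t)) has_vector_derivative g (e t) * \<epsilon> t) (at t within I)"
        by (rule has_vector_derivative_at_within[OF ge[OF subsetD[OF I(1) tI]]])
      ultimately have "((\<lambda>t. g (e t) * exp (- E t)) has_vector_derivative
          g (e t) * ((- \<epsilon> t) * exp (- E t)) + g (e t) * \<epsilon> t * exp (- E t)) (at t within I)"
        by (intro has_vector_derivative_mult)
      then show ?thesis by (simp add: algebra_simps)
    qed
    have "convex I" by (simp add: I_def)
    then obtain k where k: "\<And>t. t \<in> I \<Longrightarrow> g (e t) * exp (- E t) = k"
      using has_vector_derivative_zero_constant[OF _ d0] by metis
    have "g (e t0) * exp (- E t0) = g (e t1) * exp (- E t1)" using k[OF I(2)] k[OF I(3)] by simp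
    then have "g (e t0) = g (e t1) * exp (E t0 - E t1)"
      by (simp add: exp_minus exp_diff field_simps)
    moreover have "norm (E t0 - E t1) \<le> 4 * \<delta>"
    proof -
      have "norm (E t0 - E t1) \<le> (4 * \<delta> * B) * norm (t0 - t1)"
      proof (rule differentiable_bound[of I E "\<lambda>t h. h *\<^sub>R \<epsilon> t"])
        show "onorm (\<lambda>h. h *\<^sub>R \<epsilon> t) \<le> 4 * \<delta> * B" if "t \<in> I" for t
        proof (rule onorm_bound)
          show "norm (h *\<^sub>R \<epsilon> t) \<le> 4 * \<delta> * B * norm h" for h
            using mult_left_mono[OF n\<epsilon>[OF subsetD[OF I(1) that]], of "\<bar>h\<bar>"] by (simp add: mult_ac)
        qed (use B \<delta> in simp)
      qed (use E I in \<open>auto simp: has_vector_derivative_def I_def\<close>)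
      also have "(4 * \<delta> * B) * norm (t0 - t1) \<le> 4 * \<delta> * (B * (2 * r))"
      proof -
        have "norm (t0 - t1) \<le> 2 * r" using t by auto
        then have "(4 * \<delta> * B) * norm (t0 - t1) \<le> (4 * \<delta> * B) * (2 * r)"
          using \<delta> B by (intro mult_left_mono) auto
        then show ?thesis by (simp add: mult.assoc)
      qed
      also have "4 * \<delta> * (B * (2 * r)) \<le> 4 * \<delta> * 1"
        using \<delta> B(2) by (intro mult_left_mono) (auto simp: mult.commute)
      finally show ?thesis by simp
    qed
    ultimately show ?thesis using t by (intro exI[of _ "E t0 - E t1"]) simp
  qed
  have "\<exists>z. g b = g c * exp z \<and> norm z \<le> 4 * \<delta> * real k" if "(b, c) \<in> R ^^ k" for b c k
    using that
  proof (induction k arbitrary: c)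
    case 0
    then show ?case by (intro exI[of _ 0]) auto
  next
    case (Suc k)
    then obtain y where y: "(b, y) \<in> R ^^ k" "(y, c) \<in> R" by auto
    obtain z where z: "g b = g y * exp z" "norm z \<le> 4 * \<delta> * real k" using Suc.IH[OF y(1)] by blast
    obtain z' where z': "g y = g c * exp z'" "norm z' \<le> 4 * \<delta>" using near[OF y(2)] by blast
    have "norm (z' + z) \<le> 4 * \<delta> * real (Suc k)"
      using norm_triangle_ineq[of z' z] z(2) z'(2) by (simp add: algebra_simps)
    moreover have "g b = g c * exp (z' + z)" using z z' by (simp add: exp_add)
    ultimately show ?case by blast
  qed
  from this[OF n[OF _ a0]] \<delta>(2) have gz: "\<exists>z. g b = g a0 * exp z \<and> norm z < 1" if "b \<in> A" for b
    using that by (meson order_le_less_trans)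
  have g0: "g a0 \<noteq> 0" using U0[OF a0] by (simp add: g_def)
  have cF: "continuous_on A F"
    using F has_derivative_continuous unfolding continuous_on_eq_continuous_within by blast
  have cg: "continuous_on A g" unfolding g_def
    by (intro continuous_on_mult cU continuous_on_exp continuous_on_minus cF)
  \<comment> \<open>The first three terms exponentiate to \<open>U b\<close>, and the last one
    removes the factor U / u. Both quotients under \<open>Ln\<close> have positive real part, hence
    continuity.\<close>
  define \<Lambda> where "\<Lambda> b = F b + Ln (g a0) + Ln (g b / g a0) - Ln (U b / u b)" for b
  have nonneg: "z \<notin> \<real>\<^sub>\<le>\<^sub>0" if "Re z > 0" for z using that by (auto simp: complex_nonpos_Reals_iff)
  have 1: "Re (g b / g a0) > 0" if bA: "b \<in> A" for b
  proof -
    obtain z where z: "g b = g a0 * exp z" "norm z < 1" using gz[OF bA] by blast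
    \<comment> \<open>Since 1 < pi/2, the value exp z lies in the right half-plane.\<close>
    have "\<bar>Im z\<bar> < 1" using abs_Im_le_cmod[of z] z by simp
    then have "cos (Im z) > 0" using pi_ge_two by (intro cos_gt_zero_pi) auto
    then show ?thesis using z g0 by (simp add: Re_exp)
  qed
  have u0: "u b \<noteq> 0" if "b \<in> A" for b using u(2)[OF that] by auto
  have 2: "Re (U b / u b) > 0" if "b \<in> A" for b
  proof -
    have "norm (1 - U b / u b) = norm (u b - U b) / norm (u b)"
      using u0[OF that] by (simp add: diff_divide_distrib flip: norm_divide)
    then have "norm (1 - U b / u b) < 1 / 2" using Uu[OF that] u(2)[OF that] by simp
    then show ?thesis using abs_Re_le_cmod[of "1 - U b / u b"] by simp
  qed
  show ?thesis
  proof (rule that[of \<Lambda>])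
    show "continuous_on A \<Lambda>"
      unfolding \<Lambda>_def
      by (intro continuous_on_add continuous_on_diff continuous_on_const cF continuous_on_Ln'
          continuous_on_divide cg cU u nonneg) (use 1 2 g0 u0 in auto)
    show "u b = exp (\<Lambda> b)" if "b \<in> A" for b
    proof -
      have "g b / g a0 \<noteq> 0" "U b / u b \<noteq> 0" using 1[OF that] 2[OF that] by force+
      then have "exp (\<Lambda> b) = exp (F b) * g a0 * (g b / g a0) / (U b / u b)"
        using g0 by (simp add: \<Lambda>_def exp_add exp_diff exp_Ln)
      also have "\<dots> = exp (F b) * g b * (u b / U b)" using g0 by simp
      also have "\<dots> = u b" using U0[OF that] by (simp add: g_def exp_minus field_simps)
      finally show ?thesis by simp
    qed
  qed
qed

text \<open>Chords of an arc point along the tangent up to sign, and squaring removes the sign. The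
  limit mentions no chart, so the squared unit tangent is well defined on \<open>A\<close>.\<close>

lemma arc_chart_direction_limit:
  assumes "arc_chart A a N r e e' \<pi>" and t: "t \<in> {-r<..<r}"
  shows "Lim (at (e t) within A) (\<lambda>b. (sgn (b - e t))\<^sup>2) = (sgn (e' t))\<^sup>2"
proof (rule tendsto_Lim)
  have ch: "open N" "r > 0" "continuous_on UNIV \<pi>" "A \<inter> N = e ` {-r<..<r}"
     "\<And>t. t\<in>{-r<..<r} \<Longrightarrow> (e has_vector_derivative e' t) (at t)"
     "\<And>t. t\<in>{-r<..<r} \<Longrightarrow> e' t \<noteq> 0"  "\<And>t. t\<in>{-r<..<r} \<Longrightarrow> \<pi> (e t) = t"
    using assms(1) unfolding arc_chart_def by auto
  have etN: "e t \<in> A \<inter> N" using ch(4) t by blast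
  have evr: "\<forall>\<^sub>F s in at t. s \<in> {-r<..<r}"
    using t by (intro eventually_at_in_open') auto
  show "\<not> trivial_limit (at (e t) within A)"
  proof -
    have "(e \<longlongrightarrow> e t) (at t)"
      using has_vector_derivative_continuous[OF ch(5)[OF t]] by (simp add: isCont_def continuous_at)
    moreover have "\<forall>\<^sub>F s in at t. e s \<in> A \<and> e s \<noteq> e t"
    proof -
      have "\<forall>\<^sub>F s in at t. s \<noteq> t" by (simp add: eventually_at_filter)
      with evr show ?thesis
      proof eventually_elim
        case (elim s)
        then show ?case using ch(4) ch(7)[of s] ch(7)[OF t] by (metis IntD1 imageI)
      qed
    qed
    ultimately have "filterlim e (at (e t) within A) (at t)"
      by (auto simp: filterlim_at elim: eventually_mono)
    then show ?thesis
      using filtermap_bot_iff[of e "at t"] at_neq_bot[of t]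
      by (auto simp: filterlim_def trivial_limit_def[symmetric] le_bot)
  qed
  have "((\<lambda>s. norm (e s - e t - (s - t) *\<^sub>R e' t) / norm (s - t)) \<longlongrightarrow> 0) (at t)"
    using ch(5)[OF t] by (simp add: has_vector_derivative_def has_derivative_iff_norm)
  moreover have "\<forall>\<^sub>F s in at t. norm (e s - e t - (s - t) *\<^sub>R e' t) / norm (s - t) =
      norm ((e s - e t) /\<^sub>R (s - t) - e' t)"
  proof (rule eventually_mono[OF eventually_neq_at_within[of t]])
    fix s assume "s \<noteq> t"
    then have "(e s - e t) /\<^sub>R (s - t) - e' t = (e s - e t - (s - t) *\<^sub>R e' t) /\<^sub>R (s - t)"
      by (simp add: scaleR_right_diff_distrib)
    then show "norm (e s - e t - (s - t) *\<^sub>R e' t) / norm (s - t) = norm ((e s - e t) /\<^sub>R (s - t) - e' t)"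
      by (simp add: divide_inverse mult.commute)
  qed
  ultimately have "((\<lambda>s. norm ((e s - e t) /\<^sub>R (s - t) - e' t)) \<longlongrightarrow> 0) (at t)"
    by (rule Lim_transform_eventually)
  then have "((\<lambda>s. (e s - e t) /\<^sub>R (s - t)) \<longlongrightarrow> e' t) (at t)"
    using LIM_zero_cancel tendsto_norm_zero_iff by blast
  then have lim: "((\<lambda>s. (sgn ((e s - e t) /\<^sub>R (s - t)))\<^sup>2) \<longlongrightarrow> (sgn (e' t))\<^sup>2) (at t)"
    using ch(6)[OF t] by (intro tendsto_power tendsto_sgn)
  have "(\<pi> \<longlongrightarrow> t) (at (e t) within A)"
    using ch(3) ch(7)[OF t] by (metis UNIV_I continuous_on_def subset_UNIV tendsto_within_subset)
  moreover have evN: "\<forall>\<^sub>F b in at (e t) within A. b \<in> N \<inter> A - {e t}"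
    using ch(1) etN by (auto simp: eventually_at_topological)
  then have "\<forall>\<^sub>F b in at (e t) within A. \<pi> b \<noteq> t"
  proof eventually_elim
    case (elim b)
    then obtain s where "s \<in> {-r<..<r}" "b = e s" using ch(4) by blast
    with elim show ?case using ch(7) by auto
  qed
  \<comment> \<open>Points of \<open>A\<close> near \<open>e t\<close> are values of
    \<open>e\<close>, so the limit over \<open>A\<close> is the parameter limit composed with
    \<open>\<pi>\<close>.\<close>
  ultimately have "filterlim \<pi> (at t) (at (e t) within A)" by (auto simp: filterlim_at)
  from filterlim_compose[OF lim this]
  have "((\<lambda>b. (sgn ((e (\<pi> b) - e t) /\<^sub>R (\<pi> b - t)))\<^sup>2) \<longlongrightarrow> (sgn (e' t))\<^sup>2) (at (e t) within A)" .
  then show "((\<lambda>b. (sgn (b - e t))\<^sup>2) \<longlongrightarrow> (sgn (e' t))\<^sup>2) (at (e t) within A)"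
  proof (rule Lim_transform_eventually)
    from evN show "\<forall>\<^sub>F b in at (e t) within A. (sgn ((e (\<pi> b) - e t) /\<^sub>R (\<pi> b - t)))\<^sup>2 = (sgn (b - e t))\<^sup>2"
    proof eventually_elim
      case (elim b)
      then obtain s where s: "s \<in> {-r<..<r}" "b = e s" using ch(4) by blast
      with elim have "s \<noteq> t" by auto
      \<comment> \<open>The real factor 1 / (s - t) changes the direction of the chord at most by a
        sign.\<close>
      then have "(sgn (inverse (s - t)))\<^sup>2 = 1" by (simp add: sgn_if power2_eq_square)
      then show ?case using s ch(7)[OF s(1)] by (simp add: sgn_scaleR scaleR_power)
    qed
  qed
qed

theorem no_exact_closed_curve:
  assumes A: "compact A" "connected A" "A \<noteq> {}"
    and ch: "\<And>a. a \<in> A \<Longrightarrow> \<exists>N r e e' \<pi>. arc_chart A a N r e e' \<pi>"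
  shows "\<not> forms_exact_on A"
proof
  assume ex: "forms_exact_on A"
  define u where "u a = Lim (at a within A) (\<lambda>b. (sgn (b - a))\<^sup>2)" for a
  have ue: "u (e t) = (sgn (e' t))\<^sup>2" if "arc_chart A a N r e e' \<pi>" "t \<in> {-r<..<r}" for a N r e e' \<pi> t
    unfolding u_def by (rule arc_chart_direction_limit[OF that])
  have "continuous_on A u"
    unfolding continuous_on_eq_continuous_within
  proof
    fix a assume a: "a \<in> A"
    obtain N r e e' \<pi> where arc: "arc_chart A a N r e e' \<pi>" using ch[OF a] by blast
    have c: "open N" "a \<in> N" "continuous_on UNIV \<pi>" "A \<inter> N = e ` {-r<..<r}" "continuous_on {-r<..<r} e'"
     "\<And>t. t\<in>{-r<..<r} \<Longrightarrow> e' t \<noteq> 0"  "\<And>t. t\<in>{-r<..<r} \<Longrightarrow> \<pi> (e t) = t"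
      using arc unfolding arc_chart_def by auto
    have \<pi>: "\<pi> b \<in> {-r<..<r}" "e (\<pi> b) = b" if "b \<in> A \<inter> N" for b using that c(4,7) by auto
    have "continuous_on (A \<inter> N) (\<lambda>b. (sgn (e' (\<pi> b)))\<^sup>2)"
    proof (intro continuous_on_power continuous_on_sgn)
      show "continuous_on (A \<inter> N) (\<lambda>b. e' (\<pi> b))"
        by (rule continuous_on_compose2[OF c(5) continuous_on_subset[OF c(3) subset_UNIV]]) (use \<pi> in auto)
    qed (use c(6) \<pi> in auto)
    then have "continuous_on (A \<inter> N) u"
      by (rule continuous_on_eq) (use ue[OF arc] \<pi> in metis)
    then have "continuous (at a within A \<inter> N) u"
      using a c(2) by (simp add: continuous_on_eq_continuous_within)
    moreover have "at a within A \<inter> N = at a within A"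
      by (rule at_within_nhd[OF c(2,1)]) auto
    ultimately show "continuous (at a within A) u" by simp
  qed
  moreover have "norm (u a) = 1" if aA: "a \<in> A" for a
  proof -
    obtain N r e e' \<pi> where arc: "arc_chart A a N r e e' \<pi>" using ch[OF aA] by blast
    then have "0 \<in> {-r<..<r}" "e 0 = a" "e' 0 \<noteq> 0" by (auto simp: arc_chart_def)
    with ue[OF arc, of 0] show ?thesis by (simp add: norm_power norm_sgn)
  qed
  ultimately obtain \<Lambda> where \<Lambda>: "continuous_on A \<Lambda>" "\<And>a. a \<in> A \<Longrightarrow> u a = exp (\<Lambda> a)"
    and u1: "\<And>a. a \<in> A \<Longrightarrow> norm (u a) = 1"
    using exact_forms_logarithm[OF A(1,2) ch ex] by metis
  \<comment> \<open>Its square is \<open>u\<close>, so \<open>\<tau>\<close> is a continuous field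
    that agrees with the unit tangent up to a sign at each point.\<close>
  define \<tau> where "\<tau> a = exp (\<Lambda> a / 2)" for a
  have c\<tau>: "continuous_on A \<tau>" unfolding \<tau>_def by (intro continuous_intros \<Lambda>) auto
  have \<tau>2: "(\<tau> a)\<^sup>2 = u a" if "a \<in> A" for a
    using \<Lambda>(2)[OF that] by (simp add: \<tau>_def exp_double[symmetric])
  \<comment> \<open>The pairing of \<open>\<tau>\<close> with itself is 1; two coordinate errors of
    1/4 lower it by at most 1/2, so the form stays positive on \<open>\<tau>\<close>.\<close>
  obtain P1 P2 where P: "real_polynomial_function P1" "real_polynomial_function P2"
    "\<And>a. a \<in> A \<Longrightarrow> \<bar>Re (\<tau> a) - P1 a\<bar> < 1/4" "\<And>a. a \<in> A \<Longrightarrow> \<bar>Im (\<tau> a) - P2 a\<bar> < 1/4"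
    using complex_stone_weierstrass[OF A(1) c\<tau>, of "1/4"] by (metis zero_less_divide_1_iff zero_less_numeral)
  obtain F :: "complex \<Rightarrow> real" where F: "\<And>a. a \<in> A \<Longrightarrow> (F has_derivative (\<lambda>h. P1 a * Re h + P2 a * Im h)) (at a within A)"
    using ex P unfolding forms_exact_on_def by metis
  have "continuous_on A F"
    using F has_derivative_continuous unfolding continuous_on_eq_continuous_within by blast
  then obtain a where a: "a \<in> A" "\<And>b. b \<in> A \<Longrightarrow> F b \<le> F a"
    using continuous_attains_sup[OF A(1,3)] by blast
  obtain N r e e' \<pi> where arc: "arc_chart A a N r e e' \<pi>" using ch[OF a(1)] by blast
  then have c: "r > 0" "A \<inter> N = e ` {-r<..<r}" "e 0 = a" "e' 0 \<noteq> 0" "(e has_vector_derivative e' 0) (at 0)"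
    by (auto simp: arc_chart_def)
  have r0: "(0::real) \<in> {-r<..<r}" using c(1) by simp
  have de: "(e has_derivative (\<lambda>h. h *\<^sub>R e' 0)) (at 0 within {-r<..<r})"
    using c(5) unfolding has_vector_derivative_def by (rule has_derivative_at_withinI)
  have "e ` {-r<..<r} \<subseteq> A" using c(2) by blast
  from has_derivative_in_compose[OF de, of F, unfolded c(3), OF has_derivative_subset[OF F[OF a(1)] this]]
  have "((\<lambda>t. F (e t)) has_derivative (\<lambda>h. P1 a * Re (h *\<^sub>R e' 0) + P2 a * Im (h *\<^sub>R e' 0)))
      (at 0 within {-r<..<r})" .
  moreover have "(\<lambda>h. P1 a * Re (h *\<^sub>R e' 0) + P2 a * Im (h *\<^sub>R e' 0)) =
      (\<lambda>h. (P1 a * Re (e' 0) + P2 a * Im (e' 0)) * h)"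
    by (simp add: fun_eq_iff algebra_simps)
  ultimately have "((\<lambda>t. F (e t)) has_real_derivative P1 a * Re (e' 0) + P2 a * Im (e' 0)) (at 0)"
    by (simp add: has_field_derivative_def at_within_open[OF r0])
  then have crit: "P1 a * Re (e' 0) + P2 a * Im (e' 0) = 0"
  proof (rule DERIV_local_max[OF _ c(1)], intro allI impI)
    fix t assume "\<bar>0 - t\<bar> < r"
    then have "e t \<in> A" using c(2) by (auto simp: abs_less_iff)
    then show "F (e t) \<le> F (e 0)" using a(2) c(3) by simp
  qed
  have "(sgn (e' 0))\<^sup>2 = (\<tau> a)\<^sup>2" using ue[OF arc r0] \<tau>2[OF a(1)] c(3) by simp
  then have "sgn (e' 0) = \<tau> a \<or> sgn (e' 0) = - \<tau> a" by (simp add: power2_eq_iff)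
  moreover have "e' 0 = norm (e' 0) *\<^sub>R sgn (e' 0)" using c(4) by (simp add: sgn_div_norm)
  ultimately obtain s where s: "e' 0 = s *\<^sub>R \<tau> a"
    by (metis scaleR_minus_left scaleR_minus_right)
  with c(4) have "s \<noteq> 0" by auto
  have "s * (P1 a * Re (\<tau> a) + P2 a * Im (\<tau> a)) = 0"
    using crit unfolding s by (simp add: algebra_simps)
  then have z: "P1 a * Re (\<tau> a) + P2 a * Im (\<tau> a) = 0" using \<open>s \<noteq> 0\<close> by simp
  have "norm (\<tau> a) ^ 2 = 1" using \<tau>2[OF a(1)] u1[OF a(1)] by (simp flip: norm_power)
  then have n1: "norm (\<tau> a) = 1" using norm_ge_zero[of "\<tau> a"] unfolding power2_eq_1_iff by linarith
  have "(Re (\<tau> a))\<^sup>2 + (Im (\<tau> a))\<^sup>2 = 1" using n1 by (simp add: cmod_def)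
  moreover have "\<bar>(Re (\<tau> a) - P1 a) * Re (\<tau> a)\<bar> \<le> 1/4 * 1" "\<bar>(Im (\<tau> a) - P2 a) * Im (\<tau> a)\<bar> \<le> 1/4 * 1"
    using P(3,4)[OF a(1)] abs_Re_le_cmod[of "\<tau> a"] abs_Im_le_cmod[of "\<tau> a"] n1
    unfolding abs_mult by (intro mult_mono; simp)+
  ultimately show False using z
    unfolding abs_le_iff left_diff_distrib power2_eq_square by linarith
qed

section \<open>Graph charts of plane curves\<close>

text \<open>The disc around \<open>snd c\<close> confines the condition to one sheet of
  \<open>C\<close> over the disc around \<open>fst c\<close>.\<close>

definition graph_at :: "(complex \<times> complex) set \<Rightarrow> complex \<times> complex \<Rightarrow> bool" where
  "graph_at C c \<longleftrightarrow> (\<exists>r r' \<phi>. r > 0 \<and> r' > 0 \<and> \<phi> holomorphic_on ball (fst c) r \<and>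
     (\<forall>z\<in>ball (fst c) r. \<phi> z \<in> ball (snd c) r' \<and> (\<forall>w\<in>ball (snd c) r'. (z, w) \<in> C \<longleftrightarrow> w = \<phi> z)))"

text \<open>A contraction argument yields \<open>\<phi>\<close> as a bare function together with the
  estimate \<open>lip\<close>. That estimate makes \<open>\<phi>\<close> Lipschitz at
  \<open>z0\<close>, after which the first-order expansion of \<open>P\<close> at
  \<open>(z0, \<phi> z0)\<close> can be solved for the increment of \<open>\<phi>\<close>.\<close>

lemma implicit_has_field_derivative:
  fixes P :: "complex \<times> complex \<Rightarrow> complex"
  assumes der: "(P has_derivative (\<lambda>h. p1 * fst h + p2 * snd h)) (at (z0, \<phi> z0))"
    and p2: "p2 \<noteq> 0" and U: "open U" "z0 \<in> U"
    and zero: "\<And>z. z \<in> U \<Longrightarrow> P (z, \<phi> z) = 0"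
    and lip: "\<And>z. z \<in> U \<Longrightarrow> norm (\<phi> z - \<phi> z0) \<le> M * norm (P (z, \<phi> z0))" and M: "M > 0"
  shows "(\<phi> has_field_derivative (- p1 / p2)) (at z0)"
proof -
  have alt: "\<exists>d>0. \<forall>z w. norm ((z, w) - (z0, \<phi> z0)) < d \<longrightarrow>
      norm (P (z, w) - (p1 * (z - z0) + p2 * (w - \<phi> z0))) \<le> e * norm ((z, w) - (z0, \<phi> z0))"
    if "e > 0" for e
    using der[unfolded has_derivative_at_alt, THEN conjunct2, rule_format, OF that] zero[OF U(2)]
    by fastforce
  obtain d1 where d1: "d1 > 0" and d1': "\<And>z w. norm ((z, w) - (z0, \<phi> z0)) < d1 \<Longrightarrow>
      norm (P (z, w) - (p1 * (z - z0) + p2 * (w - \<phi> z0))) \<le> 1 * norm ((z, w) - (z0, \<phi> z0))"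
    using alt[OF zero_less_one] by blast
  have d1_le: "norm (P (z, \<phi> z0) - p1 * (z - z0)) \<le> norm (z - z0)" if "norm (z - z0) < d1" for z
    using d1'[of z "\<phi> z0"] that by (simp add: norm_Pair)
  define L where "L = M * (norm p1 + 1)"
  have L: "L > 0" using M by (simp add: L_def add_nonneg_pos)
  have \<phi>_lip: "norm (\<phi> z - \<phi> z0) \<le> L * norm (z - z0)" if "z \<in> U" "norm (z - z0) < d1" for z
  proof -
    have "norm (P (z, \<phi> z0)) \<le> norm (P (z, \<phi> z0) - p1 * (z - z0)) + norm (p1 * (z - z0))"
      by (metis diff_add_cancel norm_triangle_ineq)
    also have "\<dots> \<le> norm (z - z0) + norm p1 * norm (z - z0)" using d1_le[OF that(2)] by (simp add: norm_mult)
    also have "\<dots> = (norm p1 + 1) * norm (z - z0)" by (simp add: algebra_simps)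
    finally show ?thesis using lip[OF that(1)] M
      by (smt (verit, ccfv_SIG) L_def mult.assoc mult_left_mono)
  qed
  obtain d2 where d2: "d2 > 0" "ball z0 d2 \<subseteq> U" using U openE by metis
  have "(\<phi> has_derivative (\<lambda>h. (- p1 / p2) * h)) (at z0)"
    unfolding has_derivative_at_alt
  proof (intro conjI allI impI)
    show "bounded_linear (\<lambda>h. (- p1 / p2) * h)" by (rule bounded_linear_mult_right)
    fix e :: real assume e: "e > 0"
    \<comment> \<open>The error e1 (1 + L) |z - z0| is e |p2| |z - z0|, and division by p2 leaves
      the required e |z - z0|.\<close>
    define e1 where "e1 = e * norm p2 / (1 + L)"
    have e1: "e1 > 0" using e p2 L by (simp add: e1_def)
    obtain d3 where d3: "d3 > 0" "\<And>z w. norm ((z, w) - (z0, \<phi> z0)) < d3 \<Longrightarrow>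
      norm (P (z, w) - (p1 * (z - z0) + p2 * (w - \<phi> z0))) \<le> e1 * norm ((z, w) - (z0, \<phi> z0))"
      using alt[OF e1] by blast
    define d where "d = min (min d1 d2) (d3 / (1 + L))"
    have "d \<le> d3 / (1 + L)" by (simp add: d_def)
    then have "(1 + L) * d \<le> d3" using L by (simp add: pos_le_divide_eq mult.commute)
    moreover have "d > 0" using d1(1) d2(1) d3(1) L by (simp add: d_def)
    ultimately have d: "d > 0" "d \<le> d1" "d \<le> d2" "(1 + L) * d \<le> d3" by (auto simp: d_def)
    show "\<exists>d>0. \<forall>z. norm (z - z0) < d \<longrightarrow> norm (\<phi> z - \<phi> z0 - (- p1 / p2) * (z - z0)) \<le> e * norm (z - z0)"
    proof (intro exI[of _ d] conjI allI impI d(1))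
      fix z assume z: "norm (z - z0) < d"
      have zU: "z \<in> U" using z d d2 by (auto simp: dist_norm norm_minus_commute)
      have n: "norm ((z, \<phi> z) - (z0, \<phi> z0)) \<le> (1 + L) * norm (z - z0)"
        using norm_Pair_le[of "z - z0" "\<phi> z - \<phi> z0"] \<phi>_lip[OF zU] z d by (simp add: algebra_simps)
      also have "\<dots> < d3" using z d(4) L by (smt (verit) mult_strict_left_mono)
      finally have "norm (P (z, \<phi> z) - (p1 * (z - z0) + p2 * (\<phi> z - \<phi> z0))) \<le> e1 * norm ((z, \<phi> z) - (z0, \<phi> z0))"
        by (rule d3)
      also have "\<dots> \<le> e1 * ((1 + L) * norm (z - z0))" using n e1 by (intro mult_left_mono) auto
      also have "\<dots> = e * norm p2 * norm (z - z0)" using L by (simp add: e1_def)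
      finally have "norm (p1 * (z - z0) + p2 * (\<phi> z - \<phi> z0)) \<le> e * norm p2 * norm (z - z0)"
        by (simp only: zero[OF zU] diff_0 norm_minus_cancel)
      moreover have "p1 * (z - z0) + p2 * (\<phi> z - \<phi> z0) = p2 * (\<phi> z - \<phi> z0 - (- p1 / p2) * (z - z0))"
        using p2 by (simp add: field_simps)
      ultimately have "norm p2 * norm (\<phi> z - \<phi> z0 - (- p1 / p2) * (z - z0)) \<le> norm p2 * (e * norm (z - z0))"
        by (simp add: norm_mult mult_ac)
      then show "norm (\<phi> z - \<phi> z0 - (- p1 / p2) * (z - z0)) \<le> e * norm (z - z0)"
        by (rule mult_left_le_imp_le) (use p2 in simp)
    qed
  qed
  then show ?thesis unfolding has_field_derivative_def .
qed

text \<open>Division by d = p2 c makes \<open>P\<close> a small perturbation of the identity in its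
  second variable, uniformly for \<open>z\<close> near \<open>fst c\<close>. So over each such
  \<open>z\<close> there is exactly one zero in a fixed disc, and it depends holomorphically on
  \<open>z\<close>.\<close>

lemma graph_at_implicit:
  fixes P :: "complex \<times> complex \<Rightarrow> complex"
  assumes der: "\<And>x. (P has_derivative (\<lambda>h. p1 x * fst h + p2 x * snd h)) (at x)"
    and cont: "continuous_on UNIV p2" and c: "P c = 0" "p2 c \<noteq> 0"
    and U: "open U" "c \<in> U" "C \<inter> U = {x. P x = 0} \<inter> U"
  shows "graph_at C c"
proof -
  define d where "d = p2 c"
  have d0: "d \<noteq> 0" using c by (simp add: d_def)
  have "open ((\<lambda>x. p2 x / d) -` ball 1 (1/2))"
    by (intro open_vimage continuous_on_divide continuous_on_const cont) (use d0 in auto)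
  with U have "open (U \<inter> (\<lambda>x. p2 x / d) -` ball 1 (1/2))" by blast
  moreover have "c \<in> U \<inter> (\<lambda>x. p2 x / d) -` ball 1 (1/2)" using U d0 by (simp add: d_def)
  ultimately obtain \<rho>0 where \<rho>0: "\<rho>0 > 0" "ball c \<rho>0 \<subseteq> U \<inter> (\<lambda>x. p2 x / d) -` ball 1 (1/2)"
    by (metis openE)
  \<comment> \<open>Two coordinates within \<open>\<rho>\<close> of those of \<open>c\<close> put
    the point at distance at most 2 \<rho> < \<rho>0.\<close>
  define \<rho> where "\<rho> = \<rho>0 / 3"
  have \<rho>: "\<rho> > 0" using \<rho>0 by (simp add: \<rho>_def)
  have box: "(z, w) \<in> U" "norm (p2 (z, w) / d - 1) \<le> 1 / 2"
    if "z \<in> cball (fst c) \<rho>" "w \<in> cball (snd c) \<rho>" for z w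
  proof -
    have "dist c (z, w) \<le> dist (fst c) z + dist (snd c) w"
      unfolding dist_prod_def by (rule order_trans[OF sqrt_add_le_add_sqrt]) auto
    also have "\<dots> < \<rho>0" using that \<rho> by (simp add: \<rho>_def)
    finally have "(z, w) \<in> ball c \<rho>0" by simp
    with \<rho>0(2) have 1: "(z, w) \<in> U \<inter> (\<lambda>x. p2 x / d) -` ball 1 (1/2)" by blast
    then show "(z, w) \<in> U" by blast
    show "norm (p2 (z, w) / d - 1) \<le> 1 / 2" using 1 by (simp add: dist_norm norm_minus_commute)
  qed
  have lip: "norm ((P (z, w) / d - w) - (P (z, w') / d - w')) \<le> norm (w - w') / 2"
    if z: "z \<in> cball (fst c) \<rho>" and w: "w \<in> cball (snd c) \<rho>" "w' \<in> cball (snd c) \<rho>" for z w w'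
  proof -
    have "norm ((P (z, w) / d - w) - (P (z, w') / d - w')) \<le> 1 / 2 * norm (w - w')"
    proof (rule field_differentiable_bound[OF convex_cball[of "snd c" \<rho>] _ _ w(1,2)])
      fix v assume v: "v \<in> cball (snd c) \<rho>"
      have "((\<lambda>w. (z, w)) has_derivative (\<lambda>h. (0, h))) (at v)"
        by (intro has_derivative_Pair has_derivative_const has_derivative_ident)
      from has_derivative_compose[OF this der]
      have "((\<lambda>w. P (z, w)) has_field_derivative p2 (z, v)) (at v)"
        by (simp add: has_field_derivative_def)
      then show "((\<lambda>w. P (z, w) / d - w) has_field_derivative (p2 (z, v) / d - 1)) (at v within cball (snd c) \<rho>)"
        by (rule DERIV_diff[OF DERIV_cdivide[OF has_field_derivative_at_within] DERIV_ident])
      show "norm (p2 (z, v) / d - 1) \<le> 1 / 2" by (rule box(2)[OF z v])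
    qed
    then show ?thesis by simp
  qed
  have "continuous_on UNIV P"
    by (intro continuous_at_imp_continuous_on ballI has_derivative_continuous[OF der])
  then have "continuous_on UNIV (\<lambda>z. P (z, snd c))"
    by (rule continuous_on_compose2[OF _ continuous_on_Pair[OF continuous_on_id continuous_on_const]]) (rule subset_UNIV)
  \<comment> \<open>With |P (z, snd c)| below |d| \<rho> / 4 the zero lies within \<rho> / 2 of
    \<open>snd c\<close>, hence in the open disc.\<close>
  then have "open ((\<lambda>z. P (z, snd c)) -` ball 0 (norm d * \<rho> / 4))" by (rule open_vimage[OF open_ball])
  moreover have "fst c \<in> (\<lambda>z. P (z, snd c)) -` ball 0 (norm d * \<rho> / 4)"
    using c \<rho> d0 by simp
  ultimately obtain r0 where r0: "r0 > 0" "ball (fst c) r0 \<subseteq> (\<lambda>z. P (z, snd c)) -` ball 0 (norm d * \<rho> / 4)"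
    by (metis openE)
  define r where "r = min r0 \<rho>"
  have r: "r > 0" "r \<le> r0" "r \<le> \<rho>" using r0 \<rho> by (auto simp: r_def)
  have zc: "z \<in> cball (fst c) \<rho>" if "z \<in> ball (fst c) r" for z using that r by auto
  have inj: "norm (w - w') \<le> 2 * norm (P (z, w) / d - P (z, w') / d)"
    if "z \<in> ball (fst c) r" "w \<in> cball (snd c) \<rho>" "w' \<in> cball (snd c) \<rho>" for z w w'
    using perturbed_identity_expanding(1)[of "snd c" \<rho> "\<lambda>w. P (z, w) / d" w w', OF lip[OF zc[OF that(1)]]] that(2,3)
    by blast
  have "\<exists>w. w \<in> ball (snd c) \<rho> \<and> P (z, w) = 0" if z: "z \<in> ball (fst c) r" for z
  proof -
    have n: "norm (P (z, snd c) / d) < \<rho> / 4"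
    proof -
      have "z \<in> ball (fst c) r0" using z r by simp
      then have "P (z, snd c) \<in> ball 0 (norm d * \<rho> / 4)" using r0(2) by blast
      then show ?thesis using d0 by (simp add: norm_divide divide_less_eq mult.commute)
    qed
    obtain w where w: "w \<in> cball (snd c) \<rho>" "P (z, w) / d = 0"
    proof (rule perturbed_identity_surj[of "snd c" \<rho> "\<lambda>w. P (z, w) / d" 0, OF lip[OF zc[OF z]]])
      show "norm (0 - P (z, snd c) / d) \<le> \<rho> / 2" unfolding diff_0 norm_minus_cancel using n \<rho> by linarith
    qed (use \<rho> in auto)
    then have "norm (w - snd c) \<le> 2 * norm (P (z, snd c) / d)"
      using inj[OF z w(1), of "snd c"] \<rho> unfolding w(2) diff_0 norm_minus_cancel by simp
    also have "\<dots> < \<rho>" using n \<rho> by simp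
    finally show ?thesis using w d0 by (intro exI[of _ w]) (auto simp: dist_norm norm_minus_commute)
  qed
  then obtain \<phi> where \<phi>: "\<And>z. z \<in> ball (fst c) r \<Longrightarrow> \<phi> z \<in> ball (snd c) \<rho>"
    "\<And>z. z \<in> ball (fst c) r \<Longrightarrow> P (z, \<phi> z) = 0" by metis
  have \<phi>c: "\<phi> z \<in> cball (snd c) \<rho>" if "z \<in> ball (fst c) r" for z
    using \<phi>(1)[OF that] by simp
  have uniq: "(z, w) \<in> C \<longleftrightarrow> w = \<phi> z" if "z \<in> ball (fst c) r" "w \<in> ball (snd c) \<rho>" for z w
  proof -
    have wc: "w \<in> cball (snd c) \<rho>" using that by simp
    have "(z, w) \<in> C \<longleftrightarrow> P (z, w) = 0" using box(1)[OF zc[OF that(1)] wc] U(3) by blast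
    also have "\<dots> \<longleftrightarrow> w = \<phi> z"
      using inj[OF that(1) wc \<phi>c[OF that(1)]] \<phi>(2)[OF that(1)] by auto
    finally show ?thesis .
  qed
  have "\<phi> holomorphic_on ball (fst c) r"
    unfolding holomorphic_on_def field_differentiable_def
  proof (rule ballI, rule exI, rule has_field_derivative_at_within)
    fix z0 assume z0: "z0 \<in> ball (fst c) r"
    show "(\<phi> has_field_derivative (- p1 (z0, \<phi> z0) / p2 (z0, \<phi> z0))) (at z0)"
    proof (rule implicit_has_field_derivative[OF der])
      show "p2 (z0, \<phi> z0) \<noteq> 0" using box(2)[OF zc[OF z0] \<phi>c[OF z0]] by auto
      show "norm (\<phi> z - \<phi> z0) \<le> (2 / norm d) * norm (P (z, \<phi> z0))" if "z \<in> ball (fst c) r" for z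
        using inj[OF that \<phi>c[OF that] \<phi>c[OF z0]] \<phi>(2)[OF that] by (simp add: norm_divide)
    qed (use z0 \<phi> d0 in auto)
  qed
  with r \<rho> \<phi> uniq show ?thesis unfolding graph_at_def by (intro exI[of _ r] exI[of _ \<rho>] exI[of _ \<phi>]) auto
qed

lemma curve_chart_graph:
  assumes "graph_at C c" "c \<in> C"
  shows "curve_chart C c"
proof -
  obtain r r' \<phi> where g: "r > 0" "r' > 0" "\<phi> holomorphic_on ball (fst c) r"
    "\<And>z. z \<in> ball (fst c) r \<Longrightarrow> \<phi> z \<in> ball (snd c) r'"
    "\<And>z w. z \<in> ball (fst c) r \<Longrightarrow> w \<in> ball (snd c) r' \<Longrightarrow> (z, w) \<in> C \<longleftrightarrow> w = \<phi> z"
    using assms(1) unfolding graph_at_def by metis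
  have sh: "fst c + z \<in> ball (fst c) r \<longleftrightarrow> z \<in> ball 0 r" for z by (simp add: dist_norm)
  show ?thesis
    unfolding curve_chart_def
  proof (rule exI[of _ "ball (fst c) r \<times> ball (snd c) r'"], rule exI[of _ r],
      rule exI[of _ "\<lambda>z. fst c + z"], rule exI[of _ "\<lambda>z. \<phi> (fst c + z)"], rule exI[of _ fst],
      intro conjI ballI)
    show "(\<lambda>z. \<phi> (fst c + z)) holomorphic_on ball 0 r"
      by (rule holomorphic_on_compose_gen[unfolded o_def, where g = \<phi> and t = "ball (fst c) r"])
         (use g(3) sh in \<open>auto intro!: holomorphic_intros\<close>)
    show "C \<inter> ball (fst c) r \<times> ball (snd c) r' = (\<lambda>z. (fst c + z, \<phi> (fst c + z))) ` ball 0 r"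
    proof (intro equalityI subsetI)
      fix x assume "x \<in> C \<inter> ball (fst c) r \<times> ball (snd c) r'"
      then obtain z w where x: "x = (z, w)" "z \<in> ball (fst c) r" "w \<in> ball (snd c) r'" "(z, w) \<in> C" by auto
      then have "x = (\<lambda>z. (fst c + z, \<phi> (fst c + z))) (z - fst c)" using g(5) by simp
      moreover have "z - fst c \<in> ball 0 r" using x(2) sh[of "z - fst c"] by simp
      ultimately show "x \<in> (\<lambda>z. (fst c + z, \<phi> (fst c + z))) ` ball 0 r" by (rule image_eqI)
    next
      fix x assume "x \<in> (\<lambda>z. (fst c + z, \<phi> (fst c + z))) ` ball 0 r"
      then obtain z where "z \<in> ball 0 r" "x = (fst c + z, \<phi> (fst c + z))" by blast
      then show "x \<in> C \<inter> ball (fst c) r \<times> ball (snd c) r'" using g(4,5) sh by blast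
    qed
    have "fst c \<in> ball (fst c) r" "snd c \<in> ball (snd c) r'" using g by auto
    with g(5) assms(2) have "snd c = \<phi> (fst c)" by (metis prod.collapse)
    then show "(fst c + 0, \<phi> (fst c + 0)) = c" by (simp add: prod_eq_iff)
  qed (use g in \<open>auto simp: open_Times mem_Times_iff bounded_linear_fst intro!: holomorphic_intros\<close>)
qed

lemma curve_chart_swap:
  assumes "curve_chart (prod.swap ` C) (prod.swap c)"
  shows "curve_chart C c"
proof -
  obtain N r \<zeta>1 \<zeta>2 \<pi> where ch: "open N" "prod.swap c \<in> N" "r > 0"
     "\<zeta>1 holomorphic_on ball 0 r" "\<zeta>2 holomorphic_on ball 0 r"
     "bounded_linear \<pi>" "prod.swap ` C \<inter> N = (\<lambda>z. (\<zeta>1 z, \<zeta>2 z)) ` ball 0 r"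
     "(\<zeta>1 0, \<zeta>2 0) = prod.swap c" "\<And>z. z \<in> ball 0 r \<Longrightarrow> \<pi> (\<zeta>1 z, \<zeta>2 z) = \<pi> (prod.swap c) + z"
    using assms(1) unfolding curve_chart_def by (elim exE conjE) simp
  have blsw: "bounded_linear (prod.swap :: complex \<times> complex \<Rightarrow> complex \<times> complex)"
    unfolding prod.swap_def[abs_def] by (intro bounded_linear_Pair bounded_linear_fst bounded_linear_snd)
  show ?thesis
    unfolding curve_chart_def
  proof (rule exI[of _ "prod.swap -` N"], rule exI[of _ r],
      rule exI[of _ \<zeta>2], rule exI[of _ \<zeta>1], rule exI[of _ "\<pi> \<circ> prod.swap"], intro conjI ballI)
    show "open (prod.swap -` N)" by (rule open_vimage[OF ch(1) linear_continuous_on[OF blsw]])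
    show "bounded_linear (\<pi> \<circ> prod.swap)" using bounded_linear_compose[OF ch(6) blsw] by (simp add: o_def)
    have "C \<inter> prod.swap -` N = prod.swap ` (prod.swap ` C \<inter> N)" by force
    also have "\<dots> = (\<lambda>z. (\<zeta>2 z, \<zeta>1 z)) ` ball 0 r" unfolding ch(7) by force
    finally show "C \<inter> prod.swap -` N = (\<lambda>z. (\<zeta>2 z, \<zeta>1 z)) ` ball 0 r" .
    show "(\<zeta>2 0, \<zeta>1 0) = c" using ch(8) by (simp add: prod_eq_iff)
  qed (use ch in auto)
qed

section \<open>Real points of a conjugation-invariant curve\<close>

definition real_point :: "complex \<Rightarrow> complex \<times> complex" where
  "real_point a = (of_real (Re a), of_real (Im a))"

text \<open>For real z the conjugate of \<phi> z also lies on \<open>C\<close> over z, so uniqueness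
  in the graph makes \<phi> z real. The real points near \<open>a\<close> are thus the graph of a
  real function.\<close>

lemma arc_chart_graph:
  assumes "graph_at C (real_point a)" "real_point a \<in> C"
    and cnj: "\<And>z w. (z, w) \<in> C \<Longrightarrow> (cnj z, cnj w) \<in> C"
  shows "\<exists>N r e e' \<pi>. arc_chart {b. real_point b \<in> C} a N r e e' \<pi>"
proof -
  define c1 where "c1 = complex_of_real (Re a)"
  define c2 where "c2 = complex_of_real (Im a)"
  have c: "real_point a = (c1, c2)" by (simp add: real_point_def c1_def c2_def)
  obtain r r' \<phi> where g: "r > 0" "r' > 0" "\<phi> holomorphic_on ball c1 r"
    "\<And>z. z \<in> ball c1 r \<Longrightarrow> \<phi> z \<in> ball c2 r'"
    "\<And>z w. z \<in> ball c1 r \<Longrightarrow> w \<in> ball c2 r' \<Longrightarrow> (z, w) \<in> C \<longleftrightarrow> w = \<phi> z"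
    using assms(1) unfolding graph_at_def c fst_conv snd_conv by metis
  have br: "of_real (Re a + t) \<in> ball c1 r \<longleftrightarrow> t \<in> {-r<..<r}" for t :: real
    by (auto simp: c1_def dist_norm simp flip: of_real_diff of_real_minus)
  have bi: "of_real s \<in> ball c2 r' \<longleftrightarrow> \<bar>s - Im a\<bar> < r'" for s :: real
    by (auto simp: c2_def dist_norm abs_minus_commute simp flip: of_real_diff)
  have \<phi>_real: "of_real (Re (\<phi> (of_real (Re a + t)))) = \<phi> (of_real (Re a + t))"
    if t: "t \<in> {-r<..<r}" for t
  proof -
    let ?z = "complex_of_real (Re a + t)"
    have z: "?z \<in> ball c1 r" using br t by blast
    have "(?z, \<phi> ?z) \<in> C" using g(4,5) z by blast
    from cnj[OF this] have 1: "(?z, cnj (\<phi> ?z)) \<in> C" by simp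
    have "dist c2 (cnj (\<phi> ?z)) = dist c2 (\<phi> ?z)"
      unfolding dist_norm c2_def by (metis complex_cnj_complex_of_real complex_cnj_diff complex_mod_cnj)
    with g(4)[OF z] have "cnj (\<phi> ?z) \<in> ball c2 r'" by simp
    with g(5)[OF z] 1 have "cnj (\<phi> ?z) = \<phi> ?z" by blast
    then show ?thesis by (simp add: complex_eq_iff)
  qed
  define e where "e t = Complex (Re a + t) (Re (\<phi> (of_real (Re a + t))))" for t
  define e' where "e' t = Complex 1 (Re (deriv \<phi> (of_real (Re a + t))))" for t
  define N where "N = {b. \<bar>Re b - Re a\<bar> < r \<and> \<bar>Im b - Im a\<bar> < r'}"
  have rp_e: "real_point (e t) = (of_real (Re a + t), \<phi> (of_real (Re a + t)))" if "t \<in> {-r<..<r}" for t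
    using \<phi>_real[OF that] by (simp add: real_point_def e_def)
  have "arc_chart {b. real_point b \<in> C} a N r e e' (\<lambda>b. Re b - Re a)"
    unfolding arc_chart_def
  proof (intro conjI ballI)
    show "open N" unfolding N_def
      by (intro open_Collect_conj open_Collect_less continuous_intros)
    show "a \<in> N" using g by (simp add: N_def)
    show "continuous_on UNIV (\<lambda>b. Re b - Re a)" by (intro continuous_intros)
    show "{b. real_point b \<in> C} \<inter> N = e ` {-r<..<r}"
    proof (intro equalityI subsetI)
      fix b assume b: "b \<in> {b. real_point b \<in> C} \<inter> N"
      define t where "t = Re b - Re a"
      have t: "t \<in> {-r<..<r}" "Re b = Re a + t" using b by (auto simp: N_def t_def abs_less_iff)
      have "(complex_of_real (Re a + t), complex_of_real (Im b)) \<in> C" using b t by (simp add: real_point_def)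
      moreover have "of_real (Im b) \<in> ball c2 r'" using b bi by (simp add: N_def)
      ultimately have "of_real (Im b) = \<phi> (of_real (Re a + t))" using g(5) br t(1) by blast
      then have "Im b = Re (\<phi> (of_real (Re a + t)))" by (metis Re_complex_of_real)
      then have "b = e t" using t by (simp add: e_def complex_eq_iff)
      then show "b \<in> e ` {-r<..<r}" using t by blast
    next
      fix b assume "b \<in> e ` {-r<..<r}"
      then obtain t where t: "t \<in> {-r<..<r}" "b = e t" by blast
      have z: "of_real (Re a + t) \<in> ball c1 r" using br t by blast
      have "real_point b \<in> C" using rp_e[OF t(1)] t(2) g(4,5) z by metis
      moreover have "\<bar>Im b - Im a\<bar> < r'"
      proof -
        have "complex_of_real (Im b) \<in> ball c2 r'"
          using g(4)[OF z] \<phi>_real[OF t(1)] t(2) by (simp add: e_def)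
        then show ?thesis using bi by blast
      qed
      ultimately show "b \<in> {b. real_point b \<in> C} \<inter> N" using t by (auto simp: N_def e_def)
    qed
    have "of_real (Re a + 0) \<in> ball c1 r" "complex_of_real (Im a) \<in> ball c2 r'"
      using br[of 0] bi[of "Im a"] g by auto
    moreover have "(of_real (Re a + 0), of_real (Im a)) \<in> C" using assms(2) by (simp add: real_point_def)
    ultimately have "of_real (Im a) = \<phi> (of_real (Re a + 0))" using g(5) by blast
    then have "Im a = Re (\<phi> (of_real (Re a + 0)))" by (metis Re_complex_of_real)
    then show "e 0 = a" by (simp add: e_def complex_eq_iff)
    have cd: "continuous_on (ball c1 r) (deriv \<phi>)"
      by (intro holomorphic_on_imp_continuous_on holomorphic_deriv g(3) open_ball)
    have cr: "continuous_on {-r<..<r} (\<lambda>t. complex_of_real (Re a + t))"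
      by (intro continuous_on_of_real continuous_on_add continuous_on_const continuous_on_id)
    have "continuous_on {-r<..<r} (\<lambda>t. deriv \<phi> (of_real (Re a + t)))"
      by (rule continuous_on_compose2[OF cd cr]) (use br in blast)
    then show "continuous_on {-r<..<r} e'"
      unfolding e'_def by (intro continuous_on_Complex continuous_on_Re continuous_on_const)
    fix t assume t: "t \<in> {-r<..<r}"
    then have z: "of_real (Re a + t) \<in> ball c1 r" using br by blast
    have dx: "((\<lambda>t. complex_of_real (Re a + t)) has_vector_derivative 1) (at t)"
      by (auto intro!: derivative_eq_intros)
    from field_vector_diff_chain_at[OF this holomorphic_derivI[OF g(3) open_ball z]]
    have "((\<lambda>t. \<phi> (of_real (Re a + t))) has_vector_derivative deriv \<phi> (of_real (Re a + t))) (at t)"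
      unfolding o_def mult_1 .
    from bounded_linear.has_vector_derivative[OF bounded_linear_Re this]
    have "((\<lambda>t. complex_of_real (Re (\<phi> (of_real (Re a + t))))) has_vector_derivative
        complex_of_real (Re (deriv \<phi> (of_real (Re a + t))))) (at t)"
      by (rule bounded_linear.has_vector_derivative[OF bounded_linear_of_real])
    from has_vector_derivative_add[OF dx has_vector_derivative_mult_right[OF this, of \<i>]]
    have "((\<lambda>t. of_real (Re a + t) + \<i> * of_real (Re (\<phi> (of_real (Re a + t))))) has_vector_derivative
        (1 + \<i> * of_real (Re (deriv \<phi> (of_real (Re a + t)))))) (at t)" .
    moreover have "(\<lambda>t. of_real (Re a + t) + \<i> * of_real (Re (\<phi> (of_real (Re a + t))))) = e"
      by (auto simp: e_def complex_eq_iff)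
    moreover have "1 + \<i> * of_real (Re (deriv \<phi> (of_real (Re a + t)))) = e' t"
      by (simp add: e'_def complex_eq_iff)
    ultimately show "(e has_vector_derivative e' t) (at t)" by simp
    show "e' t \<noteq> 0" by (simp add: e'_def complex_eq_iff)
    show "Re (e t) - Re a = t" by (simp add: e_def)
  qed (use g in auto)
  then show ?thesis by blast
qed

text \<open>The map sending \<open>b\<close> to \<open>\<i> * cnj b\<close> exchanges real and
  imaginary part and is its own inverse. It carries graphs over the second coordinate to graphs over
  the first.\<close>

lemma arc_chart_reflect:
  assumes "arc_chart K (\<i> * cnj a) N r e e' \<pi>"
  shows "arc_chart {b. \<i> * cnj b \<in> K} a {b. \<i> * cnj b \<in> N} r (\<lambda>t. \<i> * cnj (e t)) (\<lambda>t. \<i> * cnj (e' t)) (\<lambda>b. \<pi> (\<i> * cnj b))"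
proof -
  have ch: "open N" "\<i> * cnj a \<in> N" "r > 0" "continuous_on UNIV \<pi>"
     "K \<inter> N = e ` {-r<..<r}" "e 0 = \<i> * cnj a" "continuous_on {-r<..<r} e'"
     "\<And>t. t\<in>{-r<..<r} \<Longrightarrow> (e has_vector_derivative e' t) (at t) \<and> e' t \<noteq> 0 \<and> \<pi> (e t) = t"
    using assms unfolding arc_chart_def by auto
  have inv: "\<i> * cnj (\<i> * cnj b) = b" for b by simp
  have c: "continuous_on S (\<lambda>b. \<i> * cnj b)" for S by (intro continuous_intros)
  show ?thesis
    unfolding arc_chart_def
  proof (intro conjI ballI)
    show "open {b. \<i> * cnj b \<in> N}" using open_vimage[OF ch(1) c] by (simp add: vimage_def)
    show "continuous_on UNIV (\<lambda>b. \<pi> (\<i> * cnj b))"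
      by (rule continuous_on_compose2[OF ch(4) c]) auto
    have "{b. \<i> * cnj b \<in> K} \<inter> {b. \<i> * cnj b \<in> N} = (\<lambda>b. \<i> * cnj b) ` (K \<inter> N)"
    proof (intro equalityI subsetI)
      fix b assume "b \<in> {b. \<i> * cnj b \<in> K} \<inter> {b. \<i> * cnj b \<in> N}"
      then show "b \<in> (\<lambda>b. \<i> * cnj b) ` (K \<inter> N)" by (intro image_eqI[of _ _ "\<i> * cnj b"]) auto
    qed auto
    then show "{b. \<i> * cnj b \<in> K} \<inter> {b. \<i> * cnj b \<in> N} = (\<lambda>t. \<i> * cnj (e t)) ` {-r<..<r}"
      unfolding ch(5) by (simp add: image_image)
    show "continuous_on {-r<..<r} (\<lambda>t. \<i> * cnj (e' t))" by (intro continuous_intros ch(7))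
    fix t assume t: "t \<in> {-r<..<r}"
    have "(cnj \<circ> e has_vector_derivative cnj (e' t)) (at t)"
      using bounded_linear.has_vector_derivative[OF bounded_linear_cnj conjunct1[OF ch(8)[OF t]]] by (simp add: o_def)
    then show "((\<lambda>t. \<i> * cnj (e t)) has_vector_derivative \<i> * cnj (e' t)) (at t)"
      by (simp add: o_def has_vector_derivative_mult_right)
  qed (use ch in auto)
qed

text \<open>An arc is connected, so the arc through \<open>a\<close> stays in the component of
  \<open>a\<close>.\<close>

lemma arc_chart_component:
  assumes "arc_chart K a N r e e' \<pi>" and a: "a \<in> connected_component_set K a0"
  shows "arc_chart (connected_component_set K a0) a N r e e' \<pi>"
proof -
  have ch: "r > 0" "K \<inter> N = e ` {-r<..<r}" "e 0 = a"
     "\<And>t. t\<in>{-r<..<r} \<Longrightarrow> (e has_vector_derivative e' t) (at t)"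
    using assms unfolding arc_chart_def by auto
  have "connected (e ` {-r<..<r})"
    by (intro connected_continuous_image continuous_at_imp_continuous_on ballI
        has_vector_derivative_continuous[OF ch(4)]) auto
  moreover have "a \<in> e ` {-r<..<r}" using ch(1,3) by (intro image_eqI[of _ _ 0]) auto
  ultimately have "e ` {-r<..<r} \<subseteq> connected_component_set K a"
    using ch(2) by (intro connected_component_maximal) auto
  then have "e ` {-r<..<r} \<subseteq> connected_component_set K a0"
    using connected_component_eq[OF a] by simp
  moreover have "connected_component_set K a0 \<subseteq> K" by (rule connected_component_subset)
  ultimately have "connected_component_set K a0 \<inter> N = e ` {-r<..<r}" using ch(2) by blast
  with assms(1) show ?thesis unfolding arc_chart_def by blast
qed

section \<open>Thin sets in metrically conic spaces\<close>

lemma dist_le_inner_dist: "ennreal (dist x y) \<le> inner_dist Z x y"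
  unfolding inner_dist_def
proof (rule INF_greatest)
  fix g assume g: "g \<in> {g. path g \<and> path_image g \<subseteq> Z \<and> pathstart g = x \<and> pathfinish g = y \<and> arc_length g < \<infinity>}"
  define t where "t i = (if i = 0 then 0 else 1 :: real)" for i :: nat
  have "ennreal (\<Sum>i<1. dist (g (t i)) (g (t (Suc i)))) \<le> arc_length g"
    unfolding arc_length_def
  proof (rule SUP_upper2)
    show "(1, t) \<in> {(n::nat, t::nat \<Rightarrow> real). mono_on {..n} t \<and> t ` {..n} \<subseteq> {0..1}}"
      by (auto simp: t_def mono_on_def)
  qed simp
  then show "ennreal (dist x y) \<le> arc_length g"
    using g by (simp add: t_def pathstart_def pathfinish_def)
qed

text \<open>A Lipschitz path on the unit interval has length at most its constant. Composition with
  a Lipschitz map multiplies the constant, so lengths never have to be computed.\<close>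

definition lipschitz_joined :: "'a::metric_space set \<Rightarrow> real \<Rightarrow> 'a \<Rightarrow> 'a \<Rightarrow> bool" where
  "lipschitz_joined Z L x y \<longleftrightarrow> L \<ge> 0 \<and> (\<exists>\<gamma>. \<gamma> 0 = x \<and> \<gamma> 1 = y \<and> \<gamma> ` {0..1} \<subseteq> Z \<and>
     (\<forall>s\<in>{0..1}. \<forall>t\<in>{0..1}. dist (\<gamma> s) (\<gamma> t) \<le> L * \<bar>s - t :: real\<bar>))"

lemma inner_dist_le_lipschitz_joined:
  assumes "lipschitz_joined Z L x y"
  shows "inner_dist Z x y \<le> ennreal L"
proof -
  obtain \<gamma> where \<gamma>: "\<gamma> 0 = x" "\<gamma> 1 = y" "\<gamma> ` {0..1} \<subseteq> Z" and L: "L \<ge> 0"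
    and lip: "\<And>s t. s \<in> {0..1} \<Longrightarrow> t \<in> {0..1} \<Longrightarrow> dist (\<gamma> s) (\<gamma> t) \<le> L * \<bar>s - t :: real\<bar>"
    using assms unfolding lipschitz_joined_def by blast
  have len: "arc_length \<gamma> \<le> ennreal L"
    unfolding arc_length_def
  proof (rule SUP_least, clarify)
    fix n :: nat and t :: "nat \<Rightarrow> real"
    assume mono: "mono_on {..n} t" and t: "t ` {..n} \<subseteq> {0..1}"
    have t01: "t i \<in> {0..1}" if "i \<le> n" for i using t that by blast
    have "(\<Sum>i<n. dist (\<gamma> (t i)) (\<gamma> (t (Suc i)))) \<le> (\<Sum>i<n. L * (t (Suc i) - t i))"
    proof (rule sum_mono)
      fix i assume "i \<in> {..<n}"
      then have i: "i \<le> n" "Suc i \<le> n" by auto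
      have "t i \<le> t (Suc i)" using mono i by (auto simp: mono_on_def)
      then show "dist (\<gamma> (t i)) (\<gamma> (t (Suc i))) \<le> L * (t (Suc i) - t i)"
        using lip[OF t01[OF i(1)] t01[OF i(2)]] by simp
    qed
    also have "\<dots> = L * (t n - t 0)"
      by (simp add: sum_distrib_left[symmetric] sum_lessThan_telescope)
    also have "\<dots> \<le> L * 1" using t01[of n] t01[of 0] L by (intro mult_left_mono) auto
    finally show "ennreal (\<Sum>i<n. dist (\<gamma> (t i)) (\<gamma> (t (Suc i)))) \<le> ennreal L"
      by (simp add: ennreal_leI)
  qed
  have "continuous_on {0..1} \<gamma>"
    by (rule lipschitz_on_continuous_on[of L]) (use lip L in \<open>auto intro!: lipschitz_onI simp: dist_real_def\<close>)
  then have "\<gamma> \<in> {g. path g \<and> path_image g \<subseteq> Z \<and> pathstart g = x \<and> pathfinish g = y \<and> arc_length g < \<infinity>}"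
    using \<gamma> len by (auto simp: path_def path_image_def pathstart_def pathfinish_def intro: le_less_trans)
  then have "inner_dist Z x y \<le> arc_length \<gamma>"
    unfolding inner_dist_def by (rule INF_lower)
  from order_trans[OF this len] show ?thesis .
qed

text \<open>The Euclidean distance bounds the inner distance from below, and a Lipschitz path bounds
  it from above. The extracted form of the bi-Lipschitz condition is free of infinite
  values.\<close>

lemma inner_bi_lipschitz_joined:
  assumes "inner_bi_lipschitz S T h"
  obtains K where "K > 0"
    "\<And>x y L. x \<in> S \<Longrightarrow> y \<in> S \<Longrightarrow> lipschitz_joined S L x y \<Longrightarrow> dist (h x) (h y) \<le> K * L"
    "\<And>x y L. x \<in> S \<Longrightarrow> y \<in> S \<Longrightarrow> lipschitz_joined T L (h x) (h y) \<Longrightarrow> dist x y \<le> K * L"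
proof -
  obtain K where K: "K > 0" "\<And>x y. x \<in> S \<Longrightarrow> y \<in> S \<Longrightarrow>
      inner_dist T (h x) (h y) \<le> ennreal K * inner_dist S x y \<and>
      inner_dist S x y \<le> ennreal K * inner_dist T (h x) (h y)"
    using assms unfolding inner_bi_lipschitz_def by blast
  have aux: "d \<le> K * L" if "ennreal d \<le> i" "i \<le> ennreal K * i'" "i' \<le> ennreal L" "L \<ge> 0" for d i i' L
  proof -
    have "ennreal d \<le> ennreal K * ennreal L"
      using that(1-3) by (meson mult_left_mono order_trans zero_le)
    then show ?thesis using K(1) that(4) by (simp add: ennreal_mult'[symmetric])
  qed
  show ?thesis
  proof (rule that[OF K(1)])
    fix x y L assume x: "x \<in> S" "y \<in> S"
    show "dist (h x) (h y) \<le> K * L" if "lipschitz_joined S L x y"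
      using aux[OF dist_le_inner_dist conjunct1[OF K(2)[OF x]] inner_dist_le_lipschitz_joined[OF that]] that
      by (simp add: lipschitz_joined_def)
    show "dist x y \<le> K * L" if "lipschitz_joined T L (h x) (h y)"
      using aux[OF dist_le_inner_dist conjunct2[OF K(2)[OF x]] inner_dist_le_lipschitz_joined[OF that]] that
      by (simp add: lipschitz_joined_def)
  qed
qed

section \<open>Contraction of thin sets in a cone\<close>

lemma normalize_diff_le:
  fixes u v :: "'a::real_normed_vector"
  assumes "u \<noteq> 0" "v \<noteq> 0"
  shows "norm ((e / norm u) *\<^sub>R u - (e / norm v) *\<^sub>R v) \<le> 2 * \<bar>e\<bar> * norm (u - v) / norm v"
proof -
  have eq: "(1 / norm u) *\<^sub>R u - (1 / norm v) *\<^sub>R v =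
      (1 / norm v) *\<^sub>R (u - v) + (1 / norm u - 1 / norm v) *\<^sub>R u"
    by (simp add: algebra_simps)
  have "norm ((1 / norm u - 1 / norm v) *\<^sub>R u) = \<bar>norm v - norm u\<bar> / norm v"
    using assms by (simp add: field_simps abs_mult abs_div)
  also have "\<dots> \<le> norm (u - v) / norm v"
    using norm_triangle_ineq3[of u v] assms by (intro divide_right_mono) (auto simp: abs_minus_commute)
  finally have "norm ((1 / norm u) *\<^sub>R u - (1 / norm v) *\<^sub>R v) \<le> norm (u - v) / norm v + norm (u - v) / norm v"
    unfolding eq by (intro order_trans[OF norm_triangle_ineq] add_mono) (auto simp: divide_inverse mult.commute)
  then have "\<bar>e\<bar> * norm ((1 / norm u) *\<^sub>R u - (1 / norm v) *\<^sub>R v) \<le> \<bar>e\<bar> * (2 * (norm (u - v) / norm v))"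
    by (intro mult_left_mono) auto
  moreover have "(e / norm u) *\<^sub>R u - (e / norm v) *\<^sub>R v = e *\<^sub>R ((1 / norm u) *\<^sub>R u - (1 / norm v) *\<^sub>R v)"
    by (simp add: scaleR_right_diff_distrib)
  ultimately show ?thesis by (simp add: mult_ac)
qed

lemma cone_over_sphere:
  fixes X :: "'a::real_normed_vector set"
  assumes "\<epsilon> > 0"
  shows "x \<in> cone_over 0 (X \<inter> sphere 0 \<epsilon>) \<Longrightarrow> norm x \<le> \<epsilon>"
    and "x \<in> cone_over 0 (X \<inter> sphere 0 \<epsilon>) \<Longrightarrow> x \<noteq> 0 \<Longrightarrow> (\<epsilon> / norm x) *\<^sub>R x \<in> X \<inter> sphere 0 \<epsilon>"
    and "y \<in> X \<inter> sphere 0 \<epsilon> \<Longrightarrow> 0 \<le> t \<Longrightarrow> t \<le> 1 \<Longrightarrow> t *\<^sub>R y \<in> cone_over 0 (X \<inter> sphere 0 \<epsilon>)"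
proof -
  have ex: "\<exists>y t. y \<in> X \<inter> sphere 0 \<epsilon> \<and> 0 \<le> t \<and> t \<le> 1 \<and> x = t *\<^sub>R y"
    if "x \<in> cone_over 0 (X \<inter> sphere 0 \<epsilon>)" for x
  proof -
    from that obtain y where y: "y \<in> X \<inter> sphere 0 \<epsilon>" "x \<in> closed_segment 0 y"
      unfolding cone_over_def by blast
    then obtain u where "0 \<le> u" "u \<le> 1" "x = (1 - u) *\<^sub>R 0 + u *\<^sub>R y" unfolding in_segment by blast
    with y show ?thesis by (intro exI[of _ y] exI[of _ u]) simp
  qed
  show "norm x \<le> \<epsilon>" if "x \<in> cone_over 0 (X \<inter> sphere 0 \<epsilon>)"
    using ex[OF that] assms by (auto simp: mult_left_le_one_le)
  show "(\<epsilon> / norm x) *\<^sub>R x \<in> X \<inter> sphere 0 \<epsilon>" if x: "x \<in> cone_over 0 (X \<inter> sphere 0 \<epsilon>)" "x \<noteq> 0"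
  proof -
    obtain y t where y: "y \<in> X \<inter> sphere 0 \<epsilon>" "0 \<le> t" "t \<le> 1" "x = t *\<^sub>R y" using ex[OF x(1)] by blast
    with x(2) have "t > 0" by (cases "t = 0") auto
    then have "(\<epsilon> / norm x) *\<^sub>R x = y" using y assms by simp
    with y show ?thesis by simp
  qed
  show "t *\<^sub>R y \<in> cone_over 0 (X \<inter> sphere 0 \<epsilon>)" if "y \<in> X \<inter> sphere 0 \<epsilon>" "0 \<le> t" "t \<le> 1"
    unfolding cone_over_def
  proof (rule UN_I[OF that(1)])
    show "t *\<^sub>R y \<in> closed_segment 0 y"
      unfolding in_segment using that(2,3) by (intro exI[of _ t]) simp
  qed
qed

text \<open>The path of \<open>x\<close> is no longer than a multiple of its distance to the target
  \<open>y1\<close>, which is what keeps thin sets thin. Radius and constant serve all targets near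
  \<open>y\<close>, because the target will be a term of a sequence that merely converges to
  \<open>y\<close>.\<close>

definition lipschitz_contractible_at :: "'a::metric_space set \<Rightarrow> 'a \<Rightarrow> bool" where
  "lipschitz_contractible_at L y \<longleftrightarrow> (\<exists>r>0. \<exists>C\<ge>0. \<forall>y1\<in>L \<inter> ball y r. \<exists>g.
     continuous_on ((L \<inter> ball y r) \<times> {0..1::real}) (\<lambda>(x, v). g x v) \<and>
     (\<forall>x\<in>L \<inter> ball y r. g x 0 = x \<and> g x 1 = y1 \<and> (\<forall>v\<in>{0..1}. g x v \<in> L) \<and>
       (\<forall>v\<in>{0..1}. \<forall>v'\<in>{0..1}. dist (g x v) (g x v') \<le> C * \<bar>v - v'\<bar> * dist x y1)))"

text \<open>In the cone, a set whose diameter is small compared to its distance from the apex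
  contracts within a set of comparable diameter; the homeomorphism carries this over to \<open>X\<close>.\<close>

lemma conic_thin_sets_contract:
  fixes X :: "'a::euclidean_space set" and j :: "nat \<Rightarrow> 'b::metric_space \<Rightarrow> 'a"
  assumes \<epsilon>: "\<epsilon> > 0" and L: "compact (X \<inter> sphere 0 \<epsilon>)"
    and lc: "\<And>y. y \<in> X \<inter> sphere 0 \<epsilon> \<Longrightarrow> lipschitz_contractible_at (X \<inter> sphere 0 \<epsilon>) y"
    and hk: "homeomorphism (cone_over 0 (X \<inter> sphere 0 \<epsilon>)) (X \<inter> cball 0 \<epsilon>) h k"
    and K: "K > 0" "\<And>x y L. x \<in> cone_over 0 (X \<inter> sphere 0 \<epsilon>) \<Longrightarrow> y \<in> cone_over 0 (X \<inter> sphere 0 \<epsilon>) \<Longrightarrow>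
        lipschitz_joined (cone_over 0 (X \<inter> sphere 0 \<epsilon>)) L x y \<Longrightarrow> dist (h x) (h y) \<le> K * L"
    and a0: "a0 \<in> A" and j: "\<And>n. continuous_on A (j n)" "\<And>n a. a \<in> A \<Longrightarrow> j n a \<in> X \<inter> cball 0 \<epsilon>"
    and D: "\<And>n a b. a \<in> A \<Longrightarrow> b \<in> A \<Longrightarrow> dist (k (j n a)) (k (j n b)) \<le> D n"
    and \<rho>: "\<And>n. \<rho> n > 0" "\<And>n a. a \<in> A \<Longrightarrow> \<rho> n \<le> norm (k (j n a))"
    and lim: "(\<lambda>n. D n / \<rho> n) \<longlonglongrightarrow> 0"
  obtains M where "M \<ge> 0" "\<And>N. \<exists>n\<ge>N. \<exists>G c. continuous_on (A \<times> {0..1}) G \<and>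
      (\<forall>a\<in>A. G (a, 0) = j n a \<and> G (a, 1) = c \<and>
        (\<forall>v\<in>{0..1::real}. G (a, v) \<in> X \<and> dist (G (a, v)) (j n a) \<le> M * D n))"
proof -
  let ?L = "X \<inter> sphere 0 \<epsilon>" and ?C = "cone_over 0 (X \<inter> sphere 0 \<epsilon>)"
  define \<beta> where "\<beta> n a = k (j n a)" for n a
  have \<beta>C: "\<beta> n a \<in> ?C" if "a \<in> A" for n a
    using hk j(2)[OF that] unfolding homeomorphism_def \<beta>_def by blast
  have h\<beta>: "h (\<beta> n a) = j n a" if "a \<in> A" for n a
    using hk j(2)[OF that] unfolding homeomorphism_def \<beta>_def by blast
  have \<beta>0: "\<beta> n a \<noteq> 0" if "a \<in> A" for n a
    using \<rho>(1)[of n] \<rho>(2)[OF that, of n] by (auto simp: \<beta>_def)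
  define y where "y n a = (\<epsilon> / norm (\<beta> n a)) *\<^sub>R \<beta> n a" for n a
  have yL: "y n a \<in> ?L" if "a \<in> A" for n a
    unfolding y_def by (rule cone_over_sphere(2)[OF \<epsilon> \<beta>C[OF that] \<beta>0[OF that]])
  have y_diff: "dist (y n a) (y n a0) \<le> 2 * \<epsilon> * D n / norm (\<beta> n a0)" if "a \<in> A" for n a
  proof -
    have "dist (y n a) (y n a0) \<le> 2 * \<bar>\<epsilon>\<bar> * norm (\<beta> n a - \<beta> n a0) / norm (\<beta> n a0)"
      unfolding dist_norm y_def by (rule normalize_diff_le[OF \<beta>0[OF that] \<beta>0[OF a0]])
    also have "\<dots> \<le> 2 * \<epsilon> * D n / norm (\<beta> n a0)"
      using D[OF that a0, of n] \<epsilon> by (intro divide_right_mono mult_mono) (auto simp: \<beta>_def dist_norm)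
    finally show ?thesis .
  qed
  have D0: "D n \<ge> 0" for n using D[OF a0 a0, of n] by simp
  \<comment> \<open>The radius of contractibility depends on the point of the link. Along a
    subsequence the directions of the base points converge, and the contraction at the limit serves
    for late terms.\<close>
  obtain y' \<sigma> where \<sigma>: "y' \<in> ?L" "strict_mono \<sigma>" "((\<lambda>n. y n a0) \<circ> \<sigma>) \<longlonglongrightarrow> y'"
    using L yL[OF a0] unfolding compact_def by meson
  obtain r C where rC: "r > 0" "C \<ge> 0" and g: "\<forall>y1\<in>?L \<inter> ball y' r. \<exists>g.
     continuous_on ((?L \<inter> ball y' r) \<times> {0..1::real}) (\<lambda>(x, v). g x v) \<and>
     (\<forall>x\<in>?L \<inter> ball y' r. g x 0 = x \<and> g x 1 = y1 \<and> (\<forall>v\<in>{0..1}. g x v \<in> ?L) \<and>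
       (\<forall>v\<in>{0..1}. \<forall>v'\<in>{0..1}. dist (g x v) (g x v') \<le> C * \<bar>v - v'\<bar> * dist x y1))"
    using lc[OF \<sigma>(1)] unfolding lipschitz_contractible_at_def by (elim exE conjE) (rule that)
  \<comment> \<open>In the cone, \<open>D n\<close> bounds the radial motion and 4 C
    \<open>D n\<close> the motion along the link; \<open>h\<close> contributes the factor
    \<open>K\<close>.\<close>
  define M where "M = K * (1 + 4 * C)"
  have M: "M \<ge> 0" using K rC by (simp add: M_def)
  show ?thesis
  proof (rule that[OF M])
    fix N :: nat
    have "\<forall>\<^sub>F m in sequentially. dist (y (\<sigma> m) a0) y' < r / 2"
      using tendstoD[OF \<sigma>(3), of "r / 2"] rC(1) by (simp add: o_def)
    \<comment> \<open>A ratio below 1 keeps the norms in the thin set within twice the norm at the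
      base point. The other bound is chosen because 2 \<epsilon> r / (4 \<epsilon> + 1) < r /
      2.\<close>
    moreover have "\<forall>\<^sub>F m in sequentially. D (\<sigma> m) / \<rho> (\<sigma> m) < min 1 (r / (4 * \<epsilon> + 1))"
    proof -
      have "(\<lambda>m. D (\<sigma> m) / \<rho> (\<sigma> m)) \<longlonglongrightarrow> 0"
        using LIMSEQ_subseq_LIMSEQ[OF lim \<sigma>(2)] by (simp add: o_def)
      then show ?thesis by (rule order_tendstoD(2)) (use rC \<epsilon> in auto)
    qed
    moreover have "\<forall>\<^sub>F m in sequentially. m \<ge> N" by (rule eventually_ge_at_top)
    ultimately have "\<forall>\<^sub>F m in sequentially. dist (y (\<sigma> m) a0) y' < r / 2 \<and>
        D (\<sigma> m) / \<rho> (\<sigma> m) < min 1 (r / (4 * \<epsilon> + 1)) \<and> m \<ge> N"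
      by eventually_elim auto
    then obtain m where m: "dist (y (\<sigma> m) a0) y' < r / 2" "D (\<sigma> m) / \<rho> (\<sigma> m) < min 1 (r / (4 * \<epsilon> + 1))" "m \<ge> N"
      using eventually_happens'[OF sequentially_bot] by blast
    define n where "n = \<sigma> m"
    have nN: "n \<ge> N" using m(3) seq_suble[OF \<sigma>(2), of m] by (simp add: n_def)
    have \<rho>n: "\<rho> n > 0" "\<rho> n \<le> norm (\<beta> n a0)" using \<rho>(1) \<rho>(2)[OF a0] by (auto simp: \<beta>_def)
    have Dn: "D n \<le> norm (\<beta> n a0)" "D n / norm (\<beta> n a0) < r / (4 * \<epsilon> + 1)"
    proof -
      have "norm (\<beta> n a0) > 0" using \<rho>n by linarith
      then have 1: "D n / norm (\<beta> n a0) \<le> D n / \<rho> n"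
        using D0 \<rho>n by (intro divide_left_mono mult_pos_pos) auto
      then show "D n / norm (\<beta> n a0) < r / (4 * \<epsilon> + 1)" using m(2) by (simp add: n_def)
      have "D n / norm (\<beta> n a0) < 1" using 1 m(2) by (simp add: n_def)
      then show "D n \<le> norm (\<beta> n a0)" using \<beta>0[OF a0, of n] by (simp add: divide_less_eq)
    qed
    have near: "y n a \<in> ?L \<inter> ball y' r" if "a \<in> A" for a
    proof -
      have "dist (y n a) (y n a0) \<le> 2 * \<epsilon> * (D n / norm (\<beta> n a0))" using y_diff[OF that] by simp
      also have "\<dots> \<le> 2 * \<epsilon> * (r / (4 * \<epsilon> + 1))" using Dn(2) \<epsilon> by (intro mult_left_mono) auto
      also have "\<dots> < r / 2" using \<epsilon> rC by (simp add: field_simps)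
      finally have "dist (y n a) (y n a0) < r / 2" .
      moreover have "dist (y n a0) y' < r / 2" using m(1) by (simp add: n_def)
      ultimately have "dist (y n a) y' < r" using dist_triangle[of "y n a" y' "y n a0"] by linarith
      then show ?thesis using yL[OF that] by (simp add: dist_commute)
    qed
    obtain g where gc: "continuous_on ((?L \<inter> ball y' r) \<times> {0..1::real}) (\<lambda>(x, v). g x v)"
      and g0: "\<And>x. x \<in> ?L \<inter> ball y' r \<Longrightarrow> g x 0 = x" and g1: "\<And>x. x \<in> ?L \<inter> ball y' r \<Longrightarrow> g x 1 = y n a0"
      and gL: "\<And>x v. x \<in> ?L \<inter> ball y' r \<Longrightarrow> v \<in> {0..1} \<Longrightarrow> g x v \<in> ?L"
      and glip: "\<And>x v v'. x \<in> ?L \<inter> ball y' r \<Longrightarrow> v \<in> {0..1} \<Longrightarrow> v' \<in> {0..1} \<Longrightarrow>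
         dist (g x v) (g x v') \<le> C * \<bar>v - v'\<bar> * dist x (y n a0)"
      using bspec[OF g near[OF a0]] by blast
    \<comment> \<open>Polar coordinates of the cone: the norm is interpolated linearly while the
      direction follows the contraction in the link.\<close>
    define \<nu> where "\<nu> a v = (1 - v) * norm (\<beta> n a) + v * norm (\<beta> n a0)" for a v
    define Hc where "Hc a v = (\<nu> a v / \<epsilon>) *\<^sub>R g (y n a) v" for a v
    have \<nu>: "0 \<le> \<nu> a v" "\<nu> a v \<le> \<epsilon>" "\<nu> a v \<le> 2 * norm (\<beta> n a0)" if a: "a \<in> A" and v: "v \<in> {0..1}" for a v
    proof -
      show "0 \<le> \<nu> a v" using v by (simp add: \<nu>_def)
      have "\<nu> a v \<le> (1 - v) * \<epsilon> + v * \<epsilon>"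
        unfolding \<nu>_def using v cone_over_sphere(1)[OF \<epsilon> \<beta>C[OF a, of n]] cone_over_sphere(1)[OF \<epsilon> \<beta>C[OF a0, of n]]
        by (intro add_mono mult_left_mono) auto
      then show "\<nu> a v \<le> \<epsilon>" by (simp add: algebra_simps)
      have "norm (\<beta> n a) \<le> norm (\<beta> n a0) + dist (\<beta> n a) (\<beta> n a0)"
        unfolding dist_norm by (metis add.commute norm_triangle_sub)
      then have "norm (\<beta> n a) \<le> 2 * norm (\<beta> n a0)" using D[OF a a0, of n] Dn(1) by (simp add: \<beta>_def)
      then have "\<nu> a v \<le> (1 - v) * (2 * norm (\<beta> n a0)) + v * (2 * norm (\<beta> n a0))"
        unfolding \<nu>_def using v by (intro add_mono mult_left_mono) auto
      then show "\<nu> a v \<le> 2 * norm (\<beta> n a0)" by (simp add: algebra_simps)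
    qed
    have HcC: "Hc a v \<in> ?C" if "a \<in> A" "v \<in> {0..1}" for a v
      unfolding Hc_def using gL[OF near[OF that(1)] that(2)] \<nu>[OF that] \<epsilon> by (intro cone_over_sphere(3)[OF \<epsilon>]) auto
    have Hc0: "Hc a 0 = \<beta> n a" if "a \<in> A" for a
      using g0[OF near[OF that]] \<beta>0[OF that, of n] \<epsilon> by (simp add: Hc_def \<nu>_def y_def)
    have Hc1: "Hc a 1 = \<beta> n a0" if "a \<in> A" for a
      using g1[OF near[OF that]] \<beta>0[OF a0, of n] \<epsilon> by (simp add: Hc_def \<nu>_def y_def)
    have Hlip: "dist (Hc a v) (Hc a v') \<le> ((1 + 4 * C) * D n) * \<bar>v - v'\<bar>"
      if a: "a \<in> A" and v: "v \<in> {0..1}" "v' \<in> {0..1}" for a v v'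
    proof -
      have eq: "Hc a v - Hc a v' = ((\<nu> a v - \<nu> a v') / \<epsilon>) *\<^sub>R g (y n a) v + (\<nu> a v' / \<epsilon>) *\<^sub>R (g (y n a) v - g (y n a) v')"
        by (simp add: Hc_def algebra_simps diff_divide_distrib)
      have \<nu>_diff: "\<nu> a v - \<nu> a v' = (v' - v) * (norm (\<beta> n a) - norm (\<beta> n a0))"
        by (simp add: \<nu>_def algebra_simps)
      have "norm (((\<nu> a v - \<nu> a v') / \<epsilon>) *\<^sub>R g (y n a) v) = \<bar>\<nu> a v - \<nu> a v'\<bar>"
        using gL[OF near[OF a] v(1)] \<epsilon> by simp
      also have "\<dots> \<le> \<bar>v - v'\<bar> * D n"
        unfolding \<nu>_diff abs_mult abs_minus_commute[of v' v]
        using norm_triangle_ineq3[of "\<beta> n a" "\<beta> n a0"] D[OF a a0, of n]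
        by (intro mult_left_mono) (auto simp: \<beta>_def dist_norm)
      finally have 1: "norm (((\<nu> a v - \<nu> a v') / \<epsilon>) *\<^sub>R g (y n a) v) \<le> \<bar>v - v'\<bar> * D n" .
      have "norm ((\<nu> a v' / \<epsilon>) *\<^sub>R (g (y n a) v - g (y n a) v')) = \<nu> a v' / \<epsilon> * dist (g (y n a) v) (g (y n a) v')"
        using \<nu>(1)[OF a v(2)] \<epsilon> by (simp add: dist_norm)
      \<comment> \<open>The norm at the base point, from the radius, cancels the one from the
        normalization; what is left is proportional to \<open>D n\<close> and independent of the
        distance from the apex.\<close>
      also have "\<dots> \<le> (2 * norm (\<beta> n a0) / \<epsilon>) * (C * \<bar>v - v'\<bar> * (2 * \<epsilon> * D n / norm (\<beta> n a0)))"
      proof (intro mult_mono)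
        show "\<nu> a v' / \<epsilon> \<le> 2 * norm (\<beta> n a0) / \<epsilon>" using \<nu>(3)[OF a v(2)] \<epsilon> by (intro divide_right_mono) auto
        show "dist (g (y n a) v) (g (y n a) v') \<le> C * \<bar>v - v'\<bar> * (2 * \<epsilon> * D n / norm (\<beta> n a0))"
          using glip[OF near[OF a] v] y_diff[OF a, of n] rC(2)
          by (meson abs_ge_zero mult_left_mono mult_nonneg_nonneg order_trans)
      qed (use \<epsilon> in auto)
      also have "\<dots> = 4 * C * D n * \<bar>v - v'\<bar>" using \<epsilon> \<beta>0[OF a0, of n] by simp
      finally have 2: "norm ((\<nu> a v' / \<epsilon>) *\<^sub>R (g (y n a) v - g (y n a) v')) \<le> 4 * C * D n * \<bar>v - v'\<bar>" .
      have "norm (Hc a v - Hc a v') \<le> \<bar>v - v'\<bar> * D n + 4 * C * D n * \<bar>v - v'\<bar>"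
        unfolding eq using 1 2 by (intro order_trans[OF norm_triangle_ineq] add_mono)
      then show ?thesis by (simp add: dist_norm algebra_simps)
    qed
    have near_j: "dist (h (Hc a v)) (j n a) \<le> M * D n" if a: "a \<in> A" and v: "v \<in> {0..1}" for a v
    proof -
      have sv: "s * v \<in> {0..1}" if "s \<in> {0..1}" for s using that v by (auto simp: mult_le_one)
      \<comment> \<open>The initial part of the contraction path of \<open>a\<close>, reparametrized
        to the unit interval.\<close>
      have "lipschitz_joined ?C ((1 + 4 * C) * D n) (Hc a 0) (Hc a v)"
        unfolding lipschitz_joined_def
      proof (intro conjI exI[of _ "\<lambda>s. Hc a (s * v)"] ballI)
        show "(1 + 4 * C) * D n \<ge> 0" using rC D0[of n] by simp
        show "(\<lambda>s. Hc a (s * v)) ` {0..1} \<subseteq> ?C" using HcC[OF a sv] by blast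
        fix s t :: real assume st: "s \<in> {0..1}" "t \<in> {0..1}"
        have "dist (Hc a (s * v)) (Hc a (t * v)) \<le> ((1 + 4 * C) * D n) * \<bar>s * v - t * v\<bar>"
          by (rule Hlip[OF a sv[OF st(1)] sv[OF st(2)]])
        also have "\<bar>s * v - t * v\<bar> = \<bar>s - t\<bar> * v" using v by (simp add: abs_mult flip: left_diff_distrib)
        also have "((1 + 4 * C) * D n) * (\<bar>s - t\<bar> * v) \<le> ((1 + 4 * C) * D n) * (\<bar>s - t\<bar> * 1)"
          using v rC D0[of n] by (intro mult_left_mono) auto
        finally show "dist (Hc a (s * v)) (Hc a (t * v)) \<le> (1 + 4 * C) * D n * \<bar>s - t\<bar>" by simp
      qed auto
      from K(2)[OF HcC[OF a] HcC[OF a v] this]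
      show ?thesis using h\<beta>[OF a] Hc0[OF a] by (simp add: M_def dist_commute mult.assoc)
    qed
    have c\<beta>: "continuous_on A (\<beta> n)"
      unfolding \<beta>_def
      by (rule continuous_on_compose2[OF _ j(1), of "X \<inter> cball 0 \<epsilon>" k]) (use hk j(2) in \<open>auto simp: homeomorphism_def\<close>)
    have c\<beta>1: "continuous_on (A \<times> {0..1::real}) (\<lambda>z. \<beta> n (fst z))"
      by (rule continuous_on_compose2[OF c\<beta> continuous_on_fst[OF continuous_on_id]]) auto
    have cy: "continuous_on (A \<times> {0..1::real}) (\<lambda>z. y n (fst z))"
      unfolding y_def
      by (intro continuous_on_scaleR continuous_on_divide continuous_on_const continuous_on_norm c\<beta>1)
         (use \<beta>0 in auto)
    have "continuous_on (A \<times> {0..1}) (\<lambda>z. case (y n (fst z), snd z) of (x, v) \<Rightarrow> g x v)"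
      by (rule continuous_on_compose2[OF gc continuous_on_Pair[OF cy continuous_on_snd[OF continuous_on_id]]])
         (use near in auto)
    then have cg: "continuous_on (A \<times> {0..1}) (\<lambda>z. g (y n (fst z)) (snd z))" by simp
    have cH: "continuous_on (A \<times> {0..1}) (\<lambda>z. Hc (fst z) (snd z))"
      unfolding Hc_def \<nu>_def
      by (intro continuous_on_scaleR continuous_on_divide continuous_on_add continuous_on_mult continuous_on_diff
          continuous_on_const continuous_on_norm c\<beta>1 cg continuous_on_snd continuous_on_id) (use \<epsilon> in auto)
    have hX: "h x \<in> X" if "x \<in> ?C" for x using hk that unfolding homeomorphism_def by blast
    have ch: "continuous_on ?C h" using hk by (simp add: homeomorphism_def)
    have cG: "continuous_on (A \<times> {0..1}) (\<lambda>z. h (Hc (fst z) (snd z)))"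
      by (rule continuous_on_compose2[OF ch cH]) (auto intro!: HcC)
    show "\<exists>n\<ge>N. \<exists>G c. continuous_on (A \<times> {0..1}) G \<and>
      (\<forall>a\<in>A. G (a, 0) = j n a \<and> G (a, 1) = c \<and>
        (\<forall>v\<in>{0..1::real}. G (a, v) \<in> X \<and> dist (G (a, v)) (j n a) \<le> M * D n))"
      using cG nN near_j Hc0 Hc1 h\<beta> hX HcC
      by (intro exI[of _ n] conjI exI[of _ "\<lambda>z. h (Hc (fst z) (snd z))"] exI[of _ "h (\<beta> n a0)"]) auto
  qed
qed

section \<open>Weighted homogeneous surfaces\<close>

definition vec3 :: "'a \<Rightarrow> 'a \<Rightarrow> 'a \<Rightarrow> 'a ^ 3" where
  "vec3 a b c = (\<chi> i. if i = 1 then a else if i = 2 then b else c)"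

lemma vec3_nth [simp]: "vec3 a b c $ 1 = a" "vec3 a b c $ 2 = b" "vec3 a b c $ 3 = c"
  by (simp_all add: vec3_def)

lemma vec3_eq_iff: "x = vec3 a b c \<longleftrightarrow> x $ 1 = a \<and> x $ 2 = b \<and> x $ 3 = c"
  by (auto simp: vec_eq_iff forall_3)

definition weighted_act :: "nat ^ 'n \<Rightarrow> complex \<Rightarrow> complex ^ 'n \<Rightarrow> complex ^ 'n::finite" where
  "weighted_act w t x = (\<chi> i. t ^ (w $ i) * x $ i)"

lemma weighted_act_nth [simp]: "weighted_act w t x $ i = t ^ (w $ i) * x $ i"
  by (simp add: weighted_act_def)

lemma weighted_act_one [simp]: "weighted_act w 1 x = x"
  by (simp add: vec_eq_iff)

lemma weighted_act_mult: "weighted_act w s (weighted_act w t x) = weighted_act w (s * t) x"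
  by (simp add: vec_eq_iff power_mult_distrib mult.assoc)

lemma norm_weighted_act_le:
  assumes "\<And>i. w $ i > 0" "0 \<le> s" "s \<le> 1"
  shows "norm (weighted_act w (of_real s) x) \<le> s * norm x"
proof -
  have "norm (weighted_act w (of_real s) x) \<le> norm (s *\<^sub>R x)"
  proof (rule norm_le_componentwise_cart)
    fix i
    have "s ^ (w $ i) \<le> s ^ 1" using assms by (intro power_decreasing) (auto simp: Suc_le_eq)
    then show "norm (weighted_act w (of_real s) x $ i) \<le> norm ((s *\<^sub>R x) $ i)"
      using assms by (simp add: norm_mult norm_power mult_right_mono)
  qed
  then show ?thesis using assms by simp
qed

text \<open>Near \<open>y\<close> the link is the zero set of the pair p, |z|^2 - \<epsilon>^2. The
  derivative of this pair is onto: the Euler vector is annihilated by the gradient of p and, the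
  weights being positive, has positive inner product with \<open>y\<close>. So the surface crosses
  the sphere transversally, and the contraction for submersions applies.\<close>

lemma link_lipschitz_contractible:
  fixes q :: "('n::finite, complex) mpoly"
  assumes y: "y \<in> regular_points (zero_set q)" "y \<in> sphere 0 \<epsilon>" and \<epsilon>: "\<epsilon> > 0"
    and q: "mpoly_eval q z0 \<noteq> 0" and w: "\<And>i. w $ i > 0"
    and inv: "\<And>t x. t \<noteq> 0 \<Longrightarrow> x \<in> zero_set q \<Longrightarrow> weighted_act w t x \<in> zero_set q"
  shows "lipschitz_contractible_at (zero_set q \<inter> sphere 0 \<epsilon>) y"
proof -
  let ?L = "zero_set q \<inter> sphere 0 \<epsilon>"
  obtain p U where p: "p \<in> vanishing_ideal (zero_set q)" "mpoly_gradient p y \<noteq> 0"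
    "open U" "y \<in> U" "zero_set q \<inter> U = zero_set p \<inter> U"
    using regular_point_hypersurface[OF y(1) q] by metis
  have yX: "y \<in> zero_set q" using y(1) by (simp add: regular_points_def)
  define \<xi> where "\<xi> = (\<chi> i. of_nat (w $ i) * y $ i)"
  have euler: "(\<Sum>i\<in>UNIV. mpoly_gradient p y $ i * \<xi> $ i) = 0"
    using gradient_euler[OF p(1), of w y] inv[OF _ yX] by (simp add: \<xi>_def weighted_act_def)
  have y0: "y \<noteq> 0" using y(2) \<epsilon> by auto
  have y\<xi>: "y \<bullet> \<xi> > 0"
  proof -
    have eq: "y \<bullet> \<xi> = (\<Sum>i\<in>UNIV. real (w $ i) * (norm (y $ i))\<^sup>2)"
    proof -
      have "y $ i \<bullet> (of_nat (w $ i) * y $ i) = real (w $ i) * (norm (y $ i))\<^sup>2" for i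
      proof -
        have "of_nat (w $ i) * y $ i = real (w $ i) *\<^sub>R y $ i" by (simp add: scaleR_conv_of_real)
        then show ?thesis by (simp add: power2_norm_eq_inner)
      qed
      then show ?thesis by (simp add: inner_vec_def \<xi>_def)
    qed
    obtain i where i: "y $ i \<noteq> 0" using y0 by (auto simp: vec_eq_iff)
    have "0 < real (w $ i) * (norm (y $ i))\<^sup>2" using i w by simp
    also have "\<dots> \<le> (\<Sum>i\<in>UNIV. real (w $ i) * (norm (y $ i))\<^sup>2)"
      by (rule member_le_sum) auto
    finally show ?thesis by (simp add: eq)
  qed
  obtain i0 where i0: "mpoly_gradient p y $ i0 \<noteq> 0" using p(2) by (auto simp: vec_eq_iff)
  define e where "e = (axis i0 (1 / mpoly_gradient p y $ i0) :: complex ^ 'n)"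
  have pe: "(\<Sum>i\<in>UNIV. mpoly_gradient p y $ i * e $ i) = 1"
    using i0 by (simp add: e_def axis_def if_distrib[of "\<lambda>x. _ * x"] cong: if_cong)
  define G where "G z = (mpoly_eval p z, z \<bullet> z - \<epsilon>\<^sup>2)" for z
  define G' where "G' z h = ((\<Sum>i\<in>UNIV. mpoly_gradient p z $ i * h $ i), 2 * (z \<bullet> h))" for z h
  have dG: "(G has_derivative G' z) (at z)" for z
  proof -
    have "((\<lambda>z. z \<bullet> z - \<epsilon>\<^sup>2) has_derivative (\<lambda>h. 2 * (z \<bullet> h))) (at z)"
      by (auto intro!: derivative_eq_intros simp: inner_commute)
    from has_derivative_Pair[OF mpoly_eval_has_derivative this]
    show ?thesis unfolding G_def[abs_def] G'_def[abs_def] .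
  qed
  \<comment> \<open>\<open>e\<close> realizes the prescribed derivative of \<open>p\<close>; a
    multiple of \<open>\<xi>\<close> then adjusts the sphere component without disturbing
    it.\<close>
  define J where "J k = fst k *s e + ((snd k - 2 * (y \<bullet> (fst k *s e))) / (2 * (y \<bullet> \<xi>))) *\<^sub>R \<xi>" for k :: "complex \<times> real"
  have "linear J"
  proof (rule linearI)
    show "J (a + b) = J a + J b" for a b
      by (simp add: J_def vec_eq_iff vector_sadd_rdistrib inner_add_right add_divide_distrib diff_divide_distrib algebra_simps)
    show "J (c *\<^sub>R a) = c *\<^sub>R J a" for c a
    proof -
      have "(c *\<^sub>R fst a) *s e = c *\<^sub>R (fst a *s e)" by (simp add: vec_eq_iff)
      then show ?thesis by (simp add: J_def algebra_simps diff_divide_distrib)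
    qed
  qed
  then have J: "bounded_linear J" by (simp add: linear_conv_bounded_linear)
  have GJ: "G' y (J k) = k" for k
  proof -
    have 1: "(\<Sum>i\<in>UNIV. mpoly_gradient p y $ i * (fst k *s e + c *\<^sub>R \<xi>) $ i) = fst k" for c :: real
    proof -
      have "(\<Sum>i\<in>UNIV. mpoly_gradient p y $ i * (fst k *s e + c *\<^sub>R \<xi>) $ i) =
          fst k * (\<Sum>i\<in>UNIV. mpoly_gradient p y $ i * e $ i) +
          of_real c * (\<Sum>i\<in>UNIV. mpoly_gradient p y $ i * \<xi> $ i)"
        unfolding vector_add_component vector_smult_component vector_scaleR_component
        by (simp add: sum_distrib_left sum.distrib[symmetric] scaleR_conv_of_real algebra_simps)
      then show ?thesis by (simp add: pe euler)
    qed
    have 2: "2 * (y \<bullet> J k) = snd k"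
      using y\<xi> by (simp add: J_def inner_add_right field_simps)
    show ?thesis using 1 2 by (simp add: G'_def J_def prod_eq_iff)
  qed
  have contG: "\<exists>d>0. \<forall>x\<in>ball y d. \<forall>h. norm (G' x h - G' y h) \<le> \<eta> * norm h" if \<eta>: "\<eta> > 0" for \<eta>
  proof -
    define N where "N = real CARD('n)"
    have N: "N > 0" by (simp add: N_def)
    have "isCont (mpoly_gradient p) y"
      using continuous_on_mpoly_gradient[of p] by (simp add: continuous_on_eq_continuous_at)
    moreover have "\<eta> / (2 * N) > 0" using \<eta> N by simp
    \<comment> \<open>Summed over the \<open>N\<close> coordinates this tolerance gives \<eta> / 2;
      the radius \<eta> / 4 below gives the other half, for the sphere component.\<close>
    ultimately obtain d where d: "d > 0" "\<And>x. dist x y < d \<Longrightarrow> dist (mpoly_gradient p x) (mpoly_gradient p y) < \<eta> / (2 * N)"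
      unfolding continuous_at_eps_delta by blast
    show ?thesis
    proof (intro exI[of _ "min d (\<eta> / 4)"] conjI ballI allI)
      show "min d (\<eta> / 4) > 0" using d \<eta> by simp
      fix x h assume x: "x \<in> ball y (min d (\<eta> / 4))"
      have eq: "G' x h - G' y h = ((\<Sum>i\<in>UNIV. (mpoly_gradient p x - mpoly_gradient p y) $ i * h $ i), 2 * ((x - y) \<bullet> h))"
        by (simp add: G'_def sum_subtractf[symmetric] algebra_simps inner_diff_left)
      have "norm (\<Sum>i\<in>UNIV. (mpoly_gradient p x - mpoly_gradient p y) $ i * h $ i) \<le>
          (\<Sum>i\<in>(UNIV :: 'n set). \<eta> / (2 * N) * norm h)"
      proof (rule sum_norm_le)
        fix i
        have "norm ((mpoly_gradient p x - mpoly_gradient p y) $ i) \<le> \<eta> / (2 * N)"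
          using d(2)[of x] x Finite_Cartesian_Product.norm_nth_le[of "mpoly_gradient p x - mpoly_gradient p y" i]
          by (simp add: dist_norm norm_minus_commute)
        then show "norm ((mpoly_gradient p x - mpoly_gradient p y) $ i * h $ i) \<le> \<eta> / (2 * N) * norm h"
          unfolding norm_mult using \<eta> N Finite_Cartesian_Product.norm_nth_le[of h i] by (intro mult_mono) auto
      qed
      also have "\<dots> = \<eta> / 2 * norm h" using N by (simp add: N_def)
      finally have 1: "norm (\<Sum>i\<in>UNIV. (mpoly_gradient p x - mpoly_gradient p y) $ i * h $ i) \<le> \<eta> / 2 * norm h" .
      have "\<bar>(x - y) \<bullet> h\<bar> \<le> norm (x - y) * norm h" by (rule Cauchy_Schwarz_ineq2)
      also have "\<dots> \<le> \<eta> / 4 * norm h" using x by (intro mult_right_mono) (auto simp: dist_norm norm_minus_commute)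
      finally have 2: "norm (2 * ((x - y) \<bullet> h)) \<le> \<eta> / 2 * norm h" by simp
      show "norm (G' x h - G' y h) \<le> \<eta> * norm h"
        unfolding eq using 1 2 by (intro order_trans[OF norm_Pair_le]) simp
    qed
  qed
  have G0: "G y = 0"
    using yX p(1) y(2) \<epsilon> by (auto simp: G_def vanishing_ideal_def zero_set_def zero_prod_def dot_square_norm)
  have G_iff: "G x = 0 \<longleftrightarrow> x \<in> ?L" if "x \<in> U" for x
  proof -
    have "G x = 0 \<longleftrightarrow> x \<in> zero_set p \<and> x \<bullet> x = \<epsilon>\<^sup>2" by (auto simp: G_def zero_set_def zero_prod_def)
    also have "x \<bullet> x = \<epsilon>\<^sup>2 \<longleftrightarrow> x \<in> sphere 0 \<epsilon>" using \<epsilon> by (simp add: dot_square_norm)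
    finally show ?thesis using p(5) that by blast
  qed
  obtain r where r: "r > 0" "\<And>y1. y1 \<in> ball y r \<Longrightarrow> G y1 = 0 \<Longrightarrow> \<exists>g.
       continuous_on ({x\<in>ball y r. G x = 0} \<times> {0..1::real}) (\<lambda>(x, v). g x v) \<and>
       (\<forall>x\<in>ball y r. G x = 0 \<longrightarrow> g x 0 = x \<and> g x 1 = y1 \<and>
         (\<forall>v\<in>{0..1}. g x v \<in> U \<and> G (g x v) = 0) \<and>
         (\<forall>v\<in>{0..1}. \<forall>v'\<in>{0..1}. dist (g x v) (g x v') \<le> 3 * \<bar>v - v'\<bar> * dist x y1))"
    using submersion_locally_contractible[OF p(3,4) G0 dG contG J GJ] by blast
  obtain rU where rU: "rU > 0" "ball y rU \<subseteq> U" using p(3,4) openE by blast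
  define r' where "r' = min r rU"
  have r': "r' > 0" using r rU by (simp add: r'_def)
  have sub: "x \<in> U \<and> x \<in> ball y r \<and> G x = 0" if "x \<in> ?L \<inter> ball y r'" for x
  proof -
    have "x \<in> U" "x \<in> ball y r" using that rU(2) by (auto simp: r'_def)
    with G_iff that show ?thesis by blast
  qed
  show ?thesis
    unfolding lipschitz_contractible_at_def
  proof (rule exI[of _ r'], rule conjI[OF r'], rule exI[of _ "3 :: real"], intro conjI ballI)
    show "(3 :: real) \<ge> 0" by simp
    fix y1 assume "y1 \<in> ?L \<inter> ball y r'"
    from r(2)[of y1] sub[OF this] obtain g where
      gc: "continuous_on ({x\<in>ball y r. G x = 0} \<times> {0..1::real}) (\<lambda>(x, v). g x v)" and
      g: "\<And>x. x\<in>ball y r \<Longrightarrow> G x = 0 \<Longrightarrow> g x 0 = x \<and> g x 1 = y1 \<and>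
         (\<forall>v\<in>{0..1}. g x v \<in> U \<and> G (g x v) = 0) \<and>
         (\<forall>v\<in>{0..1}. \<forall>v'\<in>{0..1}. dist (g x v) (g x v') \<le> 3 * \<bar>v - v'\<bar> * dist x y1)"
      by blast
    show "\<exists>g. continuous_on ((?L \<inter> ball y r') \<times> {0..1::real}) (\<lambda>(x, v). g x v) \<and>
     (\<forall>x\<in>?L \<inter> ball y r'. g x 0 = x \<and> g x 1 = y1 \<and> (\<forall>v\<in>{0..1}. g x v \<in> ?L) \<and>
       (\<forall>v\<in>{0..1}. \<forall>v'\<in>{0..1}. dist (g x v) (g x v') \<le> 3 * \<bar>v - v'\<bar> * dist x y1))"
    proof (intro exI[of _ g] conjI ballI)
      show "continuous_on ((?L \<inter> ball y r') \<times> {0..1}) (\<lambda>(x, v). g x v)"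
        by (rule continuous_on_subset[OF gc]) (use sub in blast)
      fix x assume x: "x \<in> ?L \<inter> ball y r'"
      note gx = g[of x] sub[OF x]
      show "g x 0 = x" "g x 1 = y1" using gx by blast+
      show "g x v \<in> ?L" if "v \<in> {0..1}" for v using gx that G_iff[of "g x v"] by blast
      show "dist (g x v) (g x v') \<le> 3 * \<bar>v - v'\<bar> * dist x y1" if "v \<in> {0..1}" "v' \<in> {0..1}" for v v'
        using gx that by blast
    qed
  qed
qed

text \<open>Regularity is known only near 0, so the action first moves the point there; the slice
  then becomes a slice at another nonzero third coordinate. By Euler's relation a gradient along the
  third axis alone would vanish, so one of the first two partial derivatives is nonzero and the
  curve is a graph over the other coordinate.\<close>

lemma slice_graph:
  fixes q :: "(3, complex) mpoly" and w :: "nat ^ 3"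
  assumes q: "mpoly_eval q z0 \<noteq> 0" and w: "\<And>i. w $ i > 0"
    and inv: "\<And>t x. t \<noteq> 0 \<Longrightarrow> x \<in> zero_set q \<Longrightarrow> weighted_act w t x \<in> zero_set q"
    and reg: "\<And>x. x \<in> zero_set q \<Longrightarrow> x \<noteq> 0 \<Longrightarrow> norm x < \<delta> \<Longrightarrow> x \<in> regular_points (zero_set q)" and \<delta>: "\<delta> > 0"
    and r0: "r0 \<noteq> 0"
  defines "C \<equiv> {c. vec3 (fst c) (snd c) r0 \<in> zero_set q}"
  assumes c: "c \<in> C"
  shows "graph_at C c \<or> graph_at (prod.swap ` C) (prod.swap c)"
proof -
  define v where "v z = vec3 (fst z) (snd z) r0" for z
  have vc: "v c \<in> zero_set q" using c by (simp add: C_def v_def)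
  \<comment> \<open>Small enough for \<open>norm_weighted_act_le\<close> to bring the point into the
    ball of radius \<open>\<delta>\<close>.\<close>
  define s where "s = min 1 (\<delta> / (2 * (norm (v c) + 1)))"
  have s: "s > 0" "s \<le> 1" using \<delta> by (auto simp: s_def add_nonneg_pos)
  have s0: "complex_of_real s \<noteq> 0" using s by simp
  define Z where "Z z = weighted_act w (of_real s) (v z)" for z
  have "norm (Z c) \<le> s * norm (v c)"
    unfolding Z_def using s w by (intro norm_weighted_act_le) auto
  also have "\<dots> \<le> \<delta> / (2 * (norm (v c) + 1)) * norm (v c)" unfolding s_def by (intro mult_right_mono) auto
  also have "\<dots> < \<delta>"
    using \<delta> by (simp add: divide_less_eq add_nonneg_pos)
  finally have small: "norm (Z c) < \<delta>" .
  have Z3: "Z z $ 3 \<noteq> 0" for z using s0 r0 by (simp add: Z_def v_def)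
  have Zc: "Z c \<in> zero_set q" unfolding Z_def by (rule inv[OF s0 vc])
  have "Z c \<noteq> 0" using Z3[of c] by auto
  from regular_point_hypersurface[OF reg[OF Zc this small] q] obtain p U where
    p: "p \<in> vanishing_ideal (zero_set q)" "mpoly_gradient p (Z c) \<noteq> 0"
    "open U" "Z c \<in> U" "zero_set q \<inter> U = zero_set p \<inter> U" by metis
  have "(\<Sum>i\<in>UNIV. mpoly_gradient p (Z c) $ i * (of_nat (w $ i) * Z c $ i)) = 0"
    using gradient_euler[OF p(1), of w "Z c"] inv[OF _ Zc] by (simp add: weighted_act_def)
  then have euler: "mpoly_gradient p (Z c) $ 1 * (of_nat (w $ 1) * Z c $ 1) +
      mpoly_gradient p (Z c) $ 2 * (of_nat (w $ 2) * Z c $ 2) +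
      mpoly_gradient p (Z c) $ 3 * (of_nat (w $ 3) * Z c $ 3) = 0" by (simp add: sum_3)
  have grad: "mpoly_gradient p (Z c) $ 1 \<noteq> 0 \<or> mpoly_gradient p (Z c) $ 2 \<noteq> 0"
  proof (rule ccontr)
    assume "\<not> ?thesis"
    then have "mpoly_gradient p (Z c) $ 3 = 0" using euler Z3[of c] w[of 3] by simp
    with \<open>\<not> ?thesis\<close> p(2) show False by (simp add: vec_eq_iff forall_3)
  qed
  define P where "P z = mpoly_eval p (Z z)" for z
  define p1 where "p1 z = mpoly_gradient p (Z z) $ 1 * of_real s ^ (w $ 1)" for z
  define p2 where "p2 z = mpoly_gradient p (Z z) $ 2 * of_real s ^ (w $ 2)" for z
  have dZ: "(Z has_derivative (\<lambda>h. vec3 (of_real s ^ (w $ 1) * fst h) (of_real s ^ (w $ 2) * snd h) 0)) (at z)" for z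
  proof -
    have 1: "Z = (\<lambda>z. \<chi> i. if i = 1 then of_real s ^ (w $ 1) * fst z else if i = 2 then of_real s ^ (w $ 2) * snd z
        else of_real s ^ (w $ 3) * r0)"
      by (simp add: fun_eq_iff vec_eq_iff forall_3 Z_def v_def)
    show ?thesis unfolding 1 vec3_def
    proof (rule has_derivative_vec_lambda)
      fix i :: 3
      have f: "((\<lambda>z. of_real s ^ (w $ 1) * fst z) has_derivative (\<lambda>h. of_real s ^ (w $ 1) * fst h)) (at z)"
        by (intro has_derivative_mult_right bounded_linear_imp_has_derivative bounded_linear_fst)
      have g: "((\<lambda>z. of_real s ^ (w $ 2) * snd z) has_derivative (\<lambda>h. of_real s ^ (w $ 2) * snd h)) (at z)"
        by (intro has_derivative_mult_right bounded_linear_imp_has_derivative bounded_linear_snd)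
      show "((\<lambda>z. if i = 1 then of_real s ^ (w $ 1) * fst z else if i = 2 then of_real s ^ (w $ 2) * snd z
        else of_real s ^ (w $ 3) * r0) has_derivative
        (\<lambda>h. if i = 1 then of_real s ^ (w $ 1) * fst h else if i = 2 then of_real s ^ (w $ 2) * snd h else 0)) (at z)"
        using f g by (cases "i = 1"; cases "i = 2") auto
    qed
  qed
  have contZ: "continuous_on UNIV Z"
    by (intro continuous_at_imp_continuous_on ballI has_derivative_continuous[OF dZ])
  have dP: "(P has_derivative (\<lambda>h. p1 z * fst h + p2 z * snd h)) (at z)" for z
    using has_derivative_compose[OF dZ mpoly_eval_has_derivative[of p]]
    unfolding P_def by (simp add: sum_3 p1_def p2_def mult_ac)
  have cg: "continuous_on UNIV (\<lambda>z. mpoly_gradient p (Z z))"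
    by (rule continuous_on_compose2[OF continuous_on_mpoly_gradient contZ]) (rule subset_UNIV)
  have c1: "continuous_on UNIV p1" "continuous_on UNIV p2"
    unfolding p1_def p2_def
    by (intro continuous_on_mult continuous_on_const continuous_on_component cg)+
  have Pc: "P c = 0" using Zc p(1) by (auto simp: P_def vanishing_ideal_def zero_set_def)
  have ZC: "z \<in> C \<longleftrightarrow> Z z \<in> zero_set q" for z
  proof
    assume "z \<in> C"
    then have "v z \<in> zero_set q" by (simp add: C_def v_def)
    then show "Z z \<in> zero_set q" unfolding Z_def by (rule inv[OF s0])
  next
    assume "Z z \<in> zero_set q"
    then have "weighted_act w (1 / of_real s) (Z z) \<in> zero_set q" using s0 by (intro inv) auto
    then show "z \<in> C" using s0 by (simp add: Z_def weighted_act_mult C_def v_def)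
  qed
  have oU: "open (Z -` U)" by (rule open_vimage[OF p(3) contZ])
  have CU: "C \<inter> Z -` U = {z. P z = 0} \<inter> Z -` U"
    using p(5) ZC unfolding P_def zero_set_def by blast
  show ?thesis
  proof (cases "mpoly_gradient p (Z c) $ 2 = 0")
    case False
    then have "p2 c \<noteq> 0" using s0 by (simp add: p2_def)
    from graph_at_implicit[OF dP c1(2) Pc this oU _ CU] p(4) show ?thesis by simp
  next
    case True
    with grad have ne: "p1 (prod.swap (prod.swap c)) \<noteq> 0" using s0 by (simp add: p1_def)
    have sw: "(prod.swap has_derivative prod.swap) (at z)" for z :: "complex \<times> complex"
      unfolding prod.swap_def[abs_def]
      by (intro bounded_linear_imp_has_derivative bounded_linear_Pair bounded_linear_fst bounded_linear_snd)
    have csw: "continuous_on UNIV (prod.swap :: complex \<times> complex \<Rightarrow> complex \<times> complex)"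
      by (intro continuous_at_imp_continuous_on ballI has_derivative_continuous[OF sw])
    have dPs: "((\<lambda>z. P (prod.swap z)) has_derivative
        (\<lambda>h. p2 (prod.swap z) * fst h + p1 (prod.swap z) * snd h)) (at z)" for z
      using has_derivative_compose[OF sw dP] by (simp add: add.commute)
    have cs: "continuous_on UNIV (\<lambda>z. p1 (prod.swap z))"
      by (rule continuous_on_compose2[OF c1(1) csw]) (rule subset_UNIV)
    have os: "open (prod.swap -` (Z -` U))" by (rule open_vimage[OF oU csw])
    have "prod.swap ` C \<inter> prod.swap -` (Z -` U) = {z. P (prod.swap z) = 0} \<inter> prod.swap -` (Z -` U)"
      using CU by force
    from graph_at_implicit[OF dPs cs _ ne os _ this] Pc p(4) show ?thesis by simp
  qed
qed

section \<open>The scaled real curve and its contraction inside the slice\<close>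

lemma lipschitz_joined_image:
  assumes "lipschitz_joined A L x y" and f: "f ` A \<subseteq> Z" and M: "M \<ge> 0"
    "\<And>u v. u \<in> A \<Longrightarrow> v \<in> A \<Longrightarrow> dist (f u) (f v) \<le> M * dist u v"
  shows "lipschitz_joined Z (M * L) (f x) (f y)"
proof -
  obtain \<gamma> where \<gamma>: "\<gamma> 0 = x" "\<gamma> 1 = y" "\<gamma> ` {0..1} \<subseteq> A" and L: "L \<ge> 0"
    and lip: "\<And>s t. s \<in> {0..1} \<Longrightarrow> t \<in> {0..1} \<Longrightarrow> dist (\<gamma> s) (\<gamma> t) \<le> L * \<bar>s - t :: real\<bar>"
    using assms(1) unfolding lipschitz_joined_def by blast
  show ?thesis
    unfolding lipschitz_joined_def
  proof (intro conjI exI[of _ "\<lambda>s. f (\<gamma> s)"] ballI)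
    show "(\<lambda>s. f (\<gamma> s)) ` {0..1} \<subseteq> Z" using \<gamma>(3) f by blast
    fix s t :: real assume st: "s \<in> {0..1}" "t \<in> {0..1}"
    have "dist (f (\<gamma> s)) (f (\<gamma> t)) \<le> M * dist (\<gamma> s) (\<gamma> t)" using \<gamma>(3) st by (intro M) blast+
    also have "\<dots> \<le> M * (L * \<bar>s - t\<bar>)" by (rule mult_left_mono[OF lip[OF st] M(1)])
    finally show "dist (f (\<gamma> s)) (f (\<gamma> t)) \<le> M * L * \<bar>s - t\<bar>" by simp
  qed (use \<gamma> L M in auto)
qed

lemma arc_chart_lipschitz_joined:
  assumes "arc_chart A a N r e e' \<pi>" and B: "B > 0" "2 * r * B \<le> 1"
    and e': "\<And>t. t \<in> {-r<..<r} \<Longrightarrow> norm (e' t) \<le> B" and x: "x \<in> A \<inter> N" "y \<in> A \<inter> N"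
  shows "lipschitz_joined A 1 x y"
proof -
  have ch: "A \<inter> N = e ` {-r<..<r}" "\<And>t. t \<in> {-r<..<r} \<Longrightarrow> (e has_vector_derivative e' t) (at t)"
    using assms(1) unfolding arc_chart_def by auto
  have lip: "norm (e s - e t) \<le> B * norm (s - t)" if "s \<in> {-r<..<r}" "t \<in> {-r<..<r}" for s t
  proof (rule differentiable_bound[of "{-r<..<r}" e "\<lambda>t h. h *\<^sub>R e' t"])
    show "(e has_derivative (\<lambda>h. h *\<^sub>R e' u)) (at u within {-r<..<r})" if "u \<in> {-r<..<r}" for u
      using ch(2)[OF that] unfolding has_vector_derivative_def by (rule has_derivative_at_withinI)
    show "onorm (\<lambda>h. h *\<^sub>R e' u) \<le> B" if "u \<in> {-r<..<r}" for u
    proof (rule onorm_bound)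
      show "norm (h *\<^sub>R e' u) \<le> B * norm h" for h
        using mult_left_mono[OF e'[OF that], of "\<bar>h\<bar>"] by (simp add: mult.commute)
    qed (use B in simp)
  qed (use that in auto)
  obtain t0 t1 where t: "t0 \<in> {-r<..<r}" "x = e t0" "t1 \<in> {-r<..<r}" "y = e t1" using x ch(1) by blast
  define l where "l s = (1 - s) *\<^sub>R t0 + s *\<^sub>R t1" for s :: real
  have l: "l s \<in> {-r<..<r}" if "s \<in> {0..1}" for s
    unfolding l_def by (rule convexD_alt[OF convex_real_interval(8) t(1,3)]) (use that in auto)
  show ?thesis
    unfolding lipschitz_joined_def
  proof (intro conjI exI[of _ "\<lambda>s. e (l s)"] ballI)
    show "(\<lambda>s. e (l s)) ` {0..1} \<subseteq> A" using l ch(1) by blast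
    fix s u :: real assume su: "s \<in> {0..1}" "u \<in> {0..1}"
    have "dist (e (l s)) (e (l u)) \<le> B * norm (l s - l u)" unfolding dist_norm by (rule lip[OF l[OF su(1)] l[OF su(2)]])
    also have "l s - l u = (s - u) * (t1 - t0)" by (simp add: l_def algebra_simps)
    also have "B * norm ((s - u) * (t1 - t0)) = (B * \<bar>t1 - t0\<bar>) * \<bar>s - u\<bar>" by (simp add: abs_mult)
    also have "\<dots> \<le> 1 * \<bar>s - u\<bar>"
    proof (rule mult_right_mono)
      have "B * \<bar>t1 - t0\<bar> \<le> B * (2 * r)" using t B by (intro mult_left_mono) auto
      then show "B * \<bar>t1 - t0\<bar> \<le> 1" using B(2) by (simp add: mult_ac)
    qed simp
    finally show "dist (e (l s)) (e (l u)) \<le> 1 * \<bar>s - u\<bar>" .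
  qed (use t in \<open>auto simp: l_def\<close>)
qed

text \<open>This bounds the diameter of \<open>A\<close> in its inner metric by \<open>n\<close>,
  since the steps are Lipschitz paths inside \<open>A\<close>.\<close>

lemma arcs_uniform_chains:
  assumes A: "compact A" "connected A" and ch: "\<And>a. a \<in> A \<Longrightarrow> \<exists>N r e e' \<pi>. arc_chart A a N r e e' \<pi>"
  obtains n where "\<And>b c. b \<in> A \<Longrightarrow> c \<in> A \<Longrightarrow>
    (b, c) \<in> {(x, y). x \<in> A \<and> y \<in> A \<and> lipschitz_joined A 1 x y} ^^ n"
proof -
  have "\<exists>N. open N \<and> a \<in> N \<and> (\<forall>x\<in>A \<inter> N. \<forall>y\<in>A \<inter> N. lipschitz_joined A 1 x y)" if aA: "a \<in> A" for a
  proof -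
    obtain N r e e' \<pi> where "arc_chart A a N r e e' \<pi>" using ch[OF aA] by blast
    from arc_chart_shrink[OF this] obtain N' r' B where N': "arc_chart A a N' r' e e' \<pi>" "B > 0" "2 * r' * B \<le> 1"
      "\<And>t. t \<in> {-r'<..<r'} \<Longrightarrow> norm (e' t) \<le> B" by metis
    have "open N'" "a \<in> N'" using N'(1) by (auto simp: arc_chart_def)
    then show ?thesis using arc_chart_lipschitz_joined[OF N'] by blast
  qed
  then obtain N where N: "\<And>a. a \<in> A \<Longrightarrow> open (N a) \<and> a \<in> N a"
    "\<And>a x y. a \<in> A \<Longrightarrow> x \<in> A \<inter> N a \<Longrightarrow> y \<in> A \<inter> N a \<Longrightarrow> lipschitz_joined A 1 x y" by metis
  obtain n where n: "\<And>b c. b \<in> A \<Longrightarrow> c \<in> A \<Longrightarrow>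
    (b, c) \<in> {(x, y). x \<in> A \<and> y \<in> A \<and> (\<exists>a\<in>A. x \<in> N a \<and> y \<in> N a)} ^^ n"
    using uniform_chains[OF A N(1)] by blast
  have sub: "{(x, y). x \<in> A \<and> y \<in> A \<and> (\<exists>a\<in>A. x \<in> N a \<and> y \<in> N a)} \<subseteq>
      {(x, y). x \<in> A \<and> y \<in> A \<and> lipschitz_joined A 1 x y}" using N(2) by blast
  have "R ^^ n \<subseteq> R' ^^ n" if "R \<subseteq> R'" for R R' :: "(complex \<times> complex) set" and n
    using that by (induction n) (auto intro: relcomp_mono[THEN subsetD])
  from this[OF sub] n show ?thesis using that by blast
qed

text \<open>The real curve \<open>A\<close> in the slice \<open>x\<^sub>3 = r0\<close>, pushed towards \<open>0\<close> by the action of a small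
  real \<open>s\<close>, has diameter of order \<open>s ^ min w\<^sub>1 w\<^sub>2\<close> at distance of order \<open>s ^ w\<^sub>3\<close> from \<open>0\<close>.
  It contracts in \<open>X\<close> near itself, hence away from \<open>x\<^sub>3 = 0\<close>, and acting by a root of
  \<open>r0 / x\<^sub>3\<close> moves the contraction back into the slice.\<close>

lemma conic_slice_nullhomotopic:
  fixes X :: "(complex ^ 3) set" and w :: "nat ^ 3" and r0 :: real
  assumes w: "\<And>i. w $ i > 0" and w3: "w $ 3 < min (w $ 1) (w $ 2)"
    and inv: "\<And>t x. t \<noteq> 0 \<Longrightarrow> x \<in> X \<Longrightarrow> weighted_act w t x \<in> X"
    and \<epsilon>: "\<epsilon> > 0" and L: "compact (X \<inter> sphere 0 \<epsilon>)"
    and lc: "\<And>y. y \<in> X \<inter> sphere 0 \<epsilon> \<Longrightarrow> lipschitz_contractible_at (X \<inter> sphere 0 \<epsilon>) y"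
    and hk: "homeomorphism (cone_over 0 (X \<inter> sphere 0 \<epsilon>)) (X \<inter> cball 0 \<epsilon>) h k"
    and bl: "inner_bi_lipschitz (cone_over 0 (X \<inter> sphere 0 \<epsilon>)) (X \<inter> cball 0 \<epsilon>) h"
    and r0: "r0 \<noteq> 0" and A: "compact A" "connected A" "a0 \<in> A"
    and AX: "\<And>a. a \<in> A \<Longrightarrow> vec3 (of_real (Re a)) (of_real (Im a)) (of_real r0) \<in> X"
    and ch: "\<And>a. a \<in> A \<Longrightarrow> \<exists>N r e e' \<pi>. arc_chart A a N r e e' \<pi>"
  obtains H c1 where "continuous_on (A \<times> {0..1::real}) H"
    "\<And>z. z \<in> A \<times> {0..1} \<Longrightarrow> vec3 (fst (H z)) (snd (H z)) (of_real r0) \<in> X"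
    "\<And>a. a \<in> A \<Longrightarrow> H (a, 0) = (of_real (Re a), of_real (Im a))" "\<And>a. a \<in> A \<Longrightarrow> H (a, 1) = c1"
proof -
  let ?C = "cone_over 0 (X \<inter> sphere 0 \<epsilon>)" and ?B = "X \<inter> cball 0 \<epsilon>"
  define P where "P a = vec3 (complex_of_real (Re a)) (complex_of_real (Im a)) (complex_of_real r0)" for a
  define m where "m = min (w $ 1) (w $ 2)"
  have cP: "continuous_on S P" for S
    unfolding P_def vec3_def
  proof (rule continuous_on_vec_lambda)
    fix i :: 3
    show "continuous_on S (\<lambda>a. if i = 1 then complex_of_real (Re a) else if i = 2 then complex_of_real (Im a) else complex_of_real r0)"
      by (cases "i = 1"; cases "i = 2") (auto intro!: continuous_intros)
  qed
  have "bounded (P ` A)" by (intro compact_imp_bounded compact_continuous_image cP A)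
  then obtain B where B: "B > 0" "\<And>a. a \<in> A \<Longrightarrow> norm (P a) \<le> B" unfolding bounded_pos by blast
  obtain K where K: "K > 0"
    "\<And>x y L. x \<in> ?C \<Longrightarrow> y \<in> ?C \<Longrightarrow> lipschitz_joined ?C L x y \<Longrightarrow> dist (h x) (h y) \<le> K * L"
    "\<And>x y L. x \<in> ?C \<Longrightarrow> y \<in> ?C \<Longrightarrow> lipschitz_joined ?B L (h x) (h y) \<Longrightarrow> dist x y \<le> K * L"
    using inner_bi_lipschitz_joined[OF bl] by blast
  \<comment> \<open>The inner minimum keeps the scaled curve in the ball of radius
    \<open>\<epsilon>\<close>. The last bound, for a homeomorphism that moves the apex, keeps the
    curve within |h 0| / 2 of 0.\<close>
  define s0 where "s0 = min (min 1 (\<epsilon> / B)) (if h 0 = 0 then 1 else norm (h 0) / (2 * B))"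
  have s0: "s0 > 0" "s0 \<le> 1" "s0 \<le> \<epsilon> / B" "h 0 \<noteq> 0 \<Longrightarrow> s0 \<le> norm (h 0) / (2 * B)"
    using \<epsilon> B(1) by (auto simp: s0_def)
  define s where "s n = s0 / real (Suc n)" for n
  have s: "s n > 0" "s n \<le> s0" "s n \<le> 1" for n
  proof -
    show "s n > 0" using s0 by (simp add: s_def)
    show "s n \<le> s0" using s0(1) by (simp add: s_def divide_le_eq mult_left_le)
    then show "s n \<le> 1" using s0(2) by simp
  qed
  have s_lim: "s \<longlonglongrightarrow> 0"
    unfolding s_def using LIMSEQ_Suc[OF lim_const_over_n[of s0]] by simp
  define j where "j n a = weighted_act w (of_real (s n)) (P a)" for n a
  have jn: "norm (j n a) \<le> s n * B" if "a \<in> A" for n a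
  proof -
    have "norm (j n a) \<le> s n * norm (P a)"
      unfolding j_def using s[of n] w by (intro norm_weighted_act_le) auto
    also have "\<dots> \<le> s n * B" using B(2)[OF that] s(1)[of n] by (intro mult_left_mono) auto
    finally show ?thesis .
  qed
  have jB: "j n a \<in> ?B" if "a \<in> A" for n a
  proof -
    have "s n * B \<le> (\<epsilon> / B) * B" using s(2)[of n] s0(3) B by (intro mult_right_mono) auto
    then have "norm (j n a) \<le> \<epsilon>" using jn[OF that, of n] B by simp
    moreover have "j n a \<in> X" unfolding j_def using s(1)[of n] AX[OF that] by (intro inv) (auto simp: P_def)
    ultimately show ?thesis by simp
  qed
  have cj: "continuous_on A (j n)" for n
    unfolding j_def weighted_act_def
    by (intro continuous_on_vec_lambda continuous_on_mult continuous_on_const continuous_on_component cP)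
  have j_lip: "dist (j n a) (j n b) \<le> s n ^ m * dist a b" for n a b
  proof -
    have "dist (j n a) (j n b) = norm (vec3 (of_real (s n ^ (w $ 1) * (Re a - Re b))) (of_real (s n ^ (w $ 2) * (Im a - Im b))) (0::complex))"
    proof -
      have "j n a - j n b = vec3 (of_real (s n ^ (w $ 1) * (Re a - Re b))) (of_real (s n ^ (w $ 2) * (Im a - Im b))) 0"
        by (simp add: vec3_eq_iff j_def P_def algebra_simps)
      then show ?thesis by (simp add: dist_norm)
    qed
    also have "\<dots> \<le> norm (vec3 (of_real (s n ^ m * (Re a - Re b))) (of_real (s n ^ m * (Im a - Im b))) (0::complex))"
    proof (rule norm_le_componentwise_cart)
      have p: "s n ^ (w $ 1) \<le> s n ^ m" "s n ^ (w $ 2) \<le> s n ^ m"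
        using s[of n] by (auto simp: m_def intro!: power_decreasing)
      fix i :: 3
      have "norm (complex_of_real (s n ^ (w $ 1) * (Re a - Re b))) \<le> norm (complex_of_real (s n ^ m * (Re a - Re b)))"
        "norm (complex_of_real (s n ^ (w $ 2) * (Im a - Im b))) \<le> norm (complex_of_real (s n ^ m * (Im a - Im b)))"
        unfolding norm_of_real abs_mult using p s(1)[of n] by (auto intro!: mult_right_mono)
      then show "norm (vec3 (of_real (s n ^ (w $ 1) * (Re a - Re b))) (of_real (s n ^ (w $ 2) * (Im a - Im b))) (0::complex) $ i)
        \<le> norm (vec3 (of_real (s n ^ m * (Re a - Re b))) (of_real (s n ^ m * (Im a - Im b))) (0::complex) $ i)"
        using exhaust_3[of i] by (elim disjE) (simp_all only: vec3_nth norm_zero order_refl)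
    qed
    also have "\<dots> = s n ^ m * dist a b"
    proof -
      have "(norm (vec3 (of_real (s n ^ m * (Re a - Re b))) (of_real (s n ^ m * (Im a - Im b))) (0::complex)))\<^sup>2
         = (s n ^ m * dist a b)\<^sup>2"
        unfolding norm_vec_def L2_set_def sum_3 vec3_nth norm_of_real dist_norm cmod_def power_mult_distrib
        by (simp add: power_mult_distrib distrib_left)
      then show ?thesis using s(1)[of n] by (simp add: power2_eq_iff_nonneg)
    qed
    finally show ?thesis .
  qed
  have kC: "k x \<in> ?C" "h (k x) = x" if "x \<in> ?B" for x
    using hk that unfolding homeomorphism_def by blast+
  obtain n0 where n0: "\<And>b c. b \<in> A \<Longrightarrow> c \<in> A \<Longrightarrow> (b, c) \<in> {(x, y). x \<in> A \<and> y \<in> A \<and> lipschitz_joined A 1 x y} ^^ n0"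
    using arcs_uniform_chains[OF A(1,2) ch] by blast
  \<comment> \<open>There are \<open>n0\<close> chain steps; each has length at most s^m in
    \<open>X\<close>, and pulling it back to the cone costs the factor \<open>K\<close>.\<close>
  define D where "D n = real n0 * (K * s n ^ m)" for n
  have D: "dist (k (j n a)) (k (j n b)) \<le> D n" if a: "a \<in> A" and b: "b \<in> A" for n a b
  proof -
    have one: "dist (k (j n x)) (k (j n y)) \<le> K * s n ^ m" if "x \<in> A" "y \<in> A" "lipschitz_joined A 1 x y" for x y
    proof -
      have "lipschitz_joined ?B (s n ^ m * 1) (j n x) (j n y)"
        by (rule lipschitz_joined_image[OF that(3)]) (use jB j_lip s(1)[of n] in auto)
      then have "lipschitz_joined ?B (s n ^ m) (h (k (j n x))) (h (k (j n y)))"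
        using kC(2)[OF jB] that by simp
      then show ?thesis by (intro K(3) kC(1) jB that)
    qed
    have "dist (k (j n x)) (k (j n y)) \<le> real i * (K * s n ^ m)"
      if "(x, y) \<in> {(x, y). x \<in> A \<and> y \<in> A \<and> lipschitz_joined A 1 x y} ^^ i" for x y i
      using that
    proof (induction i arbitrary: y)
      case (Suc i)
      then obtain z where z: "(x, z) \<in> {(x, y). x \<in> A \<and> y \<in> A \<and> lipschitz_joined A 1 x y} ^^ i"
        "z \<in> A" "y \<in> A" "lipschitz_joined A 1 z y" by auto
      have "dist (k (j n x)) (k (j n y)) \<le> dist (k (j n x)) (k (j n z)) + dist (k (j n z)) (k (j n y))"
        by (rule dist_triangle)
      also have "\<dots> \<le> real i * (K * s n ^ m) + K * s n ^ m"
        by (intro add_mono Suc.IH z one)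
      finally show ?case by (simp add: algebra_simps)
    qed simp
    from this[OF n0[OF a b]] show ?thesis by (simp add: D_def)
  qed
  have C0: "0 \<in> ?C"
  proof -
    have "k (j 0 a0) \<in> ?C" by (intro kC jB A)
    then obtain y where "y \<in> X \<inter> sphere 0 \<epsilon>" unfolding cone_over_def by blast
    from cone_over_sphere(3)[OF \<epsilon> this, of 0] show ?thesis by simp
  qed
  \<comment> \<open>Rays lie in the cone, so the norm there is the length of a path to the apex. A
    distance from \<open>h 0\<close> in \<open>X\<close> thereby becomes a lower bound for norms in
    the cone.\<close>
  have rad: "dist (h 0) (h x) \<le> K * norm x" if x: "x \<in> ?C" for x
  proof (rule K(2)[OF C0 x])
    obtain y where y: "y \<in> X \<inter> sphere 0 \<epsilon>" "x \<in> closed_segment 0 y" using x unfolding cone_over_def by blast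
    then obtain u where u: "0 \<le> u" "u \<le> 1" "x = u *\<^sub>R y" unfolding in_segment by auto
    show "lipschitz_joined ?C (norm x) 0 x"
      unfolding lipschitz_joined_def
    proof (intro conjI exI[of _ "\<lambda>t. t *\<^sub>R x"] ballI)
      show "(\<lambda>t. t *\<^sub>R x) ` {0..1} \<subseteq> ?C"
      proof
        fix z assume "z \<in> (\<lambda>t. t *\<^sub>R x) ` {0..1}"
        then obtain t where t: "t \<in> {0..1}" "z = (t * u) *\<^sub>R y" using u by auto
        have "0 \<le> t * u" "t * u \<le> 1" using t(1) u(1,2) by (auto simp: mult_le_one)
          then show "z \<in> ?C" unfolding t(2) by (rule cone_over_sphere(3)[OF \<epsilon> y(1)])
      qed
      show "dist (t *\<^sub>R x) (t' *\<^sub>R x) \<le> norm x * \<bar>t - t'\<bar>" for t t' :: real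
        by (simp add: dist_norm mult.commute flip: scaleR_left_diff_distrib)
    qed auto
  qed
  \<comment> \<open>If \<open>h 0 = 0\<close>, the third coordinate keeps the scaled curve at
    distance at least |r0| s^w3 from it. Otherwise the distance from \<open>h 0\<close> is at least
    |h 0| / 2, which is enough because s^w3 \<le> 1.\<close>
  define \<kappa> where "\<kappa> = (if h 0 = 0 then \<bar>r0\<bar> else norm (h 0) / 2) / K"
  have \<kappa>: "\<kappa> > 0" using r0 K by (simp add: \<kappa>_def)
  define \<rho> where "\<rho> n = \<kappa> * s n ^ (w $ 3)" for n
  have \<rho>0: "\<rho> n > 0" for n using \<kappa> s(1)[of n] by (simp add: \<rho>_def)
  have \<rho>: "\<rho> n \<le> norm (k (j n a))" if a: "a \<in> A" for n a
  proof -
    have le: "dist (h 0) (j n a) \<le> K * norm (k (j n a))"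
      using rad[OF kC(1)[OF jB[OF a]], of n] kC(2)[OF jB[OF a], of n] by simp
    have "K * \<rho> n \<le> dist (h 0) (j n a)"
    proof (cases "h 0 = 0")
      case True
      have "K * \<rho> n = norm (j n a $ 3)"
        using K True s(1)[of n] by (simp add: \<rho>_def \<kappa>_def j_def P_def norm_mult norm_power)
      also have "\<dots> \<le> dist (h 0) (j n a)" using True Finite_Cartesian_Product.norm_nth_le[of "j n a" 3] by simp
      finally show ?thesis .
    next
      case False
      have "K * \<rho> n = norm (h 0) / 2 * s n ^ (w $ 3)" using K False by (simp add: \<rho>_def \<kappa>_def)
      also have "\<dots> \<le> norm (h 0) / 2 * 1"
        using s[of n] by (intro mult_left_mono power_le_one) auto
      also have "\<dots> \<le> norm (h 0) - s n * B"
      proof -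
        have "s n * B \<le> norm (h 0) / (2 * B) * B" using s(2)[of n] s0(4)[OF False] B by (intro mult_right_mono) auto
        then show ?thesis using B by simp
      qed
      also have "\<dots> \<le> norm (h 0) - norm (j n a)" using jn[OF a, of n] by simp
      also have "\<dots> \<le> dist (h 0) (j n a)" unfolding dist_norm by (rule norm_triangle_ineq2)
      finally show ?thesis .
    qed
    with le have "K * \<rho> n \<le> K * norm (k (j n a))" by simp
    then show ?thesis using K(1) by simp
  qed
  have mw: "w $ 3 < m" using w3 by (simp add: m_def)
  have ratio: "s n ^ m = s n ^ (w $ 3) * s n ^ (m - w $ 3)" for n
    using mw by (simp flip: power_add)
  have pow_lim: "(\<lambda>n. c * s n ^ (m - w $ 3)) \<longlonglongrightarrow> 0" for c :: real
    using mw by (intro tendsto_mult_right_zero tendsto_null_power s_lim) simp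
  have "(\<lambda>n. D n / \<rho> n) \<longlonglongrightarrow> 0"
  proof -
    have eq: "D n / \<rho> n = (real n0 * K / \<kappa>) * s n ^ (m - w $ 3)" for n
      using s(1)[of n] \<kappa> by (simp add: D_def \<rho>_def ratio)
    show ?thesis unfolding eq by (rule pow_lim)
  qed
  from conic_thin_sets_contract[OF \<epsilon> L lc hk K(1,2) A(3) cj jB D \<rho>0 \<rho> this]
  obtain M where M: "M \<ge> 0" and contr: "\<And>N. \<exists>n\<ge>N. \<exists>G c. continuous_on (A \<times> {0..1}) G \<and>
      (\<forall>a\<in>A. G (a, 0) = j n a \<and> G (a, 1) = c \<and>
        (\<forall>v\<in>{0..1::real}. G (a, v) \<in> X \<and> dist (G (a, v)) (j n a) \<le> M * D n))"
    by blast
  have "\<forall>\<^sub>F n in sequentially. (M * real n0 * K) * s n ^ (m - w $ 3) < \<bar>r0\<bar> / 2"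
    by (rule order_tendstoD(2)[OF pow_lim]) (use r0 in simp)
  \<comment> \<open>From here on the contraction changes the third coordinate by less than half of
    its initial size s^w3 |r0|.\<close>
  then obtain N where N: "\<And>n. n \<ge> N \<Longrightarrow> (M * real n0 * K) * s n ^ (m - w $ 3) < \<bar>r0\<bar> / 2"
    unfolding eventually_sequentially by blast
  obtain n G c where nN: "n \<ge> N" and cG: "continuous_on (A \<times> {0..1::real}) G"
    and G0: "\<And>a. a \<in> A \<Longrightarrow> G (a, 0) = j n a" and G1: "\<And>a. a \<in> A \<Longrightarrow> G (a, 1) = c"
    and GX: "\<And>a v. a \<in> A \<Longrightarrow> v \<in> {0..1} \<Longrightarrow> G (a, v) \<in> X"
    and Gd: "\<And>a v. a \<in> A \<Longrightarrow> v \<in> {0..1} \<Longrightarrow> dist (G (a, v)) (j n a) \<le> M * D n"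
    using contr[of N] by blast
  define \<sigma> where "\<sigma> = complex_of_real (s n)"
  have \<sigma>: "\<sigma> \<noteq> 0" "norm \<sigma> = s n" using s(1)[of n] by (auto simp: \<sigma>_def)
  \<comment> \<open>The third coordinate during the contraction, relative to its constant initial
    value on the scaled curve.\<close>
  define \<tau> where "\<tau> z = G z $ 3 / (\<sigma> ^ (w $ 3) * of_real r0)" for z
  have \<tau>_near: "norm (\<tau> z - 1) < 1 / 2" if z: "z \<in> A \<times> {0..1}" for z
  proof -
    obtain a v where av: "z = (a, v)" "a \<in> A" "v \<in> {0..1}" using z by blast
    have j3: "j n a $ 3 = \<sigma> ^ (w $ 3) * of_real r0" by (simp add: j_def P_def \<sigma>_def)
    have "norm (G z $ 3 - j n a $ 3) \<le> dist (G z) (j n a)"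
      using Finite_Cartesian_Product.norm_nth_le[of "G z - j n a" 3] by (simp add: dist_norm)
    also have "\<dots> \<le> M * D n" using Gd av by simp
    also have "\<dots> = s n ^ (w $ 3) * ((M * real n0 * K) * s n ^ (m - w $ 3))" by (simp add: D_def ratio)
    also have "\<dots> < s n ^ (w $ 3) * (\<bar>r0\<bar> / 2)" using N[OF nN] s(1)[of n] by (intro mult_strict_left_mono) auto
    finally have lt: "norm (G z $ 3 - \<sigma> ^ (w $ 3) * of_real r0) < s n ^ (w $ 3) * (\<bar>r0\<bar> / 2)" unfolding j3 .
    have "\<tau> z - 1 = (G z $ 3 - \<sigma> ^ (w $ 3) * of_real r0) / (\<sigma> ^ (w $ 3) * of_real r0)"
      using \<sigma> r0 by (simp add: \<tau>_def diff_divide_distrib)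
    then have "norm (\<tau> z - 1) = norm (G z $ 3 - \<sigma> ^ (w $ 3) * of_real r0) / (s n ^ (w $ 3) * \<bar>r0\<bar>)"
      by (simp add: norm_divide norm_mult norm_power \<sigma>(2))
    also have "\<dots> < 1 / 2" using lt s(1)[of n] r0 by (simp add: divide_less_eq)
    finally show ?thesis .
  qed
  have \<tau>_Re: "Re (\<tau> z) > 0" if "z \<in> A \<times> {0..1}" for z
    using \<tau>_near[OF that] abs_Re_le_cmod[of "\<tau> z - 1"] by simp
  \<comment> \<open>A root: t^w3 = \<sigma>^w3 \<tau>, with t = \<sigma> where \<tau> = 1. It is
    continuous since \<open>\<tau>\<close> stays in the right half-plane, and acting by 1 / t
    restores the third coordinate \<open>r0\<close>.\<close>
  define t where "t z = \<sigma> * exp (Ln (\<tau> z) / of_nat (w $ 3))" for z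
  have t0: "t z \<noteq> 0" for z using \<sigma> by (simp add: t_def)
  have tw: "t z ^ (w $ 3) = \<sigma> ^ (w $ 3) * \<tau> z" if "z \<in> A \<times> {0..1}" for z
  proof -
    have "exp (Ln (\<tau> z) / of_nat (w $ 3)) ^ (w $ 3) = exp (of_nat (w $ 3) * (Ln (\<tau> z) / of_nat (w $ 3)))"
      by (simp only: exp_of_nat_mult)
    also have "\<dots> = \<tau> z" using \<tau>_Re[OF that] w[of 3] by (auto intro!: exp_Ln)
    finally show ?thesis by (simp add: t_def power_mult_distrib)
  qed
  define H where "H z = (G z $ 1 / t z ^ (w $ 1), G z $ 2 / t z ^ (w $ 2))" for z
  show ?thesis
  proof (rule that[of H "H (a0, 1)"])
    have c\<tau>: "continuous_on (A \<times> {0..1}) \<tau>"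
      unfolding \<tau>_def using \<sigma> r0
      by (intro continuous_on_divide continuous_on_const continuous_on_component cG) auto
    have ct: "continuous_on (A \<times> {0..1}) t"
      unfolding t_def
    proof (intro continuous_on_mult continuous_on_const continuous_on_exp continuous_on_divide continuous_on_Ln' c\<tau>)
      show "\<tau> z \<notin> \<real>\<^sub>\<le>\<^sub>0" if "z \<in> A \<times> {0..1}" for z using \<tau>_Re[OF that] by (auto simp: complex_nonpos_Reals_iff)
    qed (use w[of 3] in simp)
    show "continuous_on (A \<times> {0..1}) H"
      unfolding H_def using t0
      by (intro continuous_on_Pair continuous_on_divide continuous_on_power continuous_on_component cG ct) auto
    show "vec3 (fst (H z)) (snd (H z)) (of_real r0) \<in> X" if z: "z \<in> A \<times> {0..1}" for z
    proof -
      have "weighted_act w (1 / t z) (G z) \<in> X" using GX z t0 by (intro inv) auto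
      moreover have "\<tau> z \<noteq> 0" using \<tau>_Re[OF z] by auto
      then have "weighted_act w (1 / t z) (G z) = vec3 (fst (H z)) (snd (H z)) (of_real r0)"
        using tw[OF z] \<sigma> r0 by (simp add: vec3_eq_iff H_def power_divide) (simp add: \<tau>_def)
      ultimately show ?thesis by simp
    qed
    show "H (a, 0) = (of_real (Re a), of_real (Im a))" if a: "a \<in> A" for a
    proof -
      have "\<tau> (a, 0) = 1" using G0[OF a] \<sigma> r0 by (simp add: \<tau>_def j_def P_def \<sigma>_def)
      then have "t (a, 0) = \<sigma>" by (simp add: t_def)
      then show ?thesis using G0[OF a] \<sigma> by (simp add: H_def j_def P_def flip: \<sigma>_def)
    qed
    show "H (a, 1) = H (a0, 1)" if "a \<in> A" for a
      using G1[OF that] G1[OF A(3)] by (simp add: H_def t_def \<tau>_def)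
  qed
qed

section \<open>Real points of the surface and compactness of the real slice\<close>

lemma keys_complexify: "Poly_Mapping.keys (complexify p) = Poly_Mapping.keys p"
  and lookup_complexify: "Poly_Mapping.lookup (complexify p) m = of_real (Poly_Mapping.lookup p m)"
proof -
  have l: "Poly_Mapping.lookup (complexify p) m = of_real (Poly_Mapping.lookup p m)" for m
    by (simp add: complexify_def Poly_Mapping.map.rep_eq when_def)
  then show "Poly_Mapping.lookup (complexify p) m = of_real (Poly_Mapping.lookup p m)" by simp
  show "Poly_Mapping.keys (complexify p) = Poly_Mapping.keys p"
    by (auto simp: in_keys_iff l)
qed

lemma mpoly_eval_complexify_of_real:
  "mpoly_eval (complexify p) (\<chi> i. of_real (x $ i)) = of_real (mpoly_eval p x)"
  by (simp add: mpoly_eval_def keys_complexify lookup_complexify)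

lemma mpoly_eval_complexify_cnj:
  "mpoly_eval (complexify p) (\<chi> i. cnj (x $ i)) = cnj (mpoly_eval (complexify p) x)"
  by (simp add: mpoly_eval_def keys_complexify lookup_complexify)

text \<open>Every real orbit through the slice meets the unit sphere. On the compact set of real
  unit vectors of \<open>X\<close> the third coordinate is bounded away from 0 by \<open>nz\<close>,
  so the scaling t that reaches the sphere is bounded below. The coordinates of the slice point are
  at most 1 / t^w1 and 1 / t^w2.\<close>

lemma real_slice_bounded:
  fixes X :: "(complex ^ 3) set" and w :: "nat ^ 3" and r0 :: real
  assumes w: "\<And>i. w $ i > 0" and inv: "\<And>t x. t \<noteq> 0 \<Longrightarrow> x \<in> X \<Longrightarrow> weighted_act w t x \<in> X"
    and cl: "closed X" and r0: "r0 \<noteq> 0"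
    and nz: "\<And>x. x \<in> X \<Longrightarrow> (\<And>i. Im (x $ i) = 0) \<Longrightarrow> x $ 3 = 0 \<Longrightarrow> x = 0"
  shows "bounded {a. vec3 (of_real (Re a)) (of_real (Im a)) (of_real r0) \<in> X}"
proof (cases "{a. vec3 (of_real (Re a)) (of_real (Im a)) (of_real r0) \<in> X} = {}")
  case True
  then show ?thesis by simp
next
  case False
  define S where "S = {x. \<forall>i. Im (x $ i) = 0} \<inter> X \<inter> sphere (0 :: complex ^ 3) 1"
  have "closed {x :: complex ^ 3. \<forall>i. Im (x $ i) = 0}"
    by (intro closed_Collect_all closed_Collect_eq continuous_intros)
  then have S: "compact S" unfolding S_def by (intro closed_Int_compact closed_Int cl) auto
  have T: "\<exists>t. 0 < t \<and> weighted_act w (of_real t) x \<in> S" if x: "x \<in> X" "\<And>i. Im (x $ i) = 0" "x $ 3 = of_real r0" for x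
  proof -
    \<comment> \<open>At scaling \<open>u\<close> the third coordinate alone gives norm at least 1,
      as u^w3 |r0| \<ge> u |r0| \<ge> 1.\<close>
    define u where "u = 1 + 1 / \<bar>r0\<bar>"
    have u: "u \<ge> 1" "u * \<bar>r0\<bar> \<ge> 1" using r0 by (auto simp: u_def algebra_simps)
    have "\<exists>t\<ge>0. t \<le> u \<and> norm (weighted_act w (of_real t) x) = 1"
    proof (rule IVT')
      have "weighted_act w (of_real 0) x = 0" using w by (simp add: vec_eq_iff)
      then show "norm (weighted_act w (of_real 0) x) \<le> 1" by simp
      have "1 \<le> u * \<bar>r0\<bar>" by (rule u)
      also have "\<dots> \<le> u ^ (w $ 3) * \<bar>r0\<bar>"
        using u power_increasing[of 1 "w $ 3" u] w[of 3] by (intro mult_right_mono) auto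
      also have "\<dots> = norm (weighted_act w (of_real u) x $ 3)"
        using x(3) u by (simp add: norm_mult norm_power)
      also have "\<dots> \<le> norm (weighted_act w (of_real u) x)" by (rule Finite_Cartesian_Product.norm_nth_le)
      finally show "1 \<le> norm (weighted_act w (of_real u) x)" .
      show "continuous_on {0..u} (\<lambda>t. norm (weighted_act w (of_real t) x))"
        unfolding weighted_act_def
        by (intro continuous_on_norm continuous_on_vec_lambda continuous_on_mult continuous_on_power
            continuous_on_of_real continuous_on_id continuous_on_const)
    qed (use u in simp)
    then obtain t where t: "t \<ge> 0" "norm (weighted_act w (of_real t) x) = 1" by blast
    have "t \<noteq> 0"
    proof
      assume "t = 0"
      then have "weighted_act w (of_real t) x = 0" using w by (simp add: vec_eq_iff)
      with t(2) show False by simp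
    qed
    with t have t0: "t > 0" by simp
    moreover have "weighted_act w (of_real t) x \<in> S"
      unfolding S_def using t t0 x inv[of "of_real t" x] by (simp flip: of_real_power)
    ultimately show ?thesis by blast
  qed
  have im0: "Im (vec3 (complex_of_real x) (complex_of_real y) (complex_of_real z) $ i) = 0" for x y z i
    by (simp add: vec3_def)
  obtain a1 where "vec3 (of_real (Re a1)) (of_real (Im a1)) (of_real r0) \<in> X" using False by blast
  then have "S \<noteq> {}" using T[OF _ im0 vec3_nth(3)] by blast
  have "continuous_on S (\<lambda>x. norm (x $ 3))" by (intro continuous_intros)
  then obtain x0 where x0: "x0 \<in> S" "\<And>x. x \<in> S \<Longrightarrow> norm (x0 $ 3) \<le> norm (x $ 3)"
    using continuous_attains_inf[OF S \<open>S \<noteq> {}\<close>] by blast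
  define \<delta> where "\<delta> = norm (x0 $ 3)"
  have "x0 $ 3 \<noteq> 0" using nz[of x0] x0(1) by (auto simp: S_def)
  then have \<delta>: "\<delta> > 0" by (simp add: \<delta>_def)
  \<comment> \<open>If t < 1 then t^w3 \<le> t, so t \<ge> \<delta> / |r0|; the minimum with 1
    covers the other case.\<close>
  define t0 where "t0 = min 1 (\<delta> / \<bar>r0\<bar>)"
  have t0: "t0 > 0" using \<delta> r0 by (simp add: t0_def)
  have bnd: "\<bar>Re a\<bar> \<le> 1 / t0 ^ (w $ 1) \<and> \<bar>Im a\<bar> \<le> 1 / t0 ^ (w $ 2)"
    if a: "vec3 (of_real (Re a)) (of_real (Im a)) (of_real r0) \<in> X" for a
  proof -
    let ?x = "vec3 (complex_of_real (Re a)) (complex_of_real (Im a)) (complex_of_real r0)"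
    obtain t where t: "0 < t" "weighted_act w (of_real t) ?x \<in> S" using T[OF a im0 vec3_nth(3)] by blast
    have n1: "norm (weighted_act w (of_real t) ?x) = 1" using t(2) by (simp add: S_def)
    have "\<delta> \<le> t ^ (w $ 3) * \<bar>r0\<bar>"
      using x0(2)[OF t(2)] t(1) by (simp add: \<delta>_def norm_mult norm_power)
    then have 3: "\<delta> / \<bar>r0\<bar> \<le> t ^ (w $ 3)" using r0 by (simp add: divide_le_eq)
    have tt: "t0 \<le> t"
    proof (cases "t \<ge> 1")
      case False
      then have "t ^ (w $ 3) \<le> t ^ 1" using t(1) w[of 3] by (intro power_decreasing) auto
      with 3 show ?thesis by (simp add: t0_def)
    qed (simp add: t0_def)
    have "t0 ^ (w $ 1) * \<bar>Re a\<bar> \<le> t ^ (w $ 1) * \<bar>Re a\<bar>" using tt t0 by (intro mult_right_mono power_mono) auto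
    also have "\<dots> \<le> 1" using Finite_Cartesian_Product.norm_nth_le[of "weighted_act w (of_real t) ?x" 1] n1 t(1) by (simp add: norm_mult norm_power)
    finally have 1: "\<bar>Re a\<bar> \<le> 1 / t0 ^ (w $ 1)" using t0 by (simp add: le_divide_eq mult.commute)
    have "t0 ^ (w $ 2) * \<bar>Im a\<bar> \<le> t ^ (w $ 2) * \<bar>Im a\<bar>" using tt t0 by (intro mult_right_mono power_mono) auto
    also have "\<dots> \<le> 1" using Finite_Cartesian_Product.norm_nth_le[of "weighted_act w (of_real t) ?x" 2] n1 t(1) by (simp add: norm_mult norm_power)
    finally have 2: "\<bar>Im a\<bar> \<le> 1 / t0 ^ (w $ 2)" using t0 by (simp add: le_divide_eq mult.commute)
    from 1 2 show ?thesis by blast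
  qed
  show ?thesis
    unfolding bounded_iff
  proof (intro exI[of _ "1 / t0 ^ (w $ 1) + 1 / t0 ^ (w $ 2)"] ballI)
    fix a assume "a \<in> {a. vec3 (of_real (Re a)) (of_real (Im a)) (of_real r0) \<in> X}"
    then show "norm a \<le> 1 / t0 ^ (w $ 1) + 1 / t0 ^ (w $ 2)"
      using bnd[of a] cmod_le[of a] by simp
  qed
qed

section \<open>A compact real curve in the slice against a conic structure at 0\<close>

theorem theorem5p3:
  fixes w :: "nat ^ 3" and f :: "(3, real) mpoly"
    and X :: "(complex ^ 3) set" and XR :: "(real ^ 3) set"
  assumes w_pos: "\<And>i. w $ i > 0"
    and w_coprime: "gcd (w $ 1) (gcd (w $ 2) (w $ 3)) = 1"
    and f_wh: "weighted_homogeneous w (complexify f)"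
    and X_eq: "X = zero_set (complexify f)"
    and X_irreducible: "irreducible_algebraic_set X"
    and X_isolated: "0 isolated_in singular_points X"
    and XR_eq: "XR = zero_set f"
    and weights: "2 * w $ 3 < min (w $ 1) (w $ 2)"
    and XR_nontrivial: "XR \<noteq> {0}"
    and XR_coordinate_planes: "XR \<inter> {x. x $ 1 * x $ 2 * x $ 3 = 0} = {0}"
  shows "\<not> strongly_metrically_conic X 0"
proof
  assume conic: "strongly_metrically_conic X 0"
  define q where "q = complexify f"
  have Xq: "X = zero_set q" by (simp add: X_eq q_def)
  have inv: "weighted_act w t x \<in> X" if "t \<noteq> 0" "x \<in> X" for t x
    using f_wh that unfolding weighted_homogeneous_def Xq zero_set_def weighted_act_def q_def by auto
  have real_mem: "(\<chi> i. of_real (x $ i)) \<in> X \<longleftrightarrow> x \<in> XR" for x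
    by (simp add: Xq q_def XR_eq zero_set_def mpoly_eval_complexify_of_real)
  have nz: "x = 0" if "x \<in> X" "\<And>i. Im (x $ i) = 0" "x $ 3 = 0" for x
  proof -
    have xr: "(\<chi> i. of_real ((\<chi> i. Re (x $ i)) $ i)) = x"
      using that(2) by (simp add: vec_eq_iff complex_eq_iff)
    then have "(\<chi> i. Re (x $ i)) \<in> XR" using that(1) real_mem by metis
    moreover have "(\<chi> i. Re (x $ i)) \<in> {x. x $ 1 * x $ 2 * x $ 3 = 0}" using that(3) by simp
    ultimately have "(\<chi> i. Re (x $ i)) = 0" using XR_coordinate_planes by blast
    with xr show ?thesis by (simp add: vec_eq_iff complex_eq_iff)
  qed
  \<comment> \<open>The real point (1, 0, 0) lies on a coordinate plane, hence off \<open>X\<close>,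
    and witnesses that the polynomial function is not identically zero.\<close>
  have q_nz: "mpoly_eval q (vec3 1 0 0) \<noteq> 0"
  proof
    assume "mpoly_eval q (vec3 1 0 0) = 0"
    then have "vec3 1 0 0 \<in> X" by (simp add: Xq zero_set_def)
    moreover have "Im (vec3 1 0 0 $ i) = 0" for i by (simp add: vec3_def)
    ultimately have "vec3 1 0 0 = (0 :: complex ^ 3)" using nz by simp
    then show False using vec3_nth(1)[of "1::complex" 0 0] by simp
  qed
  have "0 \<in> XR" using XR_coordinate_planes by blast
  with XR_nontrivial obtain b where b: "b \<in> XR" "b \<noteq> 0" by blast
  define r0 where "r0 = b $ 3"
  have r0: "r0 \<noteq> 0"
    using b XR_coordinate_planes unfolding r0_def by force
  have clX: "closed X"
    unfolding Xq zero_set_def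
    by (intro closed_Collect_eq continuous_on_mpoly_eval continuous_on_const)
  obtain \<delta> where \<delta>: "\<delta> > 0" "\<And>y. y \<in> singular_points X \<Longrightarrow> dist 0 y < \<delta> \<Longrightarrow> y = 0"
    using X_isolated unfolding isolated_in_dist_Ex_iff by blast
  have reg: "x \<in> regular_points (zero_set q)" if "x \<in> zero_set q" "x \<noteq> 0" "norm x < \<delta>" for x
    using \<delta>(2)[of x] that by (auto simp: singular_points_def Xq)
  define C where "C = {c. vec3 (fst c) (snd c) (of_real r0) \<in> X}"
  define Kr where "Kr = {a. real_point a \<in> C}"
  have Kr: "Kr = {a. vec3 (of_real (Re a)) (of_real (Im a)) (of_real r0) \<in> X}"
    by (simp add: Kr_def C_def real_point_def)
  have graph: "graph_at C c \<or> graph_at (prod.swap ` C) (prod.swap c)" if "c \<in> C" for c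
    unfolding C_def Xq
    by (rule slice_graph[OF q_nz w_pos inv[unfolded Xq] reg \<delta>(1)]) (use r0 that in \<open>auto simp: C_def Xq\<close>)
  have chart: "curve_chart C c" if "c \<in> C" for c
    using graph[OF that]
  proof
    assume "graph_at C c"
    then show ?thesis using that by (rule curve_chart_graph)
  next
    assume "graph_at (prod.swap ` C) (prod.swap c)"
    then show ?thesis by (rule curve_chart_swap[OF curve_chart_graph[OF _ imageI[OF that]]])
  qed
  have cnjC: "(cnj z, cnj v) \<in> C" if "(z, v) \<in> C" for z v
  proof -
    have "vec3 (cnj z) (cnj v) (of_real r0) = (\<chi> i. cnj (vec3 z v (of_real r0) $ i))"
      by (simp add: vec_eq_iff forall_3)
    then show ?thesis using that
      by (simp add: C_def Xq zero_set_def q_def mpoly_eval_complexify_cnj)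
  qed
  have arcK: "\<exists>N r e e' \<pi>. arc_chart Kr a N r e e' \<pi>" if a: "a \<in> Kr" for a
  proof -
    have aC: "real_point a \<in> C" using a by (simp add: Kr_def)
    from graph[OF aC] show ?thesis
    proof
      assume "graph_at C (real_point a)"
      from arc_chart_graph[OF this aC cnjC] show ?thesis unfolding Kr_def by blast
    next
      \<comment> \<open>Reflection in the diagonal reduces this case to a graph over the first
        coordinate.\<close>
      assume g: "graph_at (prod.swap ` C) (prod.swap (real_point a))"
      have sw: "prod.swap (real_point b) = real_point (\<i> * cnj b)" for b by (simp add: real_point_def)
      have aC': "real_point (\<i> * cnj a) \<in> prod.swap ` C" using aC unfolding sw[symmetric] by blast
      have "\<exists>N r e e' \<pi>. arc_chart {b. real_point b \<in> prod.swap ` C} (\<i> * cnj a) N r e e' \<pi>"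
        by (rule arc_chart_graph[OF g[unfolded sw] aC']) (use cnjC in auto)
      then obtain N r e e' \<pi> where "arc_chart {b. real_point b \<in> prod.swap ` C} (\<i> * cnj a) N r e e' \<pi>" by blast
      from arc_chart_reflect[OF this]
      have "\<exists>N r e e' \<pi>. arc_chart {b. \<i> * cnj b \<in> {b. real_point b \<in> prod.swap ` C}} a N r e e' \<pi>" by blast
      moreover have "{b. \<i> * cnj b \<in> {b. real_point b \<in> prod.swap ` C}} = Kr"
      proof -
        have "prod.swap x \<in> prod.swap ` C \<longleftrightarrow> x \<in> C" for x
        proof
          assume "prod.swap x \<in> prod.swap ` C"
          then obtain y where "y \<in> C" "prod.swap x = prod.swap y" by (rule imageE)
          then have "x = y" by (simp add: prod_eq_iff)
          with \<open>y \<in> C\<close> show "x \<in> C" by simp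
        qed (rule imageI)
        then show ?thesis unfolding mem_Collect_eq sw[symmetric] Kr_def by (simp only:)
      qed
      ultimately show ?thesis by simp
    qed
  qed
  define a0 where "a0 = Complex (b $ 1) (b $ 2)"
  have "vec3 (of_real (Re a0)) (of_real (Im a0)) (of_real r0) = (\<chi> i. complex_of_real (b $ i))"
    by (simp add: vec_eq_iff forall_3 a0_def r0_def)
  then have a0K: "a0 \<in> Kr" using b real_mem[of b] by (simp add: Kr)
  have "bounded Kr" unfolding Kr
    by (rule real_slice_bounded[OF w_pos inv clX r0 nz])
  moreover have "closed Kr"
  proof -
    have "continuous_on UNIV (\<lambda>a. vec3 (complex_of_real (Re a)) (complex_of_real (Im a)) (complex_of_real r0))"
      unfolding vec3_def
    proof (rule continuous_on_vec_lambda)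
      fix i :: 3
      show "continuous_on UNIV (\<lambda>a. if i = 1 then complex_of_real (Re a) else if i = 2 then complex_of_real (Im a) else complex_of_real r0)"
        by (cases "i = 1"; cases "i = 2") (auto intro!: continuous_intros)
    qed
    from closed_vimage[OF clX this] show ?thesis by (simp add: Kr vimage_def)
  qed
  ultimately have Kc: "compact Kr" by (simp add: compact_eq_bounded_closed)
  define A where "A = connected_component_set Kr a0"
  have "A \<in> components Kr" unfolding A_def using a0K by (rule componentsI)
  then have A: "compact A" "connected A" "A \<subseteq> Kr"
    using compact_components[OF Kc] in_components_connected in_components_subset by blast+
  have a0A: "a0 \<in> A" unfolding A_def using a0K by simp
  have arcA: "\<exists>N r e e' \<pi>. arc_chart A a N r e e' \<pi>" if "a \<in> A" for a
  proof -
    have "a \<in> Kr" using that A(3) by blast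
    from arcK[OF this] obtain N r e e' \<pi> where "arc_chart Kr a N r e e' \<pi>" by blast
    from arc_chart_component[OF this that[unfolded A_def]] show ?thesis unfolding A_def by blast
  qed
  have "\<forall>\<^sub>F \<epsilon> in at_right (0::real). \<epsilon> < \<delta>" by (rule eventually_at_rightI[of 0 \<delta>]) (use \<delta> in auto)
  moreover have "\<forall>\<^sub>F \<epsilon> in at_right (0::real). \<epsilon> > 0" by (simp add: eventually_at_filter)
  moreover note conic[unfolded strongly_metrically_conic_def]
  ultimately have "\<forall>\<^sub>F \<epsilon> in at_right (0::real). \<epsilon> > 0 \<and> \<epsilon> < \<delta> \<and> (\<exists>h k.
      homeomorphism (cone_over 0 (X \<inter> sphere 0 \<epsilon>)) (X \<inter> cball 0 \<epsilon>) h k \<and>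
      inner_bi_lipschitz (cone_over 0 (X \<inter> sphere 0 \<epsilon>)) (X \<inter> cball 0 \<epsilon>) h)"
    by eventually_elim blast
  then obtain \<epsilon> h k where \<epsilon>: "\<epsilon> > 0" "\<epsilon> < \<delta>"
    and hk: "homeomorphism (cone_over 0 (X \<inter> sphere 0 \<epsilon>)) (X \<inter> cball 0 \<epsilon>) h k"
    and bl: "inner_bi_lipschitz (cone_over 0 (X \<inter> sphere 0 \<epsilon>)) (X \<inter> cball 0 \<epsilon>) h"
    using eventually_happens'[OF trivial_limit_at_right_real] by blast
  \<comment> \<open>As \<epsilon> < \<delta>, the isolated singularity leaves only regular points on
    the link.\<close>
  have lc: "lipschitz_contractible_at (X \<inter> sphere 0 \<epsilon>) y" if y: "y \<in> X \<inter> sphere 0 \<epsilon>" for y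
  proof -
    have "y \<in> regular_points (zero_set q)" using y \<epsilon> by (intro reg) (auto simp: Xq)
    then show ?thesis unfolding Xq
      by (rule link_lipschitz_contractible[OF _ _ \<epsilon>(1) q_nz w_pos inv[unfolded Xq]]) (use y in auto)
  qed
  have Lc: "compact (X \<inter> sphere 0 \<epsilon>)" by (intro closed_Int_compact clX) auto
  have w3: "w $ 3 < min (w $ 1) (w $ 2)" using weights by simp
  have AX: "vec3 (of_real (Re a)) (of_real (Im a)) (of_real r0) \<in> X" if "a \<in> A" for a
    using that A(3) Kr by blast
  obtain H c1 where H: "continuous_on (A \<times> {0..1::real}) H"
    "\<And>z. z \<in> A \<times> {0..1} \<Longrightarrow> vec3 (fst (H z)) (snd (H z)) (of_real r0) \<in> X"
    "\<And>a. a \<in> A \<Longrightarrow> H (a, 0) = (of_real (Re a), of_real (Im a))" "\<And>a. a \<in> A \<Longrightarrow> H (a, 1) = c1"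
    using conic_slice_nullhomotopic[OF w_pos w3 inv \<epsilon>(1) Lc lc hk bl r0 A(1,2) a0A AX arcA] by blast
  have HC: "H ` (A \<times> {0..1}) \<subseteq> C" using H(2) unfolding C_def by blast
  have "forms_exact_on A"
    unfolding forms_exact_on_def
  proof (intro allI impI)
    fix P1 P2 :: "complex \<Rightarrow> real" assume P: "real_polynomial_function P1" "real_polynomial_function P2"
    obtain F :: "complex \<Rightarrow> real"
      where F: "\<And>a. a \<in> A \<Longrightarrow> (F has_derivative (\<lambda>h. P1 a * Re h + P2 a * Im h)) (at a within A)"
      using nullhomotopic_forms_exact[OF A(1) chart H(1) HC H(3,4) P] by blast
    show "\<exists>F::complex \<Rightarrow> real. \<forall>a\<in>A. (F has_derivative (\<lambda>h. P1 a * Re h + P2 a * Im h)) (at a within A)"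
      by (rule exI[of _ F], rule ballI, rule F)
  qed
  moreover have "\<not> forms_exact_on A"
    by (rule no_exact_closed_curve[OF A(1,2) _ arcA]) (use a0A in blast)
  ultimately show False by contradiction
qed

end
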